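(* Let $\Lambda\subset[0,1]^d$ be a non-degenerated Lalley-Gatzouras type sponge, and let $\mu$ be its canonical Bernoulli measure. Then the following statements are equivalent: (i) $\mu$ is a component-counting measure of $\Lambda$. (ii) $\Lambda$ satisfies the maximal power law. (iii) For every $1\le j\le d$, the set $V_j=(0,1)^j$ contains trivial points of $\Lambda_j=\pi_j(\Lambda)$. (iv) For every $1\le j\le d$, the set of trivial points of $\Lambda_j$ is dense in $\Lambda_j$.
   Context: Diagonal self-affine sponges. Let $d\ge1$. For each $i\in\{1,\dots,d\}$ let $A_i=\{0,1,\dots,n_i-1\}$ with $n_i\ge2$, and let $(\phi_{a,i})_{a\in A_i}$ be contracting similarities of $[0,1]$ into itself with positive ratios ($\phi_{a,i}(x)=rx+t$, $0<r<1$; $\phi_{a,i}'$ denotes the constant $r$). Let $A=\prod_{i=1}^d A_i$; for $a=(a_1,\dots,a_d)\in A$ let $\phi_a(x_1,\dots,x_d)=(\phi_{a,1}(x_1),\dots,\phi_{a,d}(x_d))$, where $\phi_{a,i}$ is shorthand for $\phi_{a_i,i}$. For nonempty $\mathcal{D}\subset A$, $\Phi=(\phi_a)_{a\in\mathcal{D}}$ (all maps distinct) is a diagonal IFS and its attractor $\Lambda$ (the unique nonempty compact set with $\Lambda=\bigcup_{a\in\mathcal D}\phi_a(\Lambda)$) is a diagonal self-affine sponge. For $1\le j\le d$ let $\pi_j(x_1,\dots,x_d)=(x_1,\dots,x_j)$ and $\Phi_{\{1,\dots,j\}}=\big((\phi_{a,1},\dots,\phi_{a,j})\big)_{a\in\pi_j(\mathcal{D})}$,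 an IFS on $\mathbb{R}^j$ with attractor $\Lambda_j=\pi_j(\Lambda)$. $\Lambda$ is of Lalley-Gatzouras type if (coordinate ordering condition) $\phi'_{a,1}>\dots>\phi'_{a,d}$ for all $a\in\mathcal{D}$, and (neat projection condition) for each $j\in\{1,\dots,d\}$ the images of $(0,1)^j$ under the maps of $\Phi_{\{1,\dots,j\}}$, indexed by $\pi_j(\mathcal{D})$, are pairwise disjoint. $\Lambda$ is non-degenerated if it is not contained in a $(d-1)$-dimensional face of $[0,1]^d$. Canonical Bernoulli measure. Define $\beta_1,\dots,\beta_d$ inductively: $\beta_j$ is the unique real number with $\sum_{(f_1,\dots,f_j)\in\Phi_{\{1,\dots,j\}}}\prod_{k=1}^j(f_k')^{\beta_k}=1$. The canonical Bernoulli measure $\mu$ of $\Lambda$ is the unique Borel probability measure with $\mu(\cdot)=\sum_{\mathbf f\in\Phi}p_{\mathbf f}\,\mu(\mathbf f^{-1}(\cdot))$, where $p_{\mathbf f}=\prod_{k=1}^d(f_k')^{\beta_k}$ for $\mathbf f=(f_1,\dots,f_d)$. Cylinders of $\Lambda$: sets $\phi_{i_1}\circ\dots\circ\phi_{i_n}(\Lambda)$, $n\ge0$, $i_1,\dots,i_n\in\mathcal{D}$. Counting components. For a metric space $(E,\rho)$ and $\delta>0$, $x,y\in E$ are $\delta$-equivalent if there is a finite sequence $x=x_1,\dots,x_k=y$ in $E$ with $\rho(x_i,x_{i+1})\le\delta$ for all $i$; the equivalence classes are the $\delta$-connected components and $h_E(\delta)$ is their number. A compact $E$ satisfies the maximal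 power law if $h_E(\delta)\asymp\delta^{-\dim_B E}$ as $\delta\to0$, i.e. the two sides are within a constant multiplicative factor of each other for all small $\delta>0$ ($\dim_B$ is box dimension). A finite Borel measure $\mu$ on $\Lambda$ is a component-counting measure of $\Lambda$ if there is $M\ge1$ such that for every cylinder $R$ of $\Lambda$ there is $\delta_0(R)>0$ with $M^{-1}\mu(R)\delta^{-\dim_B\Lambda}\le h_R(\delta)\le M\mu(R)\delta^{-\dim_B\Lambda}$ for all $0<\delta<\delta_0(R)$. A point $x\in E$ is a trivial point of $E$ if $\{x\}$ is a connected component of $E$. *)

theory Defs
  imports "HOL-Probability.Probability" "HOL-Library.Landau_Symbols"
begin

text \<open>
  The coordinates $1 < \dots < d$ are the elements of a finite linearly ordered type \<open>'n\<close>, so that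
  $d \ge 1$ is \<open>CARD('n)\<close>, and an index $j \in \{1,\dots,d\}$ is an element of \<open>'n\<close>.
  The space $R^j$ is identified with the coordinate subspace of \<open>real ^ 'n\<close> in which all
  coordinates above \<open>j\<close> are \<open>0\<close>; this identification is isometric.
\<close>

section \<open>Diagonal iterated function systems\<close>

text \<open>The map with index \<open>b\<close> in coordinate \<open>i\<close> is \<open>\<lambda>x. r i b * x + t i b\<close>.\<close>

definition sponge_map ::
    "('n \<Rightarrow> nat \<Rightarrow> real) \<Rightarrow> ('n \<Rightarrow> nat \<Rightarrow> real) \<Rightarrow> ('n \<Rightarrow> nat) \<Rightarrow> real ^ 'n \<Rightarrow> real ^ 'n"
  where "sponge_map r t a x = (\<chi> i. r i (a i) * x $ i + t i (a i))"

definition diagonal_ifs ::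
    "('n \<Rightarrow> nat) \<Rightarrow> ('n \<Rightarrow> nat \<Rightarrow> real) \<Rightarrow> ('n \<Rightarrow> nat \<Rightarrow> real) \<Rightarrow> ('n::finite \<Rightarrow> nat) set \<Rightarrow> bool"
  where "diagonal_ifs n r t D \<longleftrightarrow>
    (\<forall>i. 2 \<le> n i) \<and>
    (\<forall>i. \<forall>b<n i. 0 < r i b \<and> r i b < 1 \<and> (\<lambda>x. r i b * x + t i b) ` {0..1} \<subseteq> {0..1}) \<and>
    D \<noteq> {} \<and> D \<subseteq> (\<Pi> i\<in>UNIV. {..<n i}) \<and> inj_on (sponge_map r t) D"

definition is_attractor ::
    "('n \<Rightarrow> nat \<Rightarrow> real) \<Rightarrow> ('n \<Rightarrow> nat \<Rightarrow> real) \<Rightarrow> ('n::finite \<Rightarrow> nat) set \<Rightarrow> (real ^ 'n) set \<Rightarrow> bool"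
  where "is_attractor r t D L \<longleftrightarrow>
    compact L \<and> L \<noteq> {} \<and> L = (\<Union>a\<in>D. sponge_map r t a ` L)"

definition cylinders ::
    "('n \<Rightarrow> nat \<Rightarrow> real) \<Rightarrow> ('n \<Rightarrow> nat \<Rightarrow> real) \<Rightarrow> ('n::finite \<Rightarrow> nat) set \<Rightarrow> (real ^ 'n) set
      \<Rightarrow> (real ^ 'n) set set"
  where "cylinders r t D L = {foldr (sponge_map r t) w ` L | w. w \<in> lists D}"

section \<open>Sponges of Lalley-Gatzouras type\<close>

definition coord_proj :: "'n \<Rightarrow> real ^ 'n::{finite,linorder} \<Rightarrow> real ^ 'n::{finite,linorder}"
  where "coord_proj j x = (\<chi> i. if i \<le> j then x $ i else 0)"

definition open_cube :: "'n \<Rightarrow> (real ^ 'n::{finite,linorder}) set"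
  where "open_cube j = {x. (\<forall>i\<le>j. 0 < x $ i \<and> x $ i < 1) \<and> (\<forall>i>j. x $ i = 0)}"

definition proj_digits :: "'n::linorder \<Rightarrow> ('n \<Rightarrow> nat) set \<Rightarrow> ('n \<Rightarrow> nat) set"
  where "proj_digits j D = (\<lambda>a. restrict a {..j}) ` D"

text \<open>
  Under the identification above, the map $(\phi_{a,1},\dots,\phi_{a,j})$ of $R^j$ is
  \<open>coord_proj j \<circ> sponge_map r t a\<close>, which depends only on the restriction of \<open>a\<close> to \<open>{..j}\<close>.
\<close>

definition neat_projection ::
    "('n \<Rightarrow> nat \<Rightarrow> real) \<Rightarrow> ('n \<Rightarrow> nat \<Rightarrow> real) \<Rightarrow> ('n::{finite,linorder} \<Rightarrow> nat) set \<Rightarrow> bool"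
  where "neat_projection r t D \<longleftrightarrow>
    (\<forall>j. disjoint_family_on (\<lambda>a. (coord_proj j \<circ> sponge_map r t a) ` open_cube j) (proj_digits j D))"

definition coordinate_ordering ::
    "('n \<Rightarrow> nat \<Rightarrow> real) \<Rightarrow> ('n::linorder \<Rightarrow> nat) set \<Rightarrow> bool"
  where "coordinate_ordering r D \<longleftrightarrow> (\<forall>a\<in>D. \<forall>i j. i < j \<longrightarrow> r i (a i) > r j (a j))"

definition lalley_gatzouras ::
    "('n \<Rightarrow> nat \<Rightarrow> real) \<Rightarrow> ('n \<Rightarrow> nat \<Rightarrow> real) \<Rightarrow> ('n::{finite,linorder} \<Rightarrow> nat) set \<Rightarrow> bool"
  where "lalley_gatzouras r t D \<longleftrightarrow> coordinate_ordering r D \<and> neat_projection r t D"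

definition nondegenerated :: "(real ^ 'n::finite) set \<Rightarrow> bool"
  where "nondegenerated L \<longleftrightarrow> \<not> (\<exists>F. F facet_of cbox 0 1 \<and> L \<subseteq> F)"

section \<open>The canonical Bernoulli measure\<close>

text \<open>
  The system of equations in \<open>canonical_exponents\<close> is triangular: the equation for \<open>j\<close> determines
  \<open>\<beta> j\<close> from the earlier exponents, so the whole family \<open>\<beta>\<close> is uniquely determined.
  By the neat projection condition the maps of the projected system are in bijection with
  \<open>proj_digits j D\<close>.
\<close>

definition canonical_exponents ::
    "('n \<Rightarrow> nat \<Rightarrow> real) \<Rightarrow> ('n::{finite,linorder} \<Rightarrow> nat) set \<Rightarrow> ('n \<Rightarrow> real) \<Rightarrow> bool"
  where "canonical_exponents r D \<beta> \<longleftrightarrow>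
    (\<forall>j. (\<Sum>a\<in>proj_digits j D. \<Prod>k\<in>{..j}. r k (a k) powr \<beta> k) = 1)"

definition canonical_Bernoulli_measure ::
    "('n \<Rightarrow> nat \<Rightarrow> real) \<Rightarrow> ('n \<Rightarrow> nat \<Rightarrow> real) \<Rightarrow> ('n \<Rightarrow> nat) set
      \<Rightarrow> (real ^ 'n::{finite,linorder}) measure \<Rightarrow> bool"
  where "canonical_Bernoulli_measure r t D \<mu> \<longleftrightarrow>
    prob_space \<mu> \<and> sets \<mu> = sets borel \<and>
    (\<exists>\<beta>. canonical_exponents r D \<beta> \<and>
      (\<forall>B\<in>sets borel. measure \<mu> B =
        (\<Sum>a\<in>D. (\<Prod>k\<in>UNIV. r k (a k) powr \<beta> k) * measure \<mu> (sponge_map r t a -` B))))"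

section \<open>Box dimension and counting of components\<close>

definition covering_number :: "'a::metric_space set \<Rightarrow> real \<Rightarrow> nat"
  where "covering_number E \<delta> = Inf {card C | C. finite C \<and> E \<subseteq> (\<Union>x\<in>C. cball x \<delta>)}"

text \<open>Meaningful only if the limit exists, which is the case for Lalley-Gatzouras type sponges.\<close>

definition box_dim :: "'a::metric_space set \<Rightarrow> real"
  where "box_dim E = Lim (at_right 0) (\<lambda>\<delta>. ln (real (covering_number E \<delta>)) / ln (1 / \<delta>))"

definition chain_equiv :: "'a::metric_space set \<Rightarrow> real \<Rightarrow> ('a \<times> 'a) set"
  where "chain_equiv E \<delta> = {(x, y). x \<in> E \<and> y \<in> E \<and> dist x y \<le> \<delta>}\<^sup>+"

definition component_count :: "'a::metric_space set \<Rightarrow> real \<Rightarrow> nat"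
  where "component_count E \<delta> = card (E // chain_equiv E \<delta>)"

definition maximal_power_law :: "'a::metric_space set \<Rightarrow> bool"
  where "maximal_power_law E \<longleftrightarrow>
    (\<lambda>\<delta>. real (component_count E \<delta>)) \<in> \<Theta>[at_right 0](\<lambda>\<delta>. \<delta> powr (- box_dim E))"

definition component_counting_measure ::
    "('n \<Rightarrow> nat \<Rightarrow> real) \<Rightarrow> ('n \<Rightarrow> nat \<Rightarrow> real) \<Rightarrow> ('n::finite \<Rightarrow> nat) set \<Rightarrow> (real ^ 'n) set
      \<Rightarrow> (real ^ 'n) measure \<Rightarrow> bool"
  where "component_counting_measure r t D L \<mu> \<longleftrightarrow>
    finite_measure \<mu> \<and> sets \<mu> = sets borel \<and> emeasure \<mu> (- L) = 0 \<and>
    (\<exists>M\<ge>1. \<forall>R\<in>cylinders r t D L. \<exists>\<delta>\<^sub>0>0. \<forall>\<delta>. 0 < \<delta> \<and> \<delta> < \<delta>\<^sub>0 \<longrightarrow>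
      inverse M * measure \<mu> R * \<delta> powr (- box_dim L) \<le> real (component_count R \<delta>) \<and>
      real (component_count R \<delta>) \<le> M * measure \<mu> R * \<delta> powr (- box_dim L))"

definition trivial_points :: "'a::topological_space set \<Rightarrow> 'a set"
  where "trivial_points E = {x \<in> E. {x} \<in> components E}"

end

theory Submission
  imports Defs
begin

text \<open>
  Let \<open>s = \<Sum>\<beta>\<^sub>k\<close>. A word \<open>w\<close> over \<open>D\<close> codes the cylinder \<open>phi w ` L\<close>, and \<open>rho w k\<close> is its side
  in coordinate \<open>k\<close>; by the coordinate ordering condition the last coordinate has the shortest
  side. At scale \<open>\<delta>\<close> the sponge is cut into approximate cubes: refine words over \<open>D\<close> until the
  shortest side is about \<open>\<delta>\<close>, then drop the last coordinate and go on refining with the digits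
  of the projection to the other coordinates, and so on until no coordinate is left. Put \<open>Psi S
  w \<delta> = \<Prod>k\<in>S. (rho w k / \<delta>)\<^bsup>\<beta>\<^sub>k\<^esup>\<close>. The equations that define the exponents say exactly that
  \<open>Psi\<close> is preserved by one step of refinement, and dropping a coordinate changes it only by a
  bounded factor. Hence every quantity that is additive under refinement and insensitive to
  dropping is comparable to \<open>Psi\<close> (\<open>counts_climb\<close>). For a cylinder this reads \<open>weight UNIV w *
  \<delta>\<^bsup>-s\<^esup>\<close>. Applied to covering and packing numbers it shows that the box dimension of \<open>L\<close> is \<open>s\<close>
  and that component counts of cylinders are never larger than the maximal order; and \<open>weight
  UNIV w\<close> is the Bernoulli measure of the cylinder (\<open>measure_cylinder\<close>).

  The link to trivial points is the notion of an island: a relatively clopen subset of \<open>\<Lambda>\<^sub>j\<close>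
  inside the open cube \<open>V\<^sub>j\<close>. By neat projection the copy of an island in any cylinder is again
  an island, with gap proportional to the shortest side. A nonempty island contains a cylinder,
  hence a nested sequence of copies of itself that shrinks to a trivial point; conversely a
  trivial point has arbitrarily small clopen neighbourhoods. So \<open>V\<^sub>j\<close> contains a trivial point
  of \<open>\<Lambda>\<^sub>j\<close> iff there is a nonempty island (\<open>trivial_point_iff_island\<close>), and then copies of
  islands give a dense set of trivial points (\<open>trivial_points_dense_iff\<close>).

  If all \<open>\<Lambda>\<^sub>j\<close> have nonempty islands, restrict the refinement process to an island of \<open>\<Lambda>\<^sub>j\<close>
  each time the coordinate \<open>j\<close> is dropped. This costs a constant factor in the count, and the
  surviving pieces are separated from the rest of \<open>L\<close> by gaps comparable to \<open>\<delta>\<close>, so that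
  component counts of cylinders have the maximal order, with a constant that does not depend on
  the cylinder (\<open>many_islands\<close>).

  If \<open>\<Lambda>\<^sub>j\<close> has no nonempty island, every chain class of \<open>\<Lambda>\<^sub>j\<close> reaches the boundary of the cube.
  At the moment when only the coordinates up to \<open>j\<close> are left, their sides are much longer than
  \<open>\<delta>\<close>, because the ratios are strictly ordered (for the last \<open>j\<close>, because no coordinate has
  been dropped yet). All components at scale about \<open>\<delta>\<close> above such a cylinder therefore meet one
  of its faces, but only a small proportion of the approximate cubes does, because some digit
  leaves the face. Hence the number of components is \<open>o(\<delta>\<^bsup>-s\<^esup>)\<close> (\<open>few_components\<close>) and the
  maximal power law fails.
\<close>

section \<open>Coordinate projections\<close>

definition proj :: "'n set \<Rightarrow> real ^ 'n \<Rightarrow> real ^ 'n::finite"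
  where "proj S x = (\<chi> i. if i \<in> S then x $ i else 0)"

text \<open>
  These are the sets \<open>{..j}\<close> and the empty set, with which the recursion over the coordinates
  ends.
\<close>

definition down_closed :: "'n::linorder set \<Rightarrow> bool"
  where "down_closed S \<longleftrightarrow> (\<forall>j\<in>S. \<forall>i<j. i \<in> S)"

lemma coord_proj_eq_proj: "coord_proj j = proj {..j}"
  by (auto simp: coord_proj_def proj_def fun_eq_iff)

lemma proj_nth: "proj S x $ i = (if i \<in> S then x $ i else 0)"
  by (simp add: proj_def)

lemma proj_eq_iff: "proj S x = proj S y \<longleftrightarrow> (\<forall>i\<in>S. x $ i = y $ i)"
  by (auto simp: proj_def vec_eq_iff)

lemma proj_UNIV [simp]: "proj UNIV x = x"
  by (simp add: proj_def vec_eq_iff)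

lemma proj_proj_subset: "A \<subseteq> S \<Longrightarrow> proj A (proj S x) = proj A x"
  by (auto simp: proj_def vec_eq_iff)

lemma continuous_on_proj: "continuous_on X (proj S)"
proof -
  have "continuous_on X (\<lambda>x. if i \<in> S then x $ i else 0)" for i
    by (cases "i \<in> S") (auto intro!: continuous_intros)
  then show ?thesis
    unfolding proj_def by (rule continuous_on_vec_lambda)
qed

lemma down_closed_UNIV [simp]: "down_closed UNIV"
  and down_closed_empty [simp]: "down_closed {}"
  and down_closed_atMost [simp]: "down_closed {..j}"
  by (auto simp: down_closed_def)

lemma down_closed_insertD:
  assumes "down_closed (insert b A)" "\<forall>a\<in>A. a < b"
  shows "down_closed A" "insert b A = {..b}" "b \<notin> A"
proof -
  show b: "b \<notin> A" using assms(2) by auto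
  show "insert b A = {..b}"
    using assms unfolding down_closed_def by (auto simp: less_le)
  show "down_closed A"
    unfolding down_closed_def
  proof (intro ballI allI impI)
    fix j i assume "j \<in> A" "i < j"
    then have "i \<in> insert b A" "i \<noteq> b" using assms unfolding down_closed_def by auto
    then show "i \<in> A" by simp
  qed
qed

lemma down_closed_cases:
  assumes "down_closed (S :: 'n::{finite,linorder} set)"
  obtains "S = {}" | j where "S = {..j}"
proof (cases "S = {}")
  case False
  have fin: "finite S" by simp
  have mem: "Max S \<in> S" using fin False by (rule Max_in)
  have "S = {..Max S}"
  proof (intro subset_antisym subsetI)
    fix x assume "x \<in> {..Max S}"
    then have "x = Max S \<or> x < Max S" by (simp add: le_less disj_commute)
    then show "x \<in> S" using mem assms unfolding down_closed_def by blast
  next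
    fix x assume "x \<in> S"
    then show "x \<in> {..Max S}" using Max_ge[OF fin] by blast
  qed
  then show thesis by (rule that(2))
qed (rule that(1))

lemma dist_le_sum_coord: "dist x y \<le> (\<Sum>i\<in>UNIV. \<bar>x $ i - y $ i\<bar>)" for x y :: "real ^ 'n::finite"
  unfolding dist_norm using norm_le_l1_cart[of "x - y"] by simp

lemma coord_le_dist: "\<bar>x $ i - y $ i\<bar> \<le> dist x y" for x y :: "real ^ 'n::finite"
  by (metis component_le_norm_cart dist_norm vector_minus_component)

lemma dist_le_card_mult:
  fixes x y :: "real ^ 'n::finite"
  assumes "\<And>i. \<bar>x $ i - y $ i\<bar> \<le> e"
  shows "dist x y \<le> real CARD('n) * e"
proof -
  have "(\<Sum>i\<in>UNIV. \<bar>x $ i - y $ i\<bar>) \<le> (\<Sum>i\<in>(UNIV::'n set). e)"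
    by (rule sum_mono) (use assms in auto)
  then show ?thesis using dist_le_sum_coord[of x y] by simp
qed

section \<open>Words and cylinders\<close>

locale LG_sponge =
  fixes n :: "'n::{finite,linorder} \<Rightarrow> nat"
    and r t :: "'n \<Rightarrow> nat \<Rightarrow> real"
    and D :: "('n \<Rightarrow> nat) set"
    and L :: "(real ^ 'n::{finite,linorder}) set"
    and \<beta> :: "'n \<Rightarrow> real"
  assumes ifs: "diagonal_ifs n r t D"
    and attractor: "is_attractor r t D L"
    and lalley_gatzouras: "lalley_gatzouras r t D"
    and nondeg: "nondegenerated L"
    and exponents: "canonical_exponents r D \<beta>"
begin

lemma digit_bounds:
  assumes "a \<in> D"
  shows "0 < r k (a k)" "r k (a k) < 1" "0 \<le> t k (a k)" "r k (a k) + t k (a k) \<le> 1"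
proof -
  have "a \<in> (\<Pi> i\<in>UNIV. {..<n i})" using assms ifs unfolding diagonal_ifs_def by blast
  then have *: "a k < n k" by (simp add: Pi_iff)
  then have "0 < r k (a k)" "r k (a k) < 1" and i: "(\<lambda>x. r k (a k) * x + t k (a k)) ` {0..1} \<subseteq> {0..1}"
    using ifs by (auto simp: diagonal_ifs_def)
  then show "0 < r k (a k)" "r k (a k) < 1" by auto
  have "(\<lambda>x. r k (a k) * x + t k (a k)) 0 \<in> {0..1}" "(\<lambda>x. r k (a k) * x + t k (a k)) 1 \<in> {0..1}"
    using i by (meson atLeastAtMost_iff image_subset_iff order_refl zero_le_one)+
  then show "0 \<le> t k (a k)" "r k (a k) + t k (a k) \<le> 1" by auto
qed

lemma D_nonempty: "D \<noteq> {}"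
  using ifs by (simp add: diagonal_ifs_def)

lemma finite_D [simp]: "finite D"
proof -
  have "D \<subseteq> (\<Pi>\<^sub>E i\<in>UNIV. {..<n i})" using ifs by (auto simp: diagonal_ifs_def)
  moreover have "finite (\<Pi>\<^sub>E i\<in>UNIV. {..<n i})" by (rule finite_PiE) auto
  ultimately show ?thesis by (rule finite_subset)
qed

text \<open>
  A uniform bound: all ratios of digits in \<open>D\<close> lie between \<open>q\<close> and \<open>1 - q\<close>.
\<close>

definition q :: real
  where "q = Min ((\<lambda>(a, k). min (r k (a k)) (1 - r k (a k))) ` (D \<times> UNIV))"

lemma q_bounds:
  shows "0 < q" "q < 1" "\<And>a k. a \<in> D \<Longrightarrow> q \<le> r k (a k)" "\<And>a k. a \<in> D \<Longrightarrow> r k (a k) \<le> 1 - q"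
proof -
  let ?X = "(\<lambda>(a, k). min (r k (a k)) (1 - r k (a k))) ` (D \<times> (UNIV::'n set))"
  have fin: "finite ?X" "?X \<noteq> {}" using D_nonempty by auto
  have le: "q \<le> min (r k (a k)) (1 - r k (a k))" if "a \<in> D" for a k
    unfolding q_def by (rule Min_le) (use fin that in auto)
  have "q \<in> ?X" unfolding q_def by (rule Min_in) (use fin in auto)
  then show "0 < q" "q < 1" using digit_bounds by (auto simp: min_def)
  show "\<And>a k. a \<in> D \<Longrightarrow> q \<le> r k (a k)" "\<And>a k. a \<in> D \<Longrightarrow> r k (a k) \<le> 1 - q"
    using le[unfolded min.bounded_iff] by (auto simp: algebra_simps le_diff_eq)
qed

lemma ratio_strict: "a \<in> D \<Longrightarrow> i < j \<Longrightarrow> r j (a j) < r i (a i)"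
  using lalley_gatzouras by (auto simp: lalley_gatzouras_def coordinate_ordering_def)

definition phi
  where "phi w = foldr (sponge_map r t) w"

text \<open>
  In coordinate \<open>k\<close> the map \<open>phi w\<close> is \<open>\<lambda>x. rho w k * x + tau w k\<close>, so that \<open>phi w\<close> maps the
  unit cube to the box with corner \<open>tau w\<close> and sides \<open>rho w\<close>.
\<close>

definition rho :: "('n \<Rightarrow> nat) list \<Rightarrow> 'n \<Rightarrow> real"
  where "rho w k = prod_list (map (\<lambda>a. r k (a k)) w)"

definition tau :: "('n \<Rightarrow> nat) list \<Rightarrow> 'n \<Rightarrow> real"
  where "tau w k = phi w 0 $ k"

lemma phi_Nil [simp]: "phi [] x = x"
  and phi_Cons: "phi (a # w) x = sponge_map r t a (phi w x)"
  and phi_append: "phi (u @ w) x = phi u (phi w x)"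
  by (auto simp: phi_def)

lemma rho_Nil [simp]: "rho [] k = 1"
  and rho_Cons [simp]: "rho (a # w) k = r k (a k) * rho w k"
  and rho_append [simp]: "rho (u @ w) k = rho u k * rho w k"
  by (auto simp: rho_def)

lemma tau_Nil [simp]: "tau [] k = 0"
  and tau_Cons [simp]: "tau (a # w) k = r k (a k) * tau w k + t k (a k)"
  by (simp_all add: tau_def phi_Cons sponge_map_def)

lemma phi_nth: "phi w x $ k = rho w k * x $ k + tau w k"
  by (induction w) (auto simp: phi_Cons sponge_map_def algebra_simps)

lemma tau_append: "tau (u @ w) k = rho u k * tau w k + tau u k"
  by (induction u) (auto simp: algebra_simps)

lemma rho_pos: "w \<in> lists D \<Longrightarrow> 0 < rho w k"
  by (induction w) (auto simp: digit_bounds)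

lemma rho_lower: "w \<in> lists D \<Longrightarrow> q ^ length w \<le> rho w k"
proof (induction w)
  case (Cons a w)
  then show ?case using q_bounds(1) q_bounds(3)[of a k] by (auto intro!: mult_mono)
qed auto

lemma rho_upper: "w \<in> lists D \<Longrightarrow> rho w k \<le> (1 - q) ^ length w"
proof (induction w)
  case (Cons a w)
  then show ?case using q_bounds(1,2) q_bounds(4)[of a k] rho_pos[of w k] by (auto intro!: mult_mono)
qed auto

lemma rho_le_1: "w \<in> lists D \<Longrightarrow> rho w k \<le> 1"
  using rho_upper[of w k] q_bounds by (meson diff_ge_0_iff_ge diff_le_eq le_add_same_cancel1 less_imp_le order_trans power_le_one)

lemma rho_antimono: "w \<in> lists D \<Longrightarrow> i \<le> j \<Longrightarrow> rho w j \<le> rho w i"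
proof (induction w)
  case (Cons a w)
  then have "r j (a j) \<le> r i (a i)" using ratio_strict[of a i j] by (cases "i = j") (auto simp: less_imp_le)
  with Cons show ?case using rho_pos[of w] digit_bounds[of a]
    by (auto intro!: mult_mono simp: less_imp_le)
qed auto

lemma tau_nonneg: "w \<in> lists D \<Longrightarrow> 0 \<le> tau w k"
  by (induction w) (auto simp: digit_bounds less_imp_le)

lemma tau_rho_le_1: "w \<in> lists D \<Longrightarrow> tau w k + rho w k \<le> 1"
proof (induction w)
  case (Cons a w)
  then have "r k (a k) * (tau w k + rho w k) \<le> r k (a k) * 1"
    by (intro mult_left_mono) (auto simp: digit_bounds less_imp_le)
  then show ?case using digit_bounds(4)[of a k] Cons by (auto simp: algebra_simps)
qed auto

lemma compact_L: "compact L" and L_nonempty: "L \<noteq> {}"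
  and L_eq: "L = (\<Union>a\<in>D. sponge_map r t a ` L)"
  using attractor by (auto simp: is_attractor_def)

text \<open>
  A point of \<open>L\<close> with the largest \<open>k\<close>-th coordinate \<open>u\<close> is the image of another point of \<open>L\<close>
  under some map of ratio \<open>r\<close>, which gives \<open>u \<le> r * u + 1 - r\<close>, that is \<open>u \<le> 1\<close>. The lower
  bound is dual.
\<close>

lemma L_cube:
  assumes "x \<in> L" shows "0 \<le> x $ k" "x $ k \<le> 1"
proof -
  have cont: "continuous_on L (\<lambda>x. x $ k)" by (intro continuous_intros)
  obtain u where u: "u \<in> L" "\<And>y. y \<in> L \<Longrightarrow> y $ k \<le> u $ k"
    using continuous_attains_sup[OF compact_L L_nonempty cont] by blast
  obtain l where l: "l \<in> L" "\<And>y. y \<in> L \<Longrightarrow> l $ k \<le> y $ k"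
    using continuous_attains_inf[OF compact_L L_nonempty cont] by blast
  obtain a y where a: "a \<in> D" "y \<in> L" "u = sponge_map r t a y" using u(1) L_eq by blast
  have "u $ k = r k (a k) * y $ k + t k (a k)" by (simp add: a sponge_map_def)
  also have "\<dots> \<le> r k (a k) * u $ k + t k (a k)"
    using u(2)[OF a(2)] digit_bounds[OF a(1), of k] by auto
  also have "\<dots> \<le> r k (a k) * u $ k + 1 - r k (a k)" using digit_bounds[OF a(1), of k] by auto
  finally have "(1 - r k (a k)) * u $ k \<le> (1 - r k (a k)) * 1" by (simp add: algebra_simps)
  then have "u $ k \<le> 1" using digit_bounds[OF a(1), of k] by (simp add: mult_le_cancel_left)
  then show "x $ k \<le> 1" using u(2)[OF assms] by linarith
  obtain b z where b: "b \<in> D" "z \<in> L" "l = sponge_map r t b z" using l(1) L_eq by blast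
  have "r k (b k) * l $ k \<le> r k (b k) * z $ k + t k (b k)"
    using l(2)[OF b(2)] digit_bounds[OF b(1), of k] by (auto intro: order_trans[OF mult_left_mono[of "l $ k" "z $ k" "r k (b k)"]])
  also have "\<dots> = l $ k" by (simp add: b sponge_map_def)
  finally have "0 \<le> (1 - r k (b k)) * l $ k" by (simp add: algebra_simps)
  then have "0 \<le> l $ k" using digit_bounds[OF b(1), of k] by (simp add: zero_le_mult_iff)
  then show "0 \<le> x $ k" using l(2)[OF assms] by linarith
qed

lemma phi_L: "w \<in> lists D \<Longrightarrow> x \<in> L \<Longrightarrow> phi w x \<in> L"
  by (induction w) (use L_eq in \<open>auto simp: phi_Cons\<close>)

lemma L_word:
  "x \<in> L \<Longrightarrow> \<exists>w\<in>lists D. length w = m \<and> x \<in> phi w ` L"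
proof (induction m arbitrary: x)
  case 0
  then show ?case by (intro bexI[of _ "[]"]) auto
next
  case (Suc m)
  obtain a y where a: "a \<in> D" "y \<in> L" "x = sponge_map r t a y" using Suc(2) L_eq by blast
  obtain w where "w \<in> lists D" "length w = m" "y \<in> phi w ` L" using Suc(1) a by blast
  then show ?case using a by (intro bexI[of _ "a # w"]) (auto simp: phi_Cons)
qed

lemma continuous_on_phi: "continuous_on X (phi w)"
proof -
  have "phi w = (\<lambda>x. \<chi> k. rho w k * x $ k + tau w k)"
    by (auto simp: fun_eq_iff vec_eq_iff phi_nth)
  then show ?thesis by (auto intro!: continuous_on_vec_lambda continuous_intros)
qed

lemma proj_phi_proj: "proj S (phi w (proj S x)) = proj S (phi w x)"
  by (auto simp: proj_eq_iff phi_nth proj_nth)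

section \<open>Disjointness of cylinders\<close>

text \<open>
  Two open boxes are disjoint iff they are disjoint in some coordinate: otherwise the midpoints
  of the overlaps form a common point.
\<close>

lemma neat_digits:
  assumes "a \<in> D" "b \<in> D" "down_closed S" "restrict a S \<noteq> restrict b S"
  shows "\<exists>k\<in>S. t k (a k) + r k (a k) \<le> t k (b k) \<or> t k (b k) + r k (b k) \<le> t k (a k)"
proof (rule ccontr)
  assume "\<not> ?thesis"
  then have ov: "t k (b k) < t k (a k) + r k (a k)" "t k (a k) < t k (b k) + r k (b k)" if "k \<in> S" for k
    using that by force+
  from assms(4) have "S \<noteq> {}" by auto
  then obtain j where S: "S = {..j}" using assms(3) by (auto elim: down_closed_cases)
  \<comment> \<open>the midpoint of the overlap of the two intervals\<close>
  define m where "m k = (max (t k (a k)) (t k (b k)) + min (t k (a k) + r k (a k)) (t k (b k) + r k (b k))) / 2" for k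
  have m: "t k (a k) < m k" "m k < t k (a k) + r k (a k)" "t k (b k) < m k" "m k < t k (b k) + r k (b k)"
    if "k \<in> S" for k
    using ov[OF that] digit_bounds[OF assms(1), of k] digit_bounds[OF assms(2), of k]
    by (auto simp: m_def max_def min_def)
  define f where "f c = (\<chi> k. if k \<in> S then (m k - t k (c k)) / r k (c k) else 0)" for c :: "'n \<Rightarrow> nat"
  have f: "f c \<in> open_cube j" "(coord_proj j \<circ> sponge_map r t (restrict c S)) (f c) = (\<chi> k. if k \<in> S then m k else 0)"
    if c: "c = a \<or> c = b" for c
  proof -
    have cD: "c \<in> D" using c assms by auto
    have "t k (c k) < m k" "m k < t k (c k) + r k (c k)" if "k \<in> S" for k
      using c m[OF that] by auto
    then show "f c \<in> open_cube j"
      using digit_bounds[OF cD] by (auto simp: open_cube_def f_def S field_simps)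
    show "(coord_proj j \<circ> sponge_map r t (restrict c S)) (f c) = (\<chi> k. if k \<in> S then m k else 0)"
      using digit_bounds(1)[OF cD] by (auto simp: coord_proj_eq_proj proj_def S[symmetric] f_def sponge_map_def vec_eq_iff less_imp_neq[THEN not_sym])
  qed
  have disj: "disjoint_family_on (\<lambda>a. (coord_proj j \<circ> sponge_map r t a) ` open_cube j) (proj_digits j D)"
    using lalley_gatzouras by (auto simp: lalley_gatzouras_def neat_projection_def)
  have "(coord_proj j \<circ> sponge_map r t (restrict a S)) ` open_cube j \<inter> (coord_proj j \<circ> sponge_map r t (restrict b S)) ` open_cube j = {}"
    by (rule disjoint_family_onD[OF disj]) (use assms in \<open>auto simp: proj_digits_def S\<close>)
  moreover have "(\<chi> k. if k \<in> S then m k else 0) \<in> (coord_proj j \<circ> sponge_map r t (restrict a S)) ` open_cube j"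
    using f[of a] by (metis image_eqI)
  moreover have "(\<chi> k. if k \<in> S then m k else 0) \<in> (coord_proj j \<circ> sponge_map r t (restrict b S)) ` open_cube j"
    using f[of b] by (metis image_eqI)
  ultimately show False by blast
qed

lemma neat_words:
  assumes "down_closed S" "u \<in> lists D" "w \<in> lists D" "length u = length w"
    "map (\<lambda>a. restrict a S) u \<noteq> map (\<lambda>a. restrict a S) w"
  shows "\<exists>k\<in>S. tau u k + rho u k \<le> tau w k \<or> tau w k + rho w k \<le> tau u k"
  using assms(4,2,3,5)
proof (induction u w rule: list_induct2)
  case (Cons a u b w)
  have ab: "a \<in> D" "b \<in> D" "u \<in> lists D" "w \<in> lists D" using Cons by auto
  show ?case
  proof (cases "restrict a S = restrict b S")
    case False
    then obtain k where k: "k \<in> S" "t k (a k) + r k (a k) \<le> t k (b k) \<or> t k (b k) + r k (b k) \<le> t k (a k)"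
      using neat_digits[OF ab(1,2) assms(1)] by blast
    have *: "t k (c k) \<le> tau (c # v) k" "tau (c # v) k + rho (c # v) k \<le> t k (c k) + r k (c k)"
      if "c \<in> D" "v \<in> lists D" for c v
    proof -
      show "t k (c k) \<le> tau (c # v) k" using tau_nonneg[of v k] digit_bounds[of c k] that by auto
      have "r k (c k) * (tau v k + rho v k) \<le> r k (c k) * 1"
        by (intro mult_left_mono tau_rho_le_1) (use that digit_bounds[of c k] in auto)
      then show "tau (c # v) k + rho (c # v) k \<le> t k (c k) + r k (c k)" by (simp add: algebra_simps)
    qed
    show ?thesis using k *[of a u] *[of b w] ab by (intro bexI[of _ k]) auto
  next
    case True
    then have e: "a k = b k" if "k \<in> S" for k by (metis restrict_apply that)
    have "map (\<lambda>a. restrict a S) u \<noteq> map (\<lambda>a. restrict a S) w"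
      using Cons.prems(3) True by (simp only: list.map list.inject simp_thms)
    then obtain k where k: "k \<in> S" "tau u k + rho u k \<le> tau w k \<or> tau w k + rho w k \<le> tau u k"
      using Cons.IH ab by blast
    have rp: "r k (b k) > 0" using digit_bounds ab by auto
    have "r k (b k) * (tau u k + rho u k) \<le> r k (b k) * tau w k \<or> r k (b k) * (tau w k + rho w k) \<le> r k (b k) * tau u k"
      using k(2) rp by (simp only: mult_le_cancel_left_pos)
    then show ?thesis using k(1) e[OF k(1)] by (intro bexI[of _ k]) (auto simp: algebra_simps)
  qed
qed auto

lemma proj_phi_restrict:
  assumes "map (\<lambda>a. restrict a S) u = map (\<lambda>a. restrict a S) w"
  shows "proj S (phi u x) = proj S (phi w x)"
proof -
  have "length u = length w" using assms by (metis length_map)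
  then show ?thesis using assms
  proof (induction u w rule: list_induct2)
    case (Cons a u b w)
    then have "restrict a S = restrict b S" "map (\<lambda>a. restrict a S) u = map (\<lambda>a. restrict a S) w"
      by (simp_all only: list.map list.inject simp_thms)
    with Cons have "proj S (phi u x) = proj S (phi w x)" "restrict a S = restrict b S" by auto
    then show ?case
      by (auto simp: proj_eq_iff phi_Cons sponge_map_def) (metis restrict_apply)+
  qed auto
qed

section \<open>Weights given by the canonical exponents\<close>

text \<open>
  One digit in each class of digits that agree on \<open>S\<close>. It replaces \<open>proj_digits\<close>, so that all
  words, also those that refine a projected cylinder, consist of genuine digits.
\<close>

definition transversal :: "'n set \<Rightarrow> ('n \<Rightarrow> nat) set"
  where "transversal S = (SOME X. X \<subseteq> D \<and> inj_on (\<lambda>a. restrict a S) X \<and>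
    (\<lambda>a. restrict a S) ` X = (\<lambda>a. restrict a S) ` D)"

lemma transversal_props:
  shows "transversal S \<subseteq> D" "inj_on (\<lambda>a. restrict a S) (transversal S)"
    "(\<lambda>a. restrict a S) ` transversal S = (\<lambda>a. restrict a S) ` D"
proof -
  have "\<exists>X. X \<subseteq> D \<and> inj_on (\<lambda>a. restrict a S) X \<and> (\<lambda>a. restrict a S) ` X = (\<lambda>a. restrict a S) ` D"
    using subset_image_inj[of "(\<lambda>a. restrict a S) ` D" "\<lambda>a. restrict a S" D] by (metis order_refl)
  from someI_ex[OF this] show "transversal S \<subseteq> D" "inj_on (\<lambda>a. restrict a S) (transversal S)"
    "(\<lambda>a. restrict a S) ` transversal S = (\<lambda>a. restrict a S) ` D"
    unfolding transversal_def by blast+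
qed

lemma transversalD: "a \<in> transversal S \<Longrightarrow> a \<in> D"
  using transversal_props by blast

lemma finite_transversal [simp]: "finite (transversal S)"
  using transversal_props(1) finite_D by (rule finite_subset)

lemma transversal_rep:
  assumes "a \<in> D" obtains b where "b \<in> transversal S" "restrict b S = restrict a S"
  using transversal_props(3)[of S] assms by (metis (no_types, lifting) imageE imageI)

lemma transversal_nonempty: "transversal S \<noteq> {}"
  using D_nonempty transversal_props(3)[of S] by auto

lemma restrict_eq_nth: "restrict a S = restrict b S \<Longrightarrow> k \<in> S \<Longrightarrow> a k = b k"
  by (metis restrict_apply)

definition weight :: "'n set \<Rightarrow> ('n \<Rightarrow> nat) list \<Rightarrow> real"
  where "weight S w = (\<Prod>k\<in>S. rho w k powr \<beta> k)"

lemma weight_pos: "w \<in> lists D \<Longrightarrow> 0 < weight S w"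
  unfolding weight_def by (intro prod_pos) (use rho_pos in \<open>simp add: less_imp_neq[THEN not_sym]\<close>)

lemma weight_append: "u \<in> lists D \<Longrightarrow> w \<in> lists D \<Longrightarrow> weight S (u @ w) = weight S u * weight S w"
  unfolding weight_def prod.distrib[symmetric]
  by (intro prod.cong refl) (simp add: powr_mult rho_pos less_imp_le)

lemma weight_single: "weight S [a] = (\<Prod>k\<in>S. r k (a k) powr \<beta> k)"
  by (simp add: weight_def)

text \<open>
  For \<open>S = {..j}\<close> this is the equation that defines \<open>\<beta> j\<close>. The empty set has a single class of
  digits, with an empty product as weight.
\<close>

lemma sum_weight:
  assumes "down_closed S"
  shows "(\<Sum>a\<in>transversal S. weight S [a]) = 1"
  using assms
proof (cases rule: down_closed_cases)
  case 1
  have *: "a = b" if "a \<in> transversal {}" "b \<in> transversal {}" for a b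
    using transversal_props(2)[of "{}"] that by (auto simp: inj_on_def restrict_def)
  obtain a where "a \<in> transversal {}" using transversal_nonempty by blast
  with * have "transversal {} = {a}" by blast
  then show ?thesis by (simp add: 1 weight_def)
next
  case (2 j)
  have "(\<Sum>a\<in>transversal S. weight S [a]) =
    (\<Sum>a\<in>(\<lambda>a. restrict a S) ` transversal S. \<Prod>k\<in>{..j}. r k (a k) powr \<beta> k)"
    by (subst sum.reindex[OF transversal_props(2)]) (auto simp: weight_single 2 intro!: sum.cong prod.cong)
  also have "\<dots> = 1"
    using exponents unfolding transversal_props(3) by (simp add: canonical_exponents_def proj_digits_def 2)
  finally show ?thesis .
qed

text \<open>
  Every class of digits below \<open>j\<close> extends to a class up to \<open>j\<close>. If \<open>\<beta> j\<close> were negative, each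
  extension would be heavier than the class that it extends, and the total weight up to \<open>j\<close>
  would exceed the total weight below \<open>j\<close>; but both are \<open>1\<close>.
\<close>

lemma beta_nonneg: "0 \<le> \<beta> j"
proof (rule ccontr)
  assume neg: "\<not> 0 \<le> \<beta> j"
  let ?A = "{..<j}" and ?S = "{..j}"
  have dA: "down_closed ?A" by (auto simp: down_closed_def)
  have "\<exists>h. \<forall>a\<in>transversal ?A. h a \<in> transversal ?S \<and> restrict (h a) ?S = restrict a ?S"
    using transversal_rep transversalD by (intro bchoice) metis
  then obtain h where h: "\<And>a. a \<in> transversal ?A \<Longrightarrow> h a \<in> transversal ?S"
      "\<And>a. a \<in> transversal ?A \<Longrightarrow> restrict (h a) ?S = restrict a ?S" by blast
  have inj: "inj_on h (transversal ?A)"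
  proof (rule inj_onI)
    fix a b assume ab: "a \<in> transversal ?A" "b \<in> transversal ?A" "h a = h b"
    then have "restrict a ?S = restrict b ?S" using h(2) by metis
    then have "a k = b k" if "k \<in> ?S" for k using that by (rule restrict_eq_nth)
    then have "restrict a ?A = restrict b ?A" by (auto simp: restrict_def fun_eq_iff)
    then show "a = b" using transversal_props(2)[of ?A] ab by (auto simp: inj_on_def)
  qed
  have less: "weight ?A [a] < weight ?S [h a]" if a: "a \<in> transversal ?A" for a
  proof -
    have aD: "a \<in> D" using a by (rule transversalD)
    have "weight ?S [h a] = weight ?S [a]"
      unfolding weight_single by (intro prod.cong refl) (use restrict_eq_nth[OF h(2)[OF a]] in auto)
    also have "\<dots> = r j (a j) powr \<beta> j * weight ?A [a]"
    proof -
      have "?S = insert j ?A" by auto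
      then show ?thesis by (simp add: weight_single)
    qed
    finally have e: "weight ?S [h a] = r j (a j) powr \<beta> j * weight ?A [a]" .
    have "1 < r j (a j) powr \<beta> j" using powr_less_mono2_neg[of "\<beta> j" "r j (a j)" 1] neg digit_bounds[OF aD, of j] by simp
    then show ?thesis using e weight_pos[of "[a]" ?A] aD by simp
  qed
  have "1 = (\<Sum>a\<in>transversal ?A. weight ?A [a])" using sum_weight[OF dA] by simp
  also have "\<dots> < (\<Sum>a\<in>transversal ?A. weight ?S [h a])"
    by (rule sum_strict_mono) (use less transversal_nonempty in auto)
  also have "\<dots> = (\<Sum>a\<in>h ` transversal ?A. weight ?S [a])" using inj by (simp add: sum.reindex)
  also have "\<dots> \<le> (\<Sum>a\<in>transversal ?S. weight ?S [a])"
    by (rule sum_mono2) (use h weight_pos transversalD in \<open>auto simp: less_imp_le\<close>)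
  also have "\<dots> = 1" by (rule sum_weight) simp
  finally show False by simp
qed

lemma weight_le_1: "w \<in> lists D \<Longrightarrow> weight S w \<le> 1"
  unfolding weight_def
  by (intro prod_le_1) (use rho_pos rho_le_1 beta_nonneg in \<open>auto simp: powr_le1 less_imp_le\<close>)

text \<open>
  Up to constants, the number of approximate cubes of size \<open>\<delta>\<close> in the projection of the
  cylinder \<open>w\<close> to the coordinates in \<open>S\<close>.
\<close>

definition Psi :: "'n set \<Rightarrow> ('n \<Rightarrow> nat) list \<Rightarrow> real \<Rightarrow> real"
  where "Psi S w \<delta> = (\<Prod>k\<in>S. (rho w k / \<delta>) powr \<beta> k)"

lemma Psi_eq: "w \<in> lists D \<Longrightarrow> 0 < \<delta> \<Longrightarrow> Psi S w \<delta> = weight S w * \<delta> powr (- (\<Sum>k\<in>S. \<beta> k))"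
proof -
  assume w: "w \<in> lists D" and \<delta>: "0 < \<delta>"
  have "Psi S w \<delta> = (\<Prod>k\<in>S. rho w k powr \<beta> k * \<delta> powr (- \<beta> k))"
    unfolding Psi_def using rho_pos[OF w] \<delta>
    by (intro prod.cong refl, subst powr_divide) (auto simp: powr_minus divide_inverse less_imp_le)
  also have "\<dots> = weight S w * \<delta> powr (- (\<Sum>k\<in>S. \<beta> k))"
    using \<delta> by (simp add: prod.distrib weight_def powr_sum[symmetric] sum_negf)
  finally show ?thesis .
qed

lemma Psi_pos: "w \<in> lists D \<Longrightarrow> 0 < \<delta> \<Longrightarrow> 0 < Psi S w \<delta>"
  by (simp add: Psi_eq weight_pos)

lemma Psi_append:
  "u \<in> lists D \<Longrightarrow> w \<in> lists D \<Longrightarrow> 0 < \<delta> \<Longrightarrow> Psi S (u @ w) \<delta> = Psi S u \<delta> * weight S w"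
  by (simp add: Psi_eq weight_append)

lemma Psi_insert: "b \<notin> A \<Longrightarrow> Psi (insert b A) w \<delta> = (rho w b / \<delta>) powr \<beta> b * Psi A w \<delta>"
  by (simp add: Psi_def)

text \<open>
  The factor gained by appending a digit is its weight, and the weights add up to \<open>1\<close>. That the
  equality is exact keeps the constants from growing with the number of refinements.
\<close>

lemma sum_Psi:
  assumes "down_closed S" "w \<in> lists D" "0 < \<delta>"
  shows "(\<Sum>a\<in>transversal S. Psi S (w @ [a]) \<delta>) = Psi S w \<delta>"
proof -
  have "(\<Sum>a\<in>transversal S. Psi S (w @ [a]) \<delta>) = (\<Sum>a\<in>transversal S. Psi S w \<delta> * weight S [a])"
    by (intro sum.cong refl Psi_append) (use assms transversalD in auto)
  then show ?thesis using sum_weight[OF assms(1)] by (simp add: sum_distrib_left[symmetric])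
qed

section \<open>Counting approximate cubes\<close>

text \<open>
  The words in force when a coordinate has just been dropped: its side is comparable to \<open>\<delta>\<close>.
  The lower bound survives because only a bounded number of digits is inserted at that moment.
\<close>

definition dropped :: "'n set \<Rightarrow> real \<Rightarrow> real \<Rightarrow> ('n \<Rightarrow> nat) list set"
  where "dropped S M \<delta> = {w \<in> lists D. \<exists>k. k \<notin> S \<and> rho w k \<le> \<delta> \<and> \<delta> \<le> M * rho w k}"

text \<open>
  Read \<open>F S w x\<close> as: the quantity under consideration, attached to sets lying over the cylinder
  \<open>w\<close> with respect to \<open>S\<close>, can be taken to be \<open>x\<close>. The first rule is additivity under
  refinement. The second one allows the last coordinate \<open>b\<close> of \<open>S\<close> to be dropped when its side
  is comparable to \<open>\<delta>\<close>, after restriction to the subcylinder given by a guard word \<open>v S\<close>. For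
  upper bounds the guard word is empty; for lower bounds it leads into the interior of the
  cube, or into an island.
\<close>

definition split_rule :: "'n set \<Rightarrow> ('n set \<Rightarrow> ('n \<Rightarrow> nat) list \<Rightarrow> real \<Rightarrow> bool) \<Rightarrow> bool"
  where "split_rule S\<^sub>0 F \<longleftrightarrow> (\<forall>S w x. down_closed S \<longrightarrow> S\<^sub>0 \<subset> S \<longrightarrow> w \<in> lists D \<longrightarrow>
    (\<forall>a\<in>transversal S. F S (w @ [a]) (x a)) \<longrightarrow> F S w (\<Sum>a\<in>transversal S. x a))"

definition drop_rule :: "'n set \<Rightarrow> ('n set \<Rightarrow> ('n \<Rightarrow> nat) list) \<Rightarrow> real \<Rightarrow> real \<Rightarrow>
    ('n set \<Rightarrow> ('n \<Rightarrow> nat) list \<Rightarrow> real \<Rightarrow> bool) \<Rightarrow> bool"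
  where "drop_rule S\<^sub>0 v M \<delta> F \<longleftrightarrow> (\<forall>b A w x. down_closed (insert b A) \<longrightarrow> (\<forall>a\<in>A. a < b) \<longrightarrow> S\<^sub>0 \<subseteq> A \<longrightarrow>
    w \<in> lists D \<longrightarrow> rho w b \<le> \<delta> \<longrightarrow> \<delta> \<le> M * rho w b \<longrightarrow> F A (w @ v (insert b A)) x \<longrightarrow> F (insert b A) w x)"

definition counts :: "('n \<Rightarrow> nat) list set \<Rightarrow> real \<Rightarrow> real \<Rightarrow> 'n set \<Rightarrow> real \<Rightarrow> real \<Rightarrow>
    ('n set \<Rightarrow> ('n \<Rightarrow> nat) list \<Rightarrow> real \<Rightarrow> bool) \<Rightarrow> bool"
  where "counts W c C S M \<delta> F \<longleftrightarrow> (\<forall>w\<in>W. (\<forall>k\<in>S. \<delta> \<le> M * rho w k) \<longrightarrow>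
    (\<exists>x. F S w x \<and> c * Psi S w \<delta> \<le> x \<and> x \<le> C * Psi S w \<delta>))"

lemma dropped_mono: "M' \<le> M \<Longrightarrow> dropped S M' \<delta> \<subseteq> dropped S M \<delta>"
  unfolding dropped_def by (smt (verit) Collect_mono mult_right_mono rho_pos)

lemma counts_mono:
  "counts W c C S M \<delta> F \<Longrightarrow> M' \<le> M \<Longrightarrow> W' \<subseteq> W \<Longrightarrow> W \<subseteq> lists D \<Longrightarrow> counts W' c C S M' \<delta> F"
  unfolding counts_def by (meson mult_right_mono order_trans rho_pos less_imp_le subsetD)

lemma dropped_subset: "dropped S M \<delta> \<subseteq> lists D"
  by (auto simp: dropped_def)

lemma drop_rule_antimono: "drop_rule S\<^sub>0 v M \<delta> F \<Longrightarrow> M' \<le> M \<Longrightarrow> drop_rule S\<^sub>0 v M' \<delta> F"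
  unfolding drop_rule_def by (meson mult_right_mono order_trans rho_pos less_imp_le)

text \<open>
  As long as the side in coordinate \<open>b\<close> exceeds \<open>\<delta>\<close> the split rule applies and \<open>Psi\<close> is
  preserved; all sides stay at least \<open>q * \<delta> / M\<close>, since \<open>b\<close> has the shortest one. When it is at
  most \<open>\<delta>\<close> the drop rule applies. There \<open>Psi\<close> changes by the factor \<open>(rho w b / \<delta>) powr \<beta> b\<close>,
  which lies between \<open>(q / M) powr \<beta> b\<close> and \<open>1\<close>, and by the weight of the guard word.
\<close>

lemma counts_step:
  assumes S: "down_closed (insert b A)" "\<forall>a\<in>A. a < b" "S\<^sub>0 \<subseteq> A"
    and v: "v (insert b A) \<in> lists D" and M: "1 \<le> M" and \<delta>: "0 < \<delta>" and c: "0 \<le> c" "0 \<le> C"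
    and split: "split_rule S\<^sub>0 F" and drop: "drop_rule S\<^sub>0 v (M / q) \<delta> F"
    and below: "counts (dropped A (M / q / q ^ length (v (insert b A))) \<delta>) c C A (M / q / q ^ length (v (insert b A))) \<delta> F"
  shows "counts (lists D) (c * weight A (v (insert b A))) (C * (M / q) powr \<beta> b) (insert b A) M \<delta> F"
proof -
  define S where "S = insert b A"
  define u where "u = v S"
  have bA: "b \<notin> A" "S = {..b}" and dA: "down_closed A"
    unfolding S_def using down_closed_insertD[OF S(1,2)] by auto
  have dS: "down_closed S" and sub: "S\<^sub>0 \<subset> S" using S bA by (auto simp: S_def)
  have uD: "u \<in> lists D" using v by (simp add: u_def S_def)
  have q: "0 < q" "q < 1" by (rule q_bounds)+
  have Mq: "M \<le> M / q" "1 / q \<le> M / q" "1 \<le> M / q"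
    using M q by (auto simp: field_simps intro: order_trans[OF _ M])
  define G where "G w \<longleftrightarrow> (\<exists>x. F S w x \<and> c * weight A u * Psi S w \<delta> \<le> x \<and> x \<le> C * (M / q) powr \<beta> b * Psi S w \<delta>)" for w
  have base: "G w" if w: "w \<in> lists D" "rho w b \<le> \<delta>" "\<forall>k\<in>S. \<delta> \<le> (M / q) * rho w k" for w
  proof -
    have rp: "0 < rho w k" for k using w rho_pos by auto
    have le: "\<delta> \<le> M / q / q ^ length u * rho (w @ u) k" if "k \<in> S" for k
    proof -
      have "\<delta> \<le> (M / q) * rho w k" using w(3) that by auto
      also have "\<dots> \<le> (M / q) * rho w k * (rho u k / q ^ length u)"
      proof -
        have "1 \<le> rho u k / q ^ length u" using rho_lower[OF uD, of k] q by simp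
        moreover have "0 \<le> (M / q) * rho w k" using M q rp[of k] by simp
        ultimately show ?thesis using mult_left_mono by fastforce
      qed
      finally show ?thesis by (simp add: field_simps)
    qed
    have "rho (w @ u) b \<le> \<delta>"
      using w(2) rho_le_1[OF uD, of b] rp[of b] by (auto intro: order_trans[OF mult_left_le])
    then have "w @ u \<in> dropped A (M / q / q ^ length u) \<delta>"
      using bA(1) w(1) uD le[of b] unfolding dropped_def S_def by auto
    moreover have "\<forall>k\<in>A. \<delta> \<le> M / q / q ^ length u * rho (w @ u) k" using le by (simp add: S_def)
    ultimately obtain x where x: "F A (w @ u) x" "c * Psi A (w @ u) \<delta> \<le> x" "x \<le> C * Psi A (w @ u) \<delta>"
      using below unfolding counts_def u_def S_def by blast
    have Fx: "F S w x"
      using drop x(1) w S uD unfolding drop_rule_def S_def u_def by blast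
    have e: "Psi S w \<delta> = (rho w b / \<delta>) powr \<beta> b * Psi A w \<delta>" "Psi A (w @ u) \<delta> = Psi A w \<delta> * weight A u"
      using Psi_insert[OF bA(1)] Psi_append[OF w(1) uD \<delta>] by (auto simp: S_def)
    have wu: "0 < weight A u" "weight A u \<le> 1" using weight_pos weight_le_1 uD by auto
    have PA: "0 < Psi A w \<delta>" using Psi_pos w \<delta> by auto
    have f1: "(rho w b / \<delta>) powr \<beta> b \<le> 1"
      using w(2) \<delta> rp[of b] beta_nonneg by (intro powr_le1) auto
    have "1 = (\<delta> / rho w b) powr \<beta> b * (rho w b / \<delta>) powr \<beta> b"
      using \<delta> rp[of b] by (simp flip: powr_mult)
    also have "\<dots> \<le> (M / q) powr \<beta> b * (rho w b / \<delta>) powr \<beta> b"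
      by (intro mult_right_mono powr_mono2) (use w \<delta> rp[of b] beta_nonneg in \<open>auto simp: S_def field_simps\<close>)
    finally have f2: "1 \<le> (M / q) powr \<beta> b * (rho w b / \<delta>) powr \<beta> b" .
    have "Psi S w \<delta> \<le> 1 * Psi A w \<delta>" unfolding e(1) by (intro mult_right_mono f1) (use PA in auto)
    then have "c * weight A u * Psi S w \<delta> \<le> c * weight A u * Psi A w \<delta>"
      using c wu by (intro mult_left_mono) auto
    then have low: "c * weight A u * Psi S w \<delta> \<le> x" using x(2) e(2) by (simp add: mult_ac)
    have "x \<le> C * (M / q) powr \<beta> b * Psi S w \<delta>"
    proof -
      have "x \<le> C * (Psi A w \<delta> * weight A u)" using x(3) e(2) by simp
      also have "\<dots> \<le> C * (Psi A w \<delta> * ((M / q) powr \<beta> b * (rho w b / \<delta>) powr \<beta> b))"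
        using c PA wu f2 by (intro mult_left_mono) auto
      also have "\<dots> = C * (M / q) powr \<beta> b * Psi S w \<delta>" by (simp add: e mult_ac)
      finally show ?thesis .
    qed
    with Fx low show "G w" unfolding G_def by blast
  qed
  \<comment> \<open>induction on the number m of refinements after which side b is certainly at most \<open>\<delta>\<close>\<close>
  have main: "G w" if "w \<in> lists D" "rho w b * (1 - q) ^ m \<le> \<delta>" "\<forall>k\<in>S. \<delta> \<le> (M / q) * rho w k" for m w
    using that
  proof (induction m arbitrary: w)
    case 0
    then show ?case using base by simp
  next
    case (Suc m)
    show ?case
    proof (cases "rho w b \<le> \<delta>")
      case True
      then show ?thesis using base Suc by blast
    next
      case False
      have "G (w @ [a])" if a: "a \<in> transversal S" for a
      proof (rule Suc.IH)
        have aD: "a \<in> D" using a transversalD by blast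
        then show "w @ [a] \<in> lists D" using Suc by simp
        have "rho (w @ [a]) b * (1 - q) ^ m \<le> rho w b * (1 - q) * (1 - q) ^ m"
          using q_bounds(4)[OF aD, of b] rho_pos[OF Suc(2), of b] q by (intro mult_right_mono) auto
        also have "\<dots> \<le> \<delta>" using Suc(3) by (simp add: mult_ac)
        finally show "rho (w @ [a]) b * (1 - q) ^ m \<le> \<delta>" .
        show "\<forall>k\<in>S. \<delta> \<le> (M / q) * rho (w @ [a]) k"
        proof
          fix k assume "k \<in> S"
          then have "k \<le> b" using bA by auto
          then have "\<delta> \<le> rho w k" using False rho_antimono[OF Suc(2), of k b] by simp
          also have "\<dots> \<le> (M / q) * (rho w k * q)"
            using M q rho_pos[OF Suc(2), of k] by (simp add: field_simps)
          also have "\<dots> \<le> (M / q) * rho (w @ [a]) k"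
            using q_bounds(3)[OF aD, of k] rho_pos[OF Suc(2), of k] M q by (intro mult_left_mono) auto
          finally show "\<delta> \<le> (M / q) * rho (w @ [a]) k" .
        qed
      qed
      then obtain x where x: "\<And>a. a \<in> transversal S \<Longrightarrow> F S (w @ [a]) (x a) \<and>
          c * weight A u * Psi S (w @ [a]) \<delta> \<le> x a \<and> x a \<le> C * (M / q) powr \<beta> b * Psi S (w @ [a]) \<delta>"
        unfolding G_def by metis
      have "F S w (\<Sum>a\<in>transversal S. x a)"
        using split dS sub Suc(2) x unfolding split_rule_def by blast
      moreover have "c * weight A u * Psi S w \<delta> \<le> (\<Sum>a\<in>transversal S. x a)"
        using sum_mono[of "transversal S" "\<lambda>a. c * weight A u * Psi S (w @ [a]) \<delta>" x] x
          sum_Psi[OF dS Suc(2) \<delta>] by (simp add: sum_distrib_left[symmetric])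
      moreover have "(\<Sum>a\<in>transversal S. x a) \<le> C * (M / q) powr \<beta> b * Psi S w \<delta>"
        using sum_mono[of "transversal S" x "\<lambda>a. C * (M / q) powr \<beta> b * Psi S (w @ [a]) \<delta>"] x
          sum_Psi[OF dS Suc(2) \<delta>] by (simp add: sum_distrib_left[symmetric])
      ultimately show ?thesis unfolding G_def by blast
    qed
  qed
  show ?thesis
    unfolding counts_def S_def[symmetric] u_def[symmetric] G_def[symmetric]
  proof (intro ballI impI)
    fix w assume w: "w \<in> lists D" "\<forall>k\<in>S. \<delta> \<le> M * rho w k"
    obtain m where "(1 - q) ^ m < \<delta>" using real_arch_pow_inv[of \<delta> "1 - q"] \<delta> q by auto
    then have "rho w b * (1 - q) ^ m \<le> \<delta>"
      using rho_le_1[OF w(1), of b] rho_pos[OF w(1), of b] q by (simp add: mult_le_one mult_left_le_one_le order_trans[OF mult_left_le_one_le])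
    moreover have "\<forall>k\<in>S. \<delta> \<le> (M / q) * rho w k"
      using w(2) Mq(1) rho_pos[OF w(1)] by (meson less_imp_le mult_right_mono order_trans)
    ultimately show "G w" using main w(1) by blast
  qed
qed

text \<open>
  The step is iterated over the coordinates in \<open>S - S\<^sub>0\<close>. The constants \<open>M'\<close> and \<open>K\<close> come
  before \<open>\<delta>\<close> and \<open>F\<close>, because the predicates \<open>F\<close> used for lower bounds contain a constant that
  depends on \<open>M'\<close>. The hypothesis on \<open>S\<^sub>0\<close> is about words reached by dropping a coordinate;
  their length grows as \<open>\<delta>\<close> decreases, which is what \<open>few_components\<close> exploits.
\<close>

lemma counts_climb:
  assumes v: "\<And>S. v S \<in> lists D"
  shows "down_closed S \<Longrightarrow> down_closed S\<^sub>0 \<Longrightarrow> S\<^sub>0 \<subset> S \<Longrightarrow> 1 \<le> M \<Longrightarrow>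
    \<exists>M'\<ge>1. \<exists>K\<ge>1. \<forall>\<delta>>0. \<forall>F. \<forall>c\<ge>0. \<forall>C\<ge>0. split_rule S\<^sub>0 F \<longrightarrow> drop_rule S\<^sub>0 v M' \<delta> F \<longrightarrow>
      counts (dropped S\<^sub>0 M' \<delta>) c C S\<^sub>0 M' \<delta> F \<longrightarrow> counts (lists D) (c / K) (C * K) S M \<delta> F"
  using finite[of S]
proof (induction S arbitrary: M rule: finite_linorder_max_induct)
  case (empty M)
  then show ?case by simp
next
  case (insert b A M)
  note dA = down_closed_insertD[OF insert(4,2)]
  have "b \<notin> S\<^sub>0"
  proof
    assume "b \<in> S\<^sub>0"
    then have "insert b A \<subseteq> S\<^sub>0" using insert(2,5) unfolding down_closed_def by blast
    then show False using insert(6) by blast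
  qed
  then have sub: "S\<^sub>0 \<subseteq> A" using insert(6) by blast
  let ?v = "v (insert b A)"
  define M1 where "M1 = M / q / q ^ length ?v"
  have q: "0 < q" "q < 1" by (rule q_bounds)+
  have Mq: "1 \<le> M / q" using insert(7) q by simp
  have M1: "1 \<le> M1"
  proof -
    have "q ^ length ?v \<le> 1" using q by (simp add: power_le_one)
    then have "q ^ length ?v \<le> M / q" using Mq by linarith
    then show ?thesis unfolding M1_def using q by (subst le_divide_eq_1_pos) auto
  qed
  have "\<exists>M'\<ge>1. \<exists>K\<ge>1. \<forall>\<delta>>0. \<forall>F. \<forall>c\<ge>0. \<forall>C\<ge>0. split_rule S\<^sub>0 F \<longrightarrow> drop_rule S\<^sub>0 v M' \<delta> F \<longrightarrow>
    counts (dropped S\<^sub>0 M' \<delta>) c C S\<^sub>0 M' \<delta> F \<longrightarrow> counts (dropped A M1 \<delta>) (c / K) (C * K) A M1 \<delta> F"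
  proof (cases "S\<^sub>0 = A")
    case True
    then show ?thesis using M1 by - (rule exI[of _ M1], rule conjI, simp, rule exI[of _ 1], simp)
  next
    case False
    then have "S\<^sub>0 \<subset> A" using sub by blast
    from insert(3)[OF dA(1) insert(5) this M1] show ?thesis
      by (elim exE conjE) (intro exI conjI allI impI; (assumption | (rule counts_mono[OF _ order_refl dropped_subset order_refl], blast)))
  qed
  then obtain M' K where MK: "1 \<le> M'" "1 \<le> K" and IH: "\<And>\<delta> F c C. 0 < \<delta> \<Longrightarrow> 0 \<le> c \<Longrightarrow> 0 \<le> C \<Longrightarrow> split_rule S\<^sub>0 F \<Longrightarrow>
      drop_rule S\<^sub>0 v M' \<delta> F \<Longrightarrow> counts (dropped S\<^sub>0 M' \<delta>) c C S\<^sub>0 M' \<delta> F \<Longrightarrow> counts (dropped A M1 \<delta>) (c / K) (C * K) A M1 \<delta> F"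
    by blast
  define K' where "K' = K * max (1 / weight A ?v) ((M / q) powr \<beta> b)"
  have wv: "0 < weight A ?v" "weight A ?v \<le> 1" using weight_pos weight_le_1 v by auto
  have "1 \<le> max (1 / weight A ?v) ((M / q) powr \<beta> b)" using wv by (simp add: le_max_iff_disj)
  then have K': "1 \<le> K'" unfolding K'_def using MK by (metis mult_mono' mult_1 zero_le_one)
  show ?case
  proof (rule exI[of _ "max M' (M / q)"], rule conjI, rule order_trans[OF MK(1) max.cobounded1],
      rule exI[of _ K'], rule conjI, rule K', intro allI impI)
    fix \<delta> :: real and F and c C :: real
    assume as: "0 < \<delta>" "0 \<le> c" "0 \<le> C" "split_rule S\<^sub>0 F" "drop_rule S\<^sub>0 v (max M' (M / q)) \<delta> F"
      "counts (dropped S\<^sub>0 (max M' (M / q)) \<delta>) c C S\<^sub>0 (max M' (M / q)) \<delta> F"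
    have "counts (dropped A M1 \<delta>) (c / K) (C * K) A M1 \<delta> F"
      by (rule IH[OF as(1-4) drop_rule_antimono[OF as(5) max.cobounded1]
          counts_mono[OF as(6) max.cobounded1 dropped_mono[OF max.cobounded1] dropped_subset]])
    then have *: "counts (lists D) (c / K * weight A ?v) (C * K * (M / q) powr \<beta> b) (insert b A) M \<delta> F"
      unfolding M1_def
      by (intro counts_step[where S\<^sub>0 = "S\<^sub>0"])
         (use as insert sub v MK drop_rule_antimono[OF as(5), of "M / q"] in auto)
    have 1: "c / K' \<le> c / K * weight A ?v"
    proof -
      have "1 / weight A ?v \<le> max (1 / weight A ?v) ((M / q) powr \<beta> b)" by simp
      then have "K / weight A ?v \<le> K'" unfolding K'_def using MK
        by (metis divide_inverse inverse_eq_divide less_eq_real_def mult_left_mono order_trans zero_le_one mult_1)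
      then have "c / K' \<le> c / (K / weight A ?v)"
        using as(2) wv MK by (intro divide_left_mono) (auto intro!: mult_pos_pos divide_pos_pos less_le_trans[OF _ K'])
      then show ?thesis by simp
    qed
    have 2: "C * K * (M / q) powr \<beta> b \<le> C * K'"
      unfolding K'_def using as(3) MK by (simp add: mult_left_mono mult.assoc)
    show "counts (lists D) (c / K') (C * K') (insert b A) M \<delta> F"
      unfolding counts_def
    proof (intro ballI impI)
      fix w assume w: "w \<in> lists D" "\<forall>k\<in>insert b A. \<delta> \<le> M * rho w k"
      then obtain x where x: "F (insert b A) w x" "c / K * weight A ?v * Psi (insert b A) w \<delta> \<le> x"
          "x \<le> C * K * (M / q) powr \<beta> b * Psi (insert b A) w \<delta>"
        using * unfolding counts_def by blast
      have P: "0 \<le> Psi (insert b A) w \<delta>" using Psi_pos w(1) as(1) by (simp add: less_imp_le)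
      show "\<exists>x. F (insert b A) w x \<and> c / K' * Psi (insert b A) w \<delta> \<le> x \<and> x \<le> C * K' * Psi (insert b A) w \<delta>"
        using x mult_right_mono[OF 1 P] mult_right_mono[OF 2 P] by (intro exI[of _ x]) auto
    qed
  qed
qed

end

section \<open>Facets of the unit cube\<close>

text \<open>
  The set is a proper face, and the cube lies in the affine hull of it and one further point,
  so the dimension drops by exactly one.
\<close>

lemma facet_of_unit_cube:
  fixes k :: "'n::finite"
  assumes "s = 0 \<or> s = (1::real)"
  shows "{x \<in> cbox 0 1. x $ k = s} facet_of (cbox 0 1 :: (real ^ 'n) set)"
proof -
  let ?C = "cbox 0 1 :: (real ^ 'n) set"
  define F where "F = {x \<in> ?C. x $ k = s}"
  have in_C: "x \<in> ?C \<longleftrightarrow> (\<forall>i. 0 \<le> x $ i \<and> x $ i \<le> 1)" for x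
    by (auto simp: mem_box_cart)
  have F_eq: "F = ?C \<inter> {x. axis k 1 \<bullet> x = s}"
    by (auto simp: F_def inner_axis' )
  have face: "F face_of ?C"
    unfolding F_eq using assms
  proof
    assume "s = 0"
    then show "?C \<inter> {x. axis k 1 \<bullet> x = s} face_of ?C"
      by (intro face_of_Int_supporting_hyperplane_ge) (auto simp: in_C inner_axis')
  next
    assume "s = 1"
    then show "?C \<inter> {x. axis k 1 \<bullet> x = s} face_of ?C"
      by (intro face_of_Int_supporting_hyperplane_le) (auto simp: in_C inner_axis')
  qed
  define f p where "f = axis k s" and "p = axis k (1 - s)"
  have fF: "f \<in> F" using assms by (auto simp: F_def in_C f_def axis_def)
  have pC: "p \<in> ?C" "p \<notin> F" using assms by (auto simp: F_def in_C p_def axis_def)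
  have "?C \<subseteq> affine hull (insert p F)"
  proof
    fix x assume x: "x \<in> ?C"
    define y where "y = (\<chi> i. if i = k then s else x $ i)"
    have "y \<in> F" using x assms by (auto simp: y_def F_def in_C)
    then have "y + ((x $ k - s) / (1 - 2 * s)) *\<^sub>R (p - f) \<in> affine hull (insert p F)"
      using fF by (intro mem_affine_3_minus) (auto intro: hull_inc)
    moreover have "y + ((x $ k - s) / (1 - 2 * s)) *\<^sub>R (p - f) = x"
      using assms by (auto simp: vec_eq_iff y_def p_def f_def axis_def)
    ultimately show "x \<in> affine hull (insert p F)" by simp
  qed
  then have "aff_dim ?C \<le> aff_dim (insert p F)"
    by (metis aff_dim_affine_hull aff_dim_subset)
  also have "\<dots> \<le> aff_dim F + 1" by (simp add: aff_dim_insert)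
  finally have "aff_dim ?C \<le> aff_dim F + 1" .
  moreover have "aff_dim F < aff_dim ?C"
    using face_of_aff_dim_lt[OF _ face] pC by auto
  ultimately have "F facet_of ?C"
    using face fF unfolding facet_of_def by auto
  then show ?thesis by (simp add: F_def)
qed

section \<open>Covering numbers\<close>

lemma covering_number_le:
  "finite C \<Longrightarrow> E \<subseteq> (\<Union>x\<in>C. cball x \<delta>) \<Longrightarrow> covering_number E \<delta> \<le> card C"
  unfolding covering_number_def by (intro cInf_lower) auto

lemma covering_number_attained:
  fixes E :: "'a::euclidean_space set"
  assumes "bounded E" "0 < \<delta>"
  obtains C where "finite C" "E \<subseteq> (\<Union>x\<in>C. cball x \<delta>)" "card C = covering_number E \<delta>"
proof -
  have "compact (closure E)" using assms by (simp add: compact_closure)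
  then obtain C where "finite C" "closure E \<subseteq> (\<Union>x\<in>C. ball x \<delta>)"
    using assms(2) unfolding compact_eq_totally_bounded by meson
  moreover have "(\<Union>x\<in>C. ball x \<delta>) \<subseteq> (\<Union>x\<in>C. cball x \<delta>)" by (intro UN_mono) auto
  ultimately have "finite C \<and> E \<subseteq> (\<Union>x\<in>C. cball x \<delta>)" using closure_subset[of E] by (meson order_trans)
  then have "{card C | C. finite C \<and> E \<subseteq> (\<Union>x\<in>C. cball x \<delta>)} \<noteq> {}" by blast
  from Inf_nat_def1[OF this] that show thesis unfolding covering_number_def by (smt (verit) mem_Collect_eq)
qed

lemma covering_number_Un:
  fixes X Y :: "'a::euclidean_space set"
  assumes "bounded X" "bounded Y" "0 < \<delta>"
  shows "covering_number (X \<union> Y) \<delta> \<le> covering_number X \<delta> + covering_number Y \<delta>"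
proof -
  obtain A where A: "finite A" "X \<subseteq> (\<Union>x\<in>A. cball x \<delta>)" "card A = covering_number X \<delta>"
    using covering_number_attained[OF assms(1,3)] .
  obtain B where B: "finite B" "Y \<subseteq> (\<Union>x\<in>B. cball x \<delta>)" "card B = covering_number Y \<delta>"
    using covering_number_attained[OF assms(2,3)] .
  have "covering_number (X \<union> Y) \<delta> \<le> card (A \<union> B)"
    by (rule covering_number_le) (use A B in auto)
  also have "\<dots> \<le> card A + card B" by (rule card_Un_le)
  finally show ?thesis using A B by simp
qed

lemma covering_number_empty [simp]: "covering_number {} \<delta> = 0"
  using covering_number_le[of "{}" "{}" \<delta>] by simp

lemma covering_number_ge_separated:
  fixes E :: "'a::euclidean_space set"
  assumes "bounded E" "0 < \<delta>" "P \<subseteq> E" "finite P"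
    and sep: "\<And>x y. x \<in> P \<Longrightarrow> y \<in> P \<Longrightarrow> x \<noteq> y \<Longrightarrow> 2 * \<delta> < dist x y"
  shows "card P \<le> covering_number E \<delta>"
proof -
  obtain C where C: "finite C" "E \<subseteq> (\<Union>x\<in>C. cball x \<delta>)" "card C = covering_number E \<delta>"
    using covering_number_attained[OF assms(1,2)] .
  have "\<forall>x\<in>P. \<exists>c\<in>C. x \<in> cball c \<delta>" using C(2) assms(3) by blast
  then obtain f where f: "\<And>x. x \<in> P \<Longrightarrow> f x \<in> C \<and> x \<in> cball (f x) \<delta>" by metis
  have "inj_on f P"
  proof (rule inj_onI, rule ccontr)
    fix x y assume xy: "x \<in> P" "y \<in> P" "f x = f y" "x \<noteq> y"
    then have "dist (f x) x \<le> \<delta>" "dist (f x) y \<le> \<delta>" using f[of x] f[of y] by auto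
    then show False using sep[OF xy(1,2,4)] dist_triangle3[of x y "f x"] by linarith
  qed
  then have "card P \<le> card C" using f C(1) by (intro card_inj_on_le) auto
  then show ?thesis using C(3) by simp
qed

definition subadditive_on :: "'a set \<Rightarrow> ('a set \<Rightarrow> real) \<Rightarrow> bool"
  where "subadditive_on E h \<longleftrightarrow> h {} \<le> 0 \<and> (\<forall>X\<subseteq>E. \<forall>Y\<subseteq>E. h (X \<union> Y) \<le> h X + h Y)"

lemma subadditive_on_UN:
  assumes "subadditive_on E h" "finite I" "\<And>i. i \<in> I \<Longrightarrow> Y i \<subseteq> E"
  shows "h (\<Union>i\<in>I. Y i) \<le> (\<Sum>i\<in>I. h (Y i))"
  using assms(2,3)
proof (induction I)
  case empty
  then show ?case using assms(1) by (simp add: subadditive_on_def)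
next
  case (insert i I)
  have "h (Y i \<union> (\<Union>i\<in>I. Y i)) \<le> h (Y i) + h (\<Union>i\<in>I. Y i)"
    using assms(1) insert.prems unfolding subadditive_on_def by (meson UN_least insertCI)
  also have "\<dots> \<le> h (Y i) + (\<Sum>i\<in>I. h (Y i))" using insert by auto
  finally show ?case using insert by simp
qed

lemma subadditive_covering_number:
  fixes E :: "'a::euclidean_space set"
  assumes "bounded E" "0 < \<delta>"
  shows "subadditive_on E (\<lambda>Y. real (covering_number Y \<delta>))"
  unfolding subadditive_on_def
proof (intro conjI allI impI)
  fix X Y assume "X \<subseteq> E" "Y \<subseteq> E"
  then have "covering_number (X \<union> Y) \<delta> \<le> covering_number X \<delta> + covering_number Y \<delta>"
    using assms by (intro covering_number_Un) (auto intro: bounded_subset)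
  then show "real (covering_number (X \<union> Y) \<delta>) \<le> real (covering_number X \<delta>) + real (covering_number Y \<delta>)"
    by linarith
qed simp

lemma covering_number_le_1:
  assumes "\<And>x y. x \<in> Y \<Longrightarrow> y \<in> Y \<Longrightarrow> dist x y \<le> \<delta>"
  shows "covering_number Y \<delta> \<le> 1"
proof (cases "Y = {}")
  case False
  then obtain y where y: "y \<in> Y" by blast
  have "Y \<subseteq> (\<Union>x\<in>{y}. cball x \<delta>)" using assms[OF y] by auto
  then show ?thesis using covering_number_le[of "{y}" Y \<delta>] by simp
qed simp

context LG_sponge
begin

section \<open>Words that map the cube into its interior\<close>

text \<open>
  If all digits fixed the face \<open>x $ k = 0\<close>, every point of \<open>L\<close> would be within \<open>(1 - q) ^ m\<close> of
  it for all \<open>m\<close>, so \<open>L\<close> would be contained in a facet. The opposite face is treated in the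
  same way.
\<close>

lemma nondegenerate_digits:
  shows "\<exists>a\<in>D. 0 < t k (a k)" and "\<exists>a\<in>D. t k (a k) + r k (a k) < 1"
proof -
  have L_cbox: "L \<subseteq> cbox 0 1" using L_cube by (auto simp: mem_box_cart)
  have nf: "\<not> L \<subseteq> {x \<in> cbox 0 1. x $ k = s}" if "s = 0 \<or> s = 1" for s
    using nondeg facet_of_unit_cube[OF that] unfolding nondegenerated_def by blast
  have lim: "x = 0" if "\<And>m. 0 \<le> x \<and> x \<le> (1 - q) ^ m" for x :: real
  proof (rule ccontr)
    assume "x \<noteq> 0"
    then have "0 < x" using that[of 0] by auto
    then obtain m where "(1 - q) ^ m < x" using real_arch_pow_inv[of x "1 - q"] q_bounds by auto
    then show False using that[of m] by simp
  qed
  show "\<exists>a\<in>D. 0 < t k (a k)"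
  proof (rule ccontr)
    assume "\<not> ?thesis"
    then have t0: "t k (a k) = 0" if "a \<in> D" for a using digit_bounds(3)[OF that, of k] that by force
    have tau0: "tau w k = 0" if "w \<in> lists D" for w using that t0 by (induction w) auto
    have "x $ k = 0" if x: "x \<in> L" for x
    proof (rule lim)
      fix m
      obtain w y where w: "w \<in> lists D" "length w = m" "y \<in> L" "x = phi w y" using L_word[OF x, of m] by auto
      have "x $ k = rho w k * y $ k" using w tau0 by (simp add: phi_nth)
      also have "\<dots> \<le> (1 - q) ^ m * 1"
        by (intro mult_mono) (use w rho_upper[OF w(1), of k] L_cube[OF w(3)] q_bounds in auto)
      finally show "0 \<le> x $ k \<and> x $ k \<le> (1 - q) ^ m" using L_cube[OF x] by simp
    qed
    then show False using nf[of 0] L_cbox by auto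
  qed
  show "\<exists>a\<in>D. t k (a k) + r k (a k) < 1"
  proof (rule ccontr)
    assume "\<not> ?thesis"
    then have t0: "t k (a k) = 1 - r k (a k)" if "a \<in> D" for a using digit_bounds(4)[OF that, of k] that by force
    have tau0: "tau w k = 1 - rho w k" if "w \<in> lists D" for w
      using that t0 by (induction w) (simp_all add: right_diff_distrib)
    have "1 - x $ k = 0" if x: "x \<in> L" for x
    proof (rule lim)
      fix m
      obtain w y where w: "w \<in> lists D" "length w = m" "y \<in> L" "x = phi w y" using L_word[OF x, of m] by auto
      have "1 - x $ k = rho w k * (1 - y $ k)" using w tau0 by (simp add: phi_nth algebra_simps)
      also have "\<dots> \<le> (1 - q) ^ m * 1"
        by (intro mult_mono) (use w rho_upper[OF w(1), of k] L_cube[OF w(3)] q_bounds in auto)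
      finally show "0 \<le> 1 - x $ k \<and> 1 - x $ k \<le> (1 - q) ^ m" using L_cube[OF x] by simp
    qed
    then show False using nf[of 1] L_cbox by auto
  qed
qed

text \<open>
  A word maps the cube into the open cube as soon as it contains, for each face, a digit that
  leaves this face. An enumeration of \<open>D\<close> is such a word.
\<close>

lemma interior_word:
  obtains v \<gamma> where "v \<in> lists D" "0 < \<gamma>" "\<And>k. \<gamma> \<le> tau v k" "\<And>k. tau v k + rho v k \<le> 1 - \<gamma>"
proof -
  obtain v where v: "set v = D" using finite_list[OF finite_D] by blast
  have tau_pos: "0 < tau w k" if "w \<in> lists D" "a \<in> set w" "0 < t k (a k)" for w a k
    using that
  proof (induction w)
    case (Cons b w)
    have b: "0 < r k (b k)" "0 \<le> t k (b k)" "0 \<le> tau w k" using Cons digit_bounds[of b k] tau_nonneg[of w k] by auto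
    show ?case
    proof (cases "a = b")
      case True
      then show ?thesis using Cons b by (simp add: add_nonneg_pos)
    next
      case False
      then have "0 < tau w k" using Cons by auto
      then show ?thesis using b by (simp add: add_pos_nonneg)
    qed
  qed auto
  have tau_less: "tau w k + rho w k < 1" if "w \<in> lists D" "a \<in> set w" "t k (a k) + r k (a k) < 1" for w a k
    using that
  proof (induction w)
    case (Cons b w)
    have b: "0 < r k (b k)" "r k (b k) + t k (b k) \<le> 1" "tau w k + rho w k \<le> 1"
      using Cons digit_bounds[of b k] tau_rho_le_1[of w k] by auto
    have e: "tau (b # w) k + rho (b # w) k = r k (b k) * (tau w k + rho w k) + t k (b k)"
      by (simp add: algebra_simps)
    have "r k (b k) * (tau w k + rho w k) \<le> r k (b k) * 1" using b by (intro mult_left_mono) auto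
    moreover have "r k (b k) * (tau w k + rho w k) < r k (b k) * 1" if "a \<noteq> b"
      using that Cons b(1) by (intro mult_strict_left_mono) auto
    ultimately show ?case
      unfolding e using Cons.prems(2) b by (cases "a = b", hypsubst, linarith, metis add_strict_right_mono less_le_trans mult_1_right)
  qed auto
  have vD: "v \<in> lists D" using v by auto
  have pos: "0 < tau v k" "tau v k + rho v k < 1" for k
    using nondegenerate_digits[of k] tau_pos[OF vD] tau_less[OF vD] v by auto
  define \<gamma> where "\<gamma> = Min (range (\<lambda>k. min (tau v k) (1 - tau v k - rho v k)))"
  have "\<gamma> \<in> range (\<lambda>k. min (tau v k) (1 - tau v k - rho v k))"
    unfolding \<gamma>_def by (rule Min_in) auto
  then have "0 < \<gamma>" using pos by (auto simp: min_def algebra_simps)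
  moreover have "\<gamma> \<le> min (tau v k) (1 - tau v k - rho v k)" for k
    unfolding \<gamma>_def by (rule Min_le) auto
  then have "\<gamma> \<le> tau v k \<and> \<gamma> \<le> 1 - tau v k - rho v k" for k
    unfolding min.bounded_iff .
  then have "\<gamma> \<le> tau v k" "tau v k + rho v k \<le> 1 - \<gamma>" for k
    by (metis, smt (verit))
  ultimately show thesis using that vD by blast
qed

section \<open>Sets lying over a cylinder\<close>

text \<open>
  In the coordinates of \<open>S\<close> the set \<open>Y\<close> is the cylinder \<open>w\<close>. In the other coordinates, which
  have been dropped, it is required to be \<open>flat\<close>: not wider than \<open>\<delta>\<close>. Such sets are the unions
  of approximate cubes that occur in the refinement process; \<open>part S Y w\<close> is the piece of \<open>Y\<close>
  over a subcylinder.
\<close>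

definition shadow where "shadow S w Y \<longleftrightarrow> proj S ` Y = proj S ` phi w ` L"

definition part where "part S Y w = {y \<in> Y. proj S y \<in> proj S ` phi w ` L}"

definition flat :: "'n set \<Rightarrow> real \<Rightarrow> (real ^ 'n::{finite,linorder}) set \<Rightarrow> bool"
  where "flat S \<delta> Y \<longleftrightarrow> (\<forall>k. k \<notin> S \<longrightarrow> (\<forall>x\<in>Y. \<forall>y\<in>Y. \<bar>x $ k - y $ k\<bar> \<le> \<delta>))"

lemma part_subset: "part S Y w \<subseteq> Y"
  by (auto simp: part_def)

lemma flat_subset: "flat S \<delta> Y \<Longrightarrow> X \<subseteq> Y \<Longrightarrow> flat S \<delta> X"
  unfolding flat_def by blast

lemma shadow_part:
  assumes "shadow S w Y" "u \<in> lists D"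
  shows "shadow S (w @ u) (part S Y (w @ u))"
proof -
  have "phi (w @ u) ` L \<subseteq> phi w ` L" using assms(2) phi_L by (auto simp: phi_append)
  then have sub: "proj S ` phi (w @ u) ` L \<subseteq> proj S ` Y" using assms(1) unfolding shadow_def by blast
  show ?thesis
    unfolding shadow_def part_def
  proof (intro subset_antisym subsetI)
    fix x assume x: "x \<in> proj S ` phi (w @ u) ` L"
    then obtain y where "y \<in> Y" "x = proj S y" using sub by (meson imageE subsetD)
    then show "x \<in> proj S ` {y \<in> Y. proj S y \<in> proj S ` phi (w @ u) ` L}" using x by simp
  qed (elim imageE CollectE conjE, simp)
qed

lemma shadowE:
  assumes "shadow S w Y" "y \<in> Y"
  obtains z where "z \<in> L" "proj S y = proj S (phi w z)"
  using assms unfolding shadow_def by blast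

lemma shadow_lift:
  assumes "shadow S w Y" "z \<in> L"
  obtains y where "y \<in> Y" "proj S y = proj S (phi w z)"
  using assms unfolding shadow_def by (metis (no_types, lifting) image_eqI imageE)

lemma part_rep:
  assumes "y \<in> Y" "proj S y = proj S (phi (w @ [a]) z)" "z \<in> L" "restrict b S = restrict a S"
  shows "y \<in> part S Y (w @ [b])" "proj S y = proj S (phi (w @ [b]) z)"
proof -
  show e: "proj S y = proj S (phi (w @ [b]) z)"
    unfolding assms(2) by (rule proj_phi_restrict) (simp del: restrict_def add: assms(4))
  show "y \<in> part S Y (w @ [b])" unfolding part_def using e assms by blast
qed

lemma Union_part:
  assumes "shadow S w Y"
  shows "Y = (\<Union>a\<in>transversal S. part S Y (w @ [a]))"
proof (intro subset_antisym subsetI)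
  fix y assume y: "y \<in> Y"
  then obtain z where z: "z \<in> L" "proj S y = proj S (phi w z)" by (rule shadowE[OF assms])
  then obtain a z' where a: "a \<in> D" "z' \<in> L" "z = sponge_map r t a z'" using L_eq by blast
  obtain b where b: "b \<in> transversal S" "restrict b S = restrict a S" using transversal_rep[OF a(1)] .
  have "y \<in> part S Y (w @ [b])"
    by (rule part_rep[OF y _ a(2) b(2)]) (use z a in \<open>simp add: phi_append phi_Cons\<close>)
  then show "y \<in> (\<Union>a\<in>transversal S. part S Y (w @ [a]))" using b by blast
qed (auto simp: part_def)

lemma shadow_mono:
  assumes "shadow S w Y" "A \<subseteq> S" shows "shadow A w Y"
proof -
  have "proj A ` X = proj A ` proj S ` X" for X
    unfolding image_image using proj_proj_subset[OF assms(2)] by simp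
  then show ?thesis using assms(1) unfolding shadow_def by metis
qed

lemma shadow_nonempty: "shadow S w Y \<Longrightarrow> Y \<noteq> {}"
  using L_nonempty unfolding shadow_def by auto

lemma shadow_UNIV: "shadow UNIV w (phi w ` L)"
  by (simp add: shadow_def)

lemma shadow_nth:
  assumes "shadow S w Y" "y \<in> Y" "k \<in> S" "w \<in> lists D"
  shows "tau w k \<le> y $ k" "y $ k \<le> tau w k + rho w k"
proof -
  obtain z where z: "z \<in> L" "proj S y = proj S (phi w z)" using shadowE[OF assms(1,2)] .
  then have "y $ k = rho w k * z $ k + tau w k" using assms(3) by (simp add: proj_eq_iff phi_nth)
  then show "tau w k \<le> y $ k" "y $ k \<le> tau w k + rho w k"
    using L_cube[OF z(1), of k] rho_pos[OF assms(4), of k] by (auto simp: mult_left_le)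
qed

lemma flat_drop:
  assumes "shadow (insert b A) w Y" "flat (insert b A) \<delta> Y" "rho w b \<le> \<delta>" "w \<in> lists D"
  shows "flat A \<delta> Y"
  unfolding flat_def
proof (intro allI impI ballI)
  fix k x y assume k: "k \<notin> A" "x \<in> Y" "y \<in> Y"
  show "\<bar>x $ k - y $ k\<bar> \<le> \<delta>"
  proof (cases "k = b")
    case True
    then show ?thesis using shadow_nth[OF assms(1) k(2) _ assms(4), of b] shadow_nth[OF assms(1) k(3) _ assms(4), of b] assms(3) by auto
  next
    case False
    then show ?thesis using assms(2) k unfolding flat_def by blast
  qed
qed

section \<open>Upper bounds for subadditive quantities\<close>

definition bounded_size :: "('n \<Rightarrow> nat) list set \<Rightarrow> real \<Rightarrow> 'n set \<Rightarrow> real \<Rightarrow> real \<Rightarrow> (real ^ 'n::{finite,linorder}) set \<Rightarrow> ((real ^ 'n::{finite,linorder}) set \<Rightarrow> real) \<Rightarrow> bool"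
  where "bounded_size W C S M \<delta> E h \<longleftrightarrow> (\<forall>w\<in>W. \<forall>Y\<subseteq>E.
    (\<forall>k\<in>S. \<delta> \<le> M * rho w k) \<longrightarrow> shadow S w Y \<longrightarrow> flat S \<delta> Y \<longrightarrow> h Y \<le> C * Psi S w \<delta>)"

text \<open>
  Subadditivity of \<open>h\<close> is the split rule. The drop rule holds with empty guard words, since a
  set over a cylinder with side at most \<open>\<delta>\<close> in coordinate \<open>b\<close> becomes flat in this coordinate.
\<close>

lemma bounded_size_climb:
  assumes "down_closed S" "down_closed S\<^sub>0" "S\<^sub>0 \<subset> S" "1 \<le> M"
  shows "\<exists>M'\<ge>1. \<exists>K\<ge>1. \<forall>\<delta>>0. \<forall>E h. \<forall>C\<ge>0. subadditive_on E h \<longrightarrow>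
    bounded_size (dropped S\<^sub>0 M' \<delta>) C S\<^sub>0 M' \<delta> E h \<longrightarrow> bounded_size (lists D) (C * K) S M \<delta> E h"
proof -
  obtain M' K where MK: "1 \<le> M'" "1 \<le> K" and climb: "\<And>\<delta> F c C. 0 < \<delta> \<Longrightarrow> 0 \<le> c \<Longrightarrow> 0 \<le> C \<Longrightarrow> split_rule S\<^sub>0 F \<Longrightarrow>
        drop_rule S\<^sub>0 (\<lambda>_. []) M' \<delta> F \<Longrightarrow> counts (dropped S\<^sub>0 M' \<delta>) c C S\<^sub>0 M' \<delta> F \<Longrightarrow> counts (lists D) (c / K) (C * K) S M \<delta> F"
    using counts_climb[OF _ assms, of "\<lambda>_. []"] by auto
  show ?thesis
  proof (rule exI[of _ M'], rule conjI, rule MK, rule exI[of _ K], rule conjI, rule MK, intro allI impI)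
    fix \<delta> :: real and E :: "(real ^ 'n::{finite,linorder}) set" and h :: "(real ^ 'n::{finite,linorder}) set \<Rightarrow> real" and C :: real
    assume as: "0 < \<delta>" "0 \<le> C" "subadditive_on E h" "bounded_size (dropped S\<^sub>0 M' \<delta>) C S\<^sub>0 M' \<delta> E h"
    define F where "F S w x \<longleftrightarrow> (\<forall>Y\<subseteq>E. shadow S w Y \<longrightarrow> flat S \<delta> Y \<longrightarrow> h Y \<le> x)" for S w and x :: real
    have split: "split_rule S\<^sub>0 F"
      unfolding split_rule_def
    proof (intro allI impI)
      fix S w and x :: "('n \<Rightarrow> nat) \<Rightarrow> real"
      assume a: "down_closed S" "S\<^sub>0 \<subset> S" "w \<in> lists D" "\<forall>a\<in>transversal S. F S (w @ [a]) (x a)"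
      show "F S w (\<Sum>a\<in>transversal S. x a)"
        unfolding F_def
      proof (intro allI impI)
        fix Y assume Y: "Y \<subseteq> E" "shadow S w Y" "flat S \<delta> Y"
        have "h Y = h (\<Union>a\<in>transversal S. part S Y (w @ [a]))" using Union_part[OF Y(2)] by metis
        also have "\<dots> \<le> (\<Sum>a\<in>transversal S. h (part S Y (w @ [a])))"
          by (rule subadditive_on_UN[OF as(3)]) (use Y(1) part_subset[of S Y] in \<open>auto intro: order_trans\<close>)
        also have "\<dots> \<le> (\<Sum>a\<in>transversal S. x a)"
        proof (rule sum_mono)
          fix b assume b: "b \<in> transversal S"
          have "shadow S (w @ [b]) (part S Y (w @ [b]))"
            using shadow_part[OF Y(2), of "[b]"] transversalD[OF b] by simp
          moreover have "flat S \<delta> (part S Y (w @ [b]))" using flat_subset[OF Y(3) part_subset] .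
          ultimately show "h (part S Y (w @ [b])) \<le> x b"
            using a(4) b Y(1) part_subset unfolding F_def by (meson order_trans)
        qed
        finally show "h Y \<le> (\<Sum>a\<in>transversal S. x a)" .
      qed
    qed
    have drop: "drop_rule S\<^sub>0 (\<lambda>_. []) M' \<delta> F"
      unfolding drop_rule_def F_def
      using flat_drop shadow_mono[OF _ subset_insertI] by (auto simp: append_Nil2)
    have "counts (dropped S\<^sub>0 M' \<delta>) 0 C S\<^sub>0 M' \<delta> F"
      unfolding counts_def
    proof (intro ballI impI)
      fix w assume w: "w \<in> dropped S\<^sub>0 M' \<delta>" "\<forall>k\<in>S\<^sub>0. \<delta> \<le> M' * rho w k"
      have "F S\<^sub>0 w (C * Psi S\<^sub>0 w \<delta>)" using as(4) w unfolding F_def bounded_size_def by blast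
      moreover have "0 \<le> C * Psi S\<^sub>0 w \<delta>" using Psi_pos[OF subsetD[OF dropped_subset w(1)] as(1), of "S\<^sub>0"] as(2) by simp
      ultimately show "\<exists>x. F S\<^sub>0 w x \<and> 0 * Psi S\<^sub>0 w \<delta> \<le> x \<and> x \<le> C * Psi S\<^sub>0 w \<delta>" by auto
    qed
    with climb[OF as(1) order_refl as(2) split drop] have "counts (lists D) (0 / K) (C * K) S M \<delta> F" by blast
    then show "bounded_size (lists D) (C * K) S M \<delta> E h"
      unfolding counts_def F_def bounded_size_def by (meson order_trans)
  qed
qed

text \<open>
  When all coordinates have been dropped, a flat set has diameter at most \<open>CARD('n) * \<delta>\<close> and is
  covered by one ball.
\<close>

lemma covering_number_upper:
  assumes "down_closed S" "S \<noteq> {}" "1 \<le> M"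
  shows "\<exists>C\<ge>1. \<forall>\<delta>>0. \<forall>E. bounded E \<longrightarrow>
    bounded_size (lists D) C S M \<delta> E (\<lambda>Y. real (covering_number Y (real CARD('n) * \<delta>)))"
proof -
  obtain M' K where MK: "1 \<le> M'" "1 \<le> K" and climb: "\<And>\<delta> E h C. 0 < \<delta> \<Longrightarrow> 0 \<le> C \<Longrightarrow> subadditive_on E h \<Longrightarrow>
    bounded_size (dropped {} M' \<delta>) C {} M' \<delta> E h \<Longrightarrow> bounded_size (lists D) (C * K) S M \<delta> E h"
    using bounded_size_climb[OF assms(1) down_closed_empty _ assms(3)] assms(2) by (metis psubsetI empty_subsetI)
  show ?thesis
  proof (rule exI[of _ K], rule conjI, rule MK, intro allI impI)
    fix \<delta> :: real and E :: "(real ^ 'n::{finite,linorder}) set"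
    assume \<delta>: "0 < \<delta>" and E: "bounded E"
    have "real (covering_number Y (real CARD('n) * \<delta>)) \<le> 1" if "flat {} \<delta> Y" for Y
    proof -
      have "covering_number Y (real CARD('n) * \<delta>) \<le> 1"
        by (rule covering_number_le_1, rule dist_le_card_mult) (use that in \<open>auto simp: flat_def\<close>)
      then show ?thesis by simp
    qed
    then have "bounded_size (dropped {} M' \<delta>) 1 {} M' \<delta> E (\<lambda>Y. real (covering_number Y (real CARD('n) * \<delta>)))"
      by (simp add: bounded_size_def Psi_def)
    then show "bounded_size (lists D) K S M \<delta> E (\<lambda>Y. real (covering_number Y (real CARD('n) * \<delta>)))"
      using climb[OF \<delta> _ subadditive_covering_number[OF E], of 1] \<delta> by simp
  qed
qed

end

section \<open>Chain components\<close>

lemma chain_equiv_subset: "chain_equiv E \<delta> \<subseteq> E \<times> E"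
  unfolding chain_equiv_def by (rule trancl_subset_Sigma) auto

lemma equiv_chain_equiv:
  assumes "0 \<le> \<delta>"
  shows "equiv E (chain_equiv E \<delta>)"
proof (rule equivI)
  show "chain_equiv E \<delta> \<subseteq> E \<times> E" by (rule chain_equiv_subset)
  show "refl_on E (chain_equiv E \<delta>)"
    using assms by (auto intro!: refl_onI r_into_trancl simp: chain_equiv_def)
  show "sym (chain_equiv E \<delta>)"
    unfolding chain_equiv_def by (intro sym_trancl) (auto simp: sym_def dist_commute)
  show "trans (chain_equiv E \<delta>)"
    unfolding chain_equiv_def by (rule trans_trancl)
qed

lemma chain_equiv_step: "x \<in> E \<Longrightarrow> y \<in> E \<Longrightarrow> dist x y \<le> \<delta> \<Longrightarrow> (x, y) \<in> chain_equiv E \<delta>"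
  unfolding chain_equiv_def by (rule r_into_trancl) auto

lemma chain_equiv_trans: "(x, y) \<in> chain_equiv E \<delta> \<Longrightarrow> (y, z) \<in> chain_equiv E \<delta> \<Longrightarrow> (x, z) \<in> chain_equiv E \<delta>"
  unfolding chain_equiv_def by (rule trancl_trans)

lemma chain_equiv_stays:
  assumes "(x, y) \<in> chain_equiv E \<delta>" "x \<in> I" "\<And>x y. x \<in> E \<inter> I \<Longrightarrow> y \<in> E - I \<Longrightarrow> \<delta> < dist x y"
  shows "y \<in> I"
  using assms(1,2) unfolding chain_equiv_def
proof (induction rule: trancl_induct)
  case (base y)
  then show ?case using assms(3)[of x y] by auto
next
  case (step y z)
  then show ?case using assms(3)[of y z] by auto
qed

text \<open>
  The classes are those of \<open>E\<close>, not of \<open>Y\<close>; this makes the number subadditive and monotone in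
  \<open>Y\<close>.
\<close>

definition classes_meeting :: "'a::metric_space set \<Rightarrow> real \<Rightarrow> 'a set \<Rightarrow> nat"
  where "classes_meeting E \<delta> Y = card ((\<lambda>y. chain_equiv E \<delta> `` {y}) ` Y)"

lemma component_count_eq: "component_count E \<delta> = classes_meeting E \<delta> E"
  unfolding component_count_def classes_meeting_def quotient_def
  by (rule arg_cong[where f = card]) auto

lemma classes_meeting_le_covering_number:
  fixes Y :: "'a::euclidean_space set"
  assumes "bounded Y" "Y \<subseteq> E" "0 < \<delta>"
  shows "finite ((\<lambda>y. chain_equiv E (2 * \<delta>) `` {y}) ` Y)"
    and "classes_meeting E (2 * \<delta>) Y \<le> covering_number Y \<delta>"
proof -
  obtain C where C: "finite C" "Y \<subseteq> (\<Union>x\<in>C. cball x \<delta>)" "card C = covering_number Y \<delta>"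
    using covering_number_attained[OF assms(1,3)] .
  define h where "h c = chain_equiv E (2 * \<delta>) `` {SOME y. y \<in> Y \<inter> cball c \<delta>}" for c
  have eq: "equiv E (chain_equiv E (2 * \<delta>))" using assms(3) by (intro equiv_chain_equiv) simp
  have sub: "(\<lambda>y. chain_equiv E (2 * \<delta>) `` {y}) ` Y \<subseteq> h ` C"
  proof (intro image_subsetI)
    fix y assume y: "y \<in> Y"
    then obtain c where c: "c \<in> C" "y \<in> cball c \<delta>" using C(2) by blast
    define z where "z = (SOME y. y \<in> Y \<inter> cball c \<delta>)"
    have z: "z \<in> Y \<inter> cball c \<delta>" unfolding z_def by (rule someI[of _ y]) (use y c in auto)
    then have "dist c z \<le> \<delta>" "dist c y \<le> \<delta>" using c by auto
    then have "dist y z \<le> 2 * \<delta>" using dist_triangle3[of y z c] by linarith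
    then have "(y, z) \<in> chain_equiv E (2 * \<delta>)" using y z assms(2) by (intro chain_equiv_step) auto
    then have "chain_equiv E (2 * \<delta>) `` {y} = h c"
      unfolding h_def z_def[symmetric] by (rule equiv_class_eq[OF eq])
    then show "chain_equiv E (2 * \<delta>) `` {y} \<in> h ` C" using c(1) by blast
  qed
  then show "finite ((\<lambda>y. chain_equiv E (2 * \<delta>) `` {y}) ` Y)" using C(1) finite_surj by blast
  have "card ((\<lambda>y. chain_equiv E (2 * \<delta>) `` {y}) ` Y) \<le> card (h ` C)"
    by (rule card_mono) (use sub C in auto)
  also have "\<dots> \<le> card C" using C(1) by (rule card_image_le)
  finally show "classes_meeting E (2 * \<delta>) Y \<le> covering_number Y \<delta>"
    unfolding classes_meeting_def using C by simp
qed

text \<open>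
  A chain cannot leave a set whose distance to the rest of \<open>E\<close> exceeds the step size.
\<close>

lemma card_islands_le_component_count:
  fixes E :: "'a::euclidean_space set"
  assumes "bounded E" "0 < \<delta>" "finite \<I>" "disjoint \<I>"
    and meet: "\<And>I. I \<in> \<I> \<Longrightarrow> I \<inter> E \<noteq> {}"
    and sep: "\<And>I x y. I \<in> \<I> \<Longrightarrow> x \<in> E \<inter> I \<Longrightarrow> y \<in> E - I \<Longrightarrow> \<delta> < dist x y"
  shows "card \<I> \<le> component_count E \<delta>"
proof -
  obtain f where f: "\<And>I. I \<in> \<I> \<Longrightarrow> f I \<in> I \<inter> E" using meet by (meson ex_in_conv)
  have eq: "equiv E (chain_equiv E \<delta>)" using assms(2) by (intro equiv_chain_equiv) simp
  have fin: "finite ((\<lambda>y. chain_equiv E \<delta> `` {y}) ` E)"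
    using classes_meeting_le_covering_number(1)[OF assms(1) order_refl, of "\<delta> / 2"] assms(2) by simp
  have "inj_on (\<lambda>I. chain_equiv E \<delta> `` {f I}) \<I>"
  proof (rule inj_onI)
    fix I J assume IJ: "I \<in> \<I>" "J \<in> \<I>" "chain_equiv E \<delta> `` {f I} = chain_equiv E \<delta> `` {f J}"
    then have "(f I, f J) \<in> chain_equiv E \<delta>" using f eq by (metis IntD2 eq_equiv_class)
    then have "f J \<in> I" by (rule chain_equiv_stays) (use f IJ sep in auto)
    then show "I = J" using f[OF IJ(2)] assms(4) IJ unfolding disjoint_def by blast
  qed
  then have "card \<I> = card ((\<lambda>I. chain_equiv E \<delta> `` {f I}) ` \<I>)" by (simp add: card_image)
  also have "\<dots> \<le> card ((\<lambda>y. chain_equiv E \<delta> `` {y}) ` E)"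
    by (rule card_mono[OF fin]) (use f in auto)
  finally show ?thesis by (simp add: component_count_eq classes_meeting_def)
qed

context LG_sponge
begin

lemma bounded_L: "bounded L"
  using compact_L compact_imp_bounded by blast

section \<open>Disjoint pieces of approximate cubes\<close>

definition open_box :: "'n set \<Rightarrow> ('n \<Rightarrow> nat) list \<Rightarrow> (real ^ 'n::{finite,linorder}) set"
  where "open_box S w = {x. \<forall>k\<in>S. tau w k < x $ k \<and> x $ k < tau w k + rho w k}"

lemma open_box_append:
  assumes "a \<in> D" "w \<in> lists D"
  shows "open_box S (w @ [a]) \<subseteq> open_box S w"
proof
  fix x assume x: "x \<in> open_box S (w @ [a])"
  have "tau w k < x $ k \<and> x $ k < tau w k + rho w k" if "k \<in> S" for k
  proof -
    have "0 \<le> rho w k * t k (a k)" using assms rho_pos[of w k] digit_bounds(3)[of a k] by simp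
    moreover have "rho w k * (r k (a k) + t k (a k)) \<le> rho w k * 1"
      using assms rho_pos[of w k] digit_bounds(4)[of a k] by (intro mult_left_mono) auto
    moreover have "tau (w @ [a]) k < x $ k \<and> x $ k < tau (w @ [a]) k + rho (w @ [a]) k"
      using x that unfolding open_box_def by blast
    ultimately show ?thesis by (simp add: tau_append algebra_simps)
  qed
  then show "x \<in> open_box S w" by (simp add: open_box_def)
qed

lemma open_box_disjoint:
  assumes "a \<in> transversal S" "b \<in> transversal S" "a \<noteq> b" "down_closed S" "w \<in> lists D"
  shows "open_box S (w @ [a]) \<inter> open_box S (w @ [b]) = {}"
proof -
  have "restrict a S \<noteq> restrict b S" using transversal_props(2)[of S] assms(1-3) by (auto simp: inj_on_def)
  then obtain k where k: "k \<in> S" "t k (a k) + r k (a k) \<le> t k (b k) \<or> t k (b k) + r k (b k) \<le> t k (a k)"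
    using neat_digits assms transversalD by meson
  then have "rho w k * (t k (a k) + r k (a k)) \<le> rho w k * t k (b k) \<or> rho w k * (t k (b k) + r k (b k)) \<le> rho w k * t k (a k)"
    using rho_pos[OF assms(5), of k] by (simp only: mult_le_cancel_left_pos)
  then have k': "tau (w @ [a]) k + rho (w @ [a]) k \<le> tau (w @ [b]) k \<or> tau (w @ [b]) k + rho (w @ [b]) k \<le> tau (w @ [a]) k"
    by (simp add: tau_append algebra_simps)
  have False if x: "x \<in> open_box S (w @ [a])" "x \<in> open_box S (w @ [b])" for x
  proof -
    have "tau (w @ [a]) k < x $ k" "x $ k < tau (w @ [a]) k + rho (w @ [a]) k"
      "tau (w @ [b]) k < x $ k" "x $ k < tau (w @ [b]) k + rho (w @ [b]) k"
      using x k(1) unfolding open_box_def by blast+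
    then show False using k' by linarith
  qed
  then show ?thesis by blast
qed

text \<open>
  Read \<open>P S w Y I\<close> as: \<open>I\<close> is an admissible piece for the set \<open>Y\<close> over the cylinder \<open>w\<close>. Pieces
  lie in the open box of \<open>w\<close>, so that pieces for different digits are disjoint. They remain
  admissible for larger cylinders, can be shrunk to admissible ones when a coordinate is
  dropped, and exist when no coordinate is left.
\<close>

definition piece_rules :: "('n set \<Rightarrow> ('n \<Rightarrow> nat) list) \<Rightarrow> real \<Rightarrow> real \<Rightarrow>
    ('n set \<Rightarrow> ('n \<Rightarrow> nat) list \<Rightarrow> (real ^ 'n::{finite,linorder}) set \<Rightarrow> (real ^ 'n::{finite,linorder}) set \<Rightarrow> bool) \<Rightarrow> bool"
  where "piece_rules v M \<delta> P \<longleftrightarrow>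
    (\<forall>S w Y I. P S w Y I \<longrightarrow> I \<noteq> {} \<and> I \<subseteq> open_box S w) \<and>
    (\<forall>S w Y I. \<forall>a\<in>D. w \<in> lists D \<longrightarrow> P S (w @ [a]) (part S Y (w @ [a])) I \<longrightarrow> P S w Y I) \<and>
    (\<forall>b A w. \<forall>Y\<subseteq>L. \<forall>I. down_closed (insert b A) \<longrightarrow> (\<forall>a\<in>A. a < b) \<longrightarrow> w \<in> lists D \<longrightarrow> \<delta> \<le> M * rho w b \<longrightarrow>
      shadow (insert b A) w Y \<longrightarrow> P A (w @ v (insert b A)) (part (insert b A) Y (w @ v (insert b A))) I \<longrightarrow>
      (\<exists>J\<subseteq>I. P (insert b A) w Y J)) \<and>
    (\<forall>w. \<forall>Y\<subseteq>L. Y \<noteq> {} \<longrightarrow> (\<exists>I. P {} w Y I))"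

text \<open>
  The largest number of disjoint pieces is superadditive under refinement, and shrinking keeps
  pieces disjoint and distinct, so \<open>counts_climb\<close> bounds it from below.
\<close>

lemma disjoint_pieces:
  assumes v: "\<And>S. v S \<in> lists D"
  shows "\<exists>M\<ge>1. \<exists>\<kappa>>0. \<forall>\<delta>>0. \<forall>P. piece_rules v M \<delta> P \<longrightarrow> (\<forall>w\<in>lists D. (\<forall>k. \<delta> \<le> rho w k) \<longrightarrow>
    (\<exists>\<I>. finite \<I> \<and> disjoint \<I> \<and> \<kappa> * Psi UNIV w \<delta> \<le> real (card \<I>) \<and> (\<forall>I\<in>\<I>. P UNIV w (phi w ` L) I)))"
proof -
  obtain M K where MK: "1 \<le> M" "1 \<le> K" and climb: "\<And>\<delta> F c C. 0 < \<delta> \<Longrightarrow> 0 \<le> c \<Longrightarrow> 0 \<le> C \<Longrightarrow> split_rule {} F \<Longrightarrow>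
        drop_rule {} v M \<delta> F \<Longrightarrow> counts (dropped {} M \<delta>) c C {} M \<delta> F \<Longrightarrow> counts (lists D) (c / K) (C * K) UNIV 1 \<delta> F"
    using counts_climb[of v UNIV "{}" 1] v by (auto simp: psubset_eq)
  show ?thesis
  proof (rule exI[of _ M], rule conjI, rule MK, rule exI[of _ "1 / K"], rule conjI, use MK in simp, intro allI impI ballI)
    fix \<delta> :: real and P w assume \<delta>: "0 < \<delta>" and P: "piece_rules v M \<delta> P" and w: "w \<in> lists D" "\<forall>k. \<delta> \<le> rho w k"
    have box: "I \<noteq> {}" "I \<subseteq> open_box S w" if "P S w Y I" for S w Y I
      using P[unfolded piece_rules_def, THEN conjunct1, rule_format, OF that] by simp_all
    have up: "P S w Y I" if "a \<in> D" "w \<in> lists D" "P S (w @ [a]) (part S Y (w @ [a])) I" for S w Y I a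
      using P[unfolded piece_rules_def, THEN conjunct2, THEN conjunct1, rule_format, OF that] .
    define F where "F S w x \<longleftrightarrow> (\<forall>Y\<subseteq>L. shadow S w Y \<longrightarrow>
      (\<exists>\<I>. finite \<I> \<and> disjoint \<I> \<and> x \<le> real (card \<I>) \<and> (\<forall>I\<in>\<I>. P S w Y I)))" for S w and x :: real
    have "split_rule {} F"
      unfolding split_rule_def
    proof (intro allI impI)
      fix S w and x :: "('n \<Rightarrow> nat) \<Rightarrow> real"
      assume a: "down_closed S" "{} \<subset> S" "w \<in> lists D" "\<forall>a\<in>transversal S. F S (w @ [a]) (x a)"
      let ?T = "transversal S"
      show "F S w (\<Sum>a\<in>?T. x a)"
        unfolding F_def
      proof (intro allI impI)
        fix Y assume Y: "Y \<subseteq> L" "shadow S w Y"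
        have "\<exists>\<I>. finite \<I> \<and> disjoint \<I> \<and> x b \<le> real (card \<I>) \<and> (\<forall>I\<in>\<I>. P S (w @ [b]) (part S Y (w @ [b])) I)"
          if b: "b \<in> ?T" for b
        proof -
          have "shadow S (w @ [b]) (part S Y (w @ [b]))"
            using shadow_part[OF Y(2), of "[b]"] transversalD[OF b] by simp
          then show ?thesis using a(4) b order_trans[OF part_subset Y(1)] unfolding F_def by blast
        qed
        then obtain \<I> where \<I>: "\<And>b. b \<in> ?T \<Longrightarrow> finite (\<I> b)" "\<And>b. b \<in> ?T \<Longrightarrow> disjoint (\<I> b)"
            "\<And>b. b \<in> ?T \<Longrightarrow> x b \<le> real (card (\<I> b))"
            "\<And>b I. b \<in> ?T \<Longrightarrow> I \<in> \<I> b \<Longrightarrow> P S (w @ [b]) (part S Y (w @ [b])) I"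
          by metis
        have dis: "I \<inter> J = {}" if ab: "a \<in> ?T" "b \<in> ?T" "a \<noteq> b" "I \<in> \<I> a" "J \<in> \<I> b" for a b I J
          using open_box_disjoint[OF ab(1-3) a(1,3)] box(2)[OF \<I>(4)[OF ab(1,4)]] box(2)[OF \<I>(4)[OF ab(2,5)]] by blast
        let ?I = "\<Union>a\<in>?T. \<I> a"
        have "card ?I = (\<Sum>a\<in>?T. card (\<I> a))"
        proof (rule card_UN_disjoint)
          show "\<forall>a\<in>?T. \<forall>b\<in>?T. a \<noteq> b \<longrightarrow> \<I> a \<inter> \<I> b = {}"
          proof (intro ballI impI, rule ccontr)
            fix a b assume ab: "a \<in> ?T" "b \<in> ?T" "a \<noteq> b" "\<I> a \<inter> \<I> b \<noteq> {}"
            then obtain I where I: "I \<in> \<I> a" "I \<in> \<I> b" by blast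
            then show False using dis[OF ab(1-3), of I I] box(1)[OF \<I>(4)[OF ab(1) I(1)]] by simp
          qed
        qed (use \<I>(1) in auto)
        then have "(\<Sum>a\<in>?T. x a) \<le> real (card ?I)" using \<I>(3) by (simp add: sum_mono)
        moreover have "finite ?I" using \<I>(1) by simp
        moreover have "disjoint ?I"
          unfolding disjoint_def
        proof (intro ballI impI)
          fix I J assume "I \<in> ?I" "J \<in> ?I" "I \<noteq> J"
          then obtain a b where ab: "a \<in> ?T" "b \<in> ?T" "I \<in> \<I> a" "J \<in> \<I> b" by blast
          show "I \<inter> J = {}"
          proof (cases "a = b")
            case True
            then show ?thesis using \<I>(2)[OF ab(1)] ab \<open>I \<noteq> J\<close> unfolding disjoint_def by blast
          qed (use dis ab in blast)
        qed
        moreover have "P S w Y I" if "I \<in> ?I" for I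
        proof -
          from that obtain b where b: "b \<in> ?T" "I \<in> \<I> b" by blast
          show ?thesis by (rule up[OF transversalD[OF b(1)] a(3) \<I>(4)[OF b]])
        qed
        ultimately show "\<exists>\<I>. finite \<I> \<and> disjoint \<I> \<and> (\<Sum>a\<in>?T. x a) \<le> real (card \<I>) \<and> (\<forall>I\<in>\<I>. P S w Y I)"
          by (intro exI[of _ ?I] conjI ballI) assumption+
      qed
    qed
    moreover have "drop_rule {} v M \<delta> F"
      unfolding drop_rule_def
    proof (intro allI impI)
      fix b A w and x :: real
      assume a: "down_closed (insert b A)" "\<forall>a\<in>A. a < b" "w \<in> lists D" "\<delta> \<le> M * rho w b"
        "F A (w @ v (insert b A)) x"
      let ?S = "insert b A" and ?v = "v (insert b A)"
      show "F ?S w x"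
        unfolding F_def
      proof (intro allI impI)
        fix Y assume Y: "Y \<subseteq> L" "shadow ?S w Y"
        let ?Y = "part ?S Y (w @ ?v)"
        have YL: "?Y \<subseteq> L" using Y(1) part_subset by blast
        have sh: "shadow A (w @ ?v) ?Y" using shadow_part[OF Y(2) v] by (rule shadow_mono) auto
        from a(5)[unfolded F_def, rule_format, OF YL sh] obtain \<I> where \<I>: "finite \<I>" "disjoint \<I>"
            "x \<le> real (card \<I>)" "\<forall>I\<in>\<I>. P A (w @ ?v) ?Y I" by (elim exE conjE) (rule that; assumption)
        have "\<exists>J\<subseteq>I. P ?S w Y J" if "I \<in> \<I>" for I
          using P[unfolded piece_rules_def, THEN conjunct2, THEN conjunct2, THEN conjunct1, rule_format,
              OF Y(1) a(1) _ a(3,4) Y(2)] a(2) \<I>(4) that by blast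
        then obtain f where f: "\<And>I. I \<in> \<I> \<Longrightarrow> f I \<subseteq> I" "\<And>I. I \<in> \<I> \<Longrightarrow> P ?S w Y (f I)" by metis
        have dis: "f I \<inter> f J = {}" if "I \<in> \<I>" "J \<in> \<I>" "I \<noteq> J" for I J
          using \<I>(2) that f(1)[OF that(1)] f(1)[OF that(2)] unfolding disjoint_def by blast
        have "inj_on f \<I>"
        proof (rule inj_onI, rule ccontr)
          fix I J assume IJ: "I \<in> \<I>" "J \<in> \<I>" "f I = f J" "I \<noteq> J"
          then show False using dis[OF IJ(1,2,4)] box(1)[OF f(2)[OF IJ(1)]] by simp
        qed
        then have "x \<le> real (card (f ` \<I>))" using \<I>(3) by (simp add: card_image)
        moreover have "disjoint (f ` \<I>)" using dis unfolding disjoint_def by blast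
        ultimately show "\<exists>\<I>. finite \<I> \<and> disjoint \<I> \<and> x \<le> real (card \<I>) \<and> (\<forall>I\<in>\<I>. P ?S w Y I)"
          using \<I>(1) f(2) by (intro exI[of _ "f ` \<I>"]) auto
      qed
    qed
    moreover have "counts (dropped {} M \<delta>) 1 1 {} M \<delta> F"
      unfolding counts_def
    proof (intro ballI impI)
      fix w
      have "F {} w 1"
        unfolding F_def
      proof (intro allI impI)
        fix Y assume "Y \<subseteq> L" "shadow {} w Y"
        then obtain I where "P {} w Y I"
          using P[unfolded piece_rules_def, THEN conjunct2, THEN conjunct2, THEN conjunct2, rule_format] shadow_nonempty by blast
        then show "\<exists>\<I>. finite \<I> \<and> disjoint \<I> \<and> 1 \<le> real (card \<I>) \<and> (\<forall>I\<in>\<I>. P {} w Y I)"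
          by (intro exI[of _ "{I}"]) auto
      qed
      then show "\<exists>x. F {} w x \<and> 1 * Psi {} w \<delta> \<le> x \<and> x \<le> 1 * Psi {} w \<delta>"
        by (intro exI[of _ 1]) (simp add: Psi_def)
    qed
    ultimately have "counts (lists D) (1 / K) (1 * K) UNIV 1 \<delta> F" using climb[OF \<delta>(1), of 1 1 F] by simp
    then obtain x where x: "F UNIV w x" "1 / K * Psi UNIV w \<delta> \<le> x"
      unfolding counts_def using w by (metis mult_1)
    have "phi w ` L \<subseteq> L" using phi_L[OF w(1)] by blast
    from x(1)[unfolded F_def, rule_format, OF this shadow_UNIV] obtain \<I> where "finite \<I>" "disjoint \<I>"
      "x \<le> real (card \<I>)" "\<forall>I\<in>\<I>. P UNIV w (phi w ` L) I" by (elim exE conjE) (rule that; assumption)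
    then show "\<exists>\<I>. finite \<I> \<and> disjoint \<I> \<and> 1 / K * Psi UNIV w \<delta> \<le> real (card \<I>) \<and> (\<forall>I\<in>\<I>. P UNIV w (phi w ` L) I)"
      using x(2) by (intro exI[of _ \<I>]) auto
  qed
qed

abbreviation dimension :: real where "dimension \<equiv> \<Sum>k\<in>UNIV. \<beta> k"

lemma Psi_UNIV_Nil: "0 < \<delta> \<Longrightarrow> Psi UNIV [] \<delta> = \<delta> powr (- dimension)"
  by (simp add: Psi_eq weight_def)

section \<open>The box dimension\<close>

text \<open>
  The pieces are balls of radius \<open>c * \<delta>\<close> around points of \<open>Y\<close>. When a coordinate is dropped,
  the guard word moves the centre away from the faces of the box, whose shortest side is then
  comparable to \<open>\<delta>\<close>, so the ball fits into the box. The centres of disjoint balls form the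
  packing.
\<close>

lemma packing:
  "\<exists>c>0. \<exists>\<kappa>>0. \<forall>\<delta>. 0 < \<delta> \<and> \<delta> \<le> 1 \<longrightarrow> (\<exists>P\<subseteq>L. finite P \<and> \<kappa> * \<delta> powr (- dimension) \<le> real (card P) \<and>
    (\<forall>x\<in>P. \<forall>y\<in>P. x \<noteq> y \<longrightarrow> c * \<delta> \<le> dist x y))"
proof -
  obtain v \<gamma> where v: "v \<in> lists D" "0 < \<gamma>" "\<And>k. \<gamma> \<le> tau v k" "\<And>k. tau v k + rho v k \<le> 1 - \<gamma>"
    using interior_word by metis
  obtain M \<kappa> where M: "1 \<le> M" and \<kappa>: "0 < \<kappa>" and pieces: "\<forall>\<delta>>0. \<forall>P. piece_rules (\<lambda>_. v) M \<delta> P \<longrightarrow> (\<forall>w\<in>lists D. (\<forall>k. \<delta> \<le> rho w k) \<longrightarrow>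
    (\<exists>\<I>. finite \<I> \<and> disjoint \<I> \<and> \<kappa> * Psi UNIV w \<delta> \<le> real (card \<I>) \<and> (\<forall>I\<in>\<I>. P UNIV w (phi w ` L) I)))"
    using disjoint_pieces[of "\<lambda>_. v", OF v(1)] by (elim exE conjE) (rule that; assumption)
  define c where "c = \<gamma> / M"
  have c: "0 < c" using v M by (simp add: c_def)
  show ?thesis
  proof (rule exI[of _ c], rule conjI, rule c, rule exI[of _ \<kappa>], rule conjI, rule \<kappa>, intro allI impI, elim conjE)
    fix \<delta> :: real assume \<delta>: "0 < \<delta>" "\<delta> \<le> 1"
    have c\<delta>: "0 < c * \<delta>" using c \<delta> by simp
    define P where "P S w Y I \<longleftrightarrow> I \<subseteq> open_box S w \<and> (\<exists>p\<in>Y. I = ball p (c * \<delta>))" for S w Y I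
    have "piece_rules (\<lambda>_. v) M \<delta> P"
      unfolding piece_rules_def
    proof (intro conjI allI ballI impI)
      fix S w Y I assume "P S w Y I"
      then show "I \<noteq> {}" "I \<subseteq> open_box S w" using c\<delta> by (auto simp: P_def)
    next
      fix S w Y I a assume "a \<in> D" "w \<in> lists D" "P S (w @ [a]) (part S Y (w @ [a])) I"
      then show "P S w Y I" using open_box_append part_subset unfolding P_def by blast
    next
      fix b :: 'n and A w Y I
      let ?S = "insert b A"
      assume a: "\<forall>a\<in>A. a < b" "w \<in> lists D" "\<delta> \<le> M * rho w b" "shadow ?S w Y" "P A (w @ v) (part ?S Y (w @ v)) I"
      obtain p where p: "p \<in> part ?S Y (w @ v)" "I = ball p (c * \<delta>)" using a(5) by (auto simp: P_def)
      have "x \<in> open_box ?S w" if x: "x \<in> I" for x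
        unfolding open_box_def mem_Collect_eq
      proof
        fix k assume k: "k \<in> ?S"
        have wv: "w @ v \<in> lists D" using a v by simp
        have "tau (w @ v) k \<le> p $ k" "p $ k \<le> tau (w @ v) k + rho (w @ v) k"
          using shadow_nth[OF shadow_part[OF a(4) v(1)] p(1) k wv] .
        moreover have "rho w k * \<gamma> \<le> rho w k * tau v k" "rho w k * (tau v k + rho v k) \<le> rho w k * (1 - \<gamma>)"
          using rho_pos[OF a(2), of k] v by auto
        moreover have "c * \<delta> \<le> rho w k * \<gamma>"
        proof -
          have "k \<le> b" using k a(1) by auto
          then have "\<delta> \<le> M * rho w k" using a(3) rho_antimono[OF a(2), of k b] M
            by (meson mult_left_mono order_trans zero_le_one)
          then have "\<gamma> * \<delta> \<le> \<gamma> * (M * rho w k)" using v by simp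
          then show ?thesis using M by (simp add: c_def field_simps)
        qed
        moreover have "\<bar>p $ k - x $ k\<bar> < c * \<delta>" using x p(2) coord_le_dist[of p k x] by simp
        ultimately show "tau w k < x $ k \<and> x $ k < tau w k + rho w k" by (simp add: tau_append algebra_simps abs_less_iff)
      qed
      then have "P ?S w Y I" using p part_subset unfolding P_def by blast
      then show "\<exists>J\<subseteq>I. P ?S w Y J" by blast
    next
      fix w Y assume "Y \<subseteq> L" "Y \<noteq> {}"
      then obtain y where "y \<in> Y" by blast
      then show "\<exists>I. P {} w Y I" by (intro exI[of _ "ball y (c * \<delta>)"]) (auto simp: P_def open_box_def)
    qed
    from pieces[rule_format, OF \<delta>(1) this lists.Nil] \<delta>(2) obtain \<I> where \<I>: "finite \<I>" "disjoint \<I>"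
      "\<kappa> * Psi UNIV [] \<delta> \<le> real (card \<I>)" "\<And>I. I \<in> \<I> \<Longrightarrow> P UNIV [] (phi [] ` L) I" by auto
    then obtain f where f: "\<And>I. I \<in> \<I> \<Longrightarrow> f I \<in> L" "\<And>I. I \<in> \<I> \<Longrightarrow> I = ball (f I) (c * \<delta>)"
      unfolding P_def by (auto simp: image_def) metis
    have sep: "c * \<delta> \<le> dist (f I) (f J)" if IJ: "I \<in> \<I>" "J \<in> \<I>" "I \<noteq> J" for I J
    proof (rule ccontr)
      assume "\<not> ?thesis"
      then have "f I \<in> ball (f J) (c * \<delta>)" by (simp add: dist_commute)
      moreover have "f I \<in> ball (f I) (c * \<delta>)" using c\<delta> by simp
      ultimately show False using \<I>(2) IJ f(2)[OF IJ(1)] f(2)[OF IJ(2)] unfolding disjoint_def by blast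
    qed
    have "inj_on f \<I>" using f(2) by (metis inj_onI)
    then have "card (f ` \<I>) = card \<I>" by (rule card_image)
    then show "\<exists>P\<subseteq>L. finite P \<and> \<kappa> * \<delta> powr (- dimension) \<le> real (card P) \<and>
        (\<forall>x\<in>P. \<forall>y\<in>P. x \<noteq> y \<longrightarrow> c * \<delta> \<le> dist x y)"
      using \<I>(1,3) f(1) sep Psi_UNIV_Nil[OF \<delta>(1)] by (intro exI[of _ "f ` \<I>"]) auto
  qed
qed

lemma covering_number_L_bounds:
  obtains c C \<epsilon> where "0 < c" "0 < C" "0 < \<epsilon>"
    "\<And>\<delta>. 0 < \<delta> \<Longrightarrow> \<delta> < \<epsilon> \<Longrightarrow> c * \<delta> powr (- dimension) \<le> real (covering_number L \<delta>) \<and>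
      real (covering_number L \<delta>) \<le> C * \<delta> powr (- dimension)"
proof -
  obtain e \<kappa> where e: "0 < e" "0 < \<kappa>" and pack: "\<forall>\<delta>. 0 < \<delta> \<and> \<delta> \<le> 1 \<longrightarrow> (\<exists>P\<subseteq>L. finite P \<and> \<kappa> * \<delta> powr (- dimension) \<le> real (card P) \<and>
    (\<forall>x\<in>P. \<forall>y\<in>P. x \<noteq> y \<longrightarrow> e * \<delta> \<le> dist x y))"
    using packing by (elim exE conjE) (rule that; assumption)
  obtain C where C: "1 \<le> C" "\<And>\<delta>. 0 < \<delta> \<Longrightarrow> bounded_size (lists D) C UNIV 1 \<delta> L (\<lambda>Y. real (covering_number Y (real CARD('n) * \<delta>)))"
    using covering_number_upper[of UNIV 1] bounded_L by auto
  let ?d = "real CARD('n)"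
  have d: "0 < ?d" by simp
  define \<epsilon> where "\<epsilon> = min (e / 3) 1"
  show thesis
  proof (rule that[of "\<kappa> * (3 / e) powr (- dimension)" "C * (1 / ?d) powr (- dimension)" \<epsilon>])
    show "0 < \<kappa> * (3 / e) powr (- dimension)" "0 < C * (1 / ?d) powr (- dimension)" "0 < \<epsilon>"
      using e C by (auto simp: \<epsilon>_def)
    fix \<delta> :: real assume \<delta>: "0 < \<delta>" "\<delta> < \<epsilon>"
    \<comment> \<open>at scale \<open>3 / e * \<delta>\<close> the packing is \<open>3 * \<delta>\<close>-separated, so a ball of radius \<open>\<delta>\<close> holds at most one of its points\<close>
    have \<delta>': "0 < 3 / e * \<delta>" "3 / e * \<delta> \<le> 1" using \<delta> e by (auto simp: \<epsilon>_def field_simps)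
    obtain P where P: "P \<subseteq> L" "finite P" "\<kappa> * (3 / e * \<delta>) powr (- dimension) \<le> real (card P)"
      "\<forall>x\<in>P. \<forall>y\<in>P. x \<noteq> y \<longrightarrow> e * (3 / e * \<delta>) \<le> dist x y"
      using pack[rule_format, OF conjI[OF \<delta>']] by blast
    have "card P \<le> covering_number L \<delta>"
    proof (rule covering_number_ge_separated[OF bounded_L \<delta>(1) P(1,2)])
      fix x y assume "x \<in> P" "y \<in> P" "x \<noteq> y"
      then have "e * (3 / e * \<delta>) \<le> dist x y" using P(4) by blast
      then show "2 * \<delta> < dist x y" using e \<delta> by simp
    qed
    then have "\<kappa> * (3 / e * \<delta>) powr (- dimension) \<le> real (covering_number L \<delta>)" using P(3) by linarith
    then have 1: "\<kappa> * (3 / e) powr (- dimension) * \<delta> powr (- dimension) \<le> real (covering_number L \<delta>)"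
      using e \<delta> by (subst (asm) powr_mult) (auto simp: mult_ac)
    have dd: "0 < \<delta> / ?d" "\<delta> / ?d \<le> 1"
    proof -
      show "0 < \<delta> / ?d" using \<delta> d by simp
      have "\<delta> \<le> 1" "1 \<le> ?d" using \<delta> by (auto simp: \<epsilon>_def Suc_le_eq)
      then show "\<delta> / ?d \<le> 1" by (subst divide_le_eq_1_pos) linarith+
    qed
    have "shadow UNIV [] L" by (simp add: shadow_def image_def)
    then have "real (covering_number L (?d * (\<delta> / ?d))) \<le> C * Psi UNIV [] (\<delta> / ?d)"
    proof -
      have "flat UNIV (\<delta> / ?d) L" "\<forall>k\<in>UNIV. \<delta> / ?d \<le> 1 * rho [] k"
        using dd by (auto simp: flat_def)
      with \<open>shadow UNIV [] L\<close> show ?thesis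
        using C(2)[OF dd(1)] unfolding bounded_size_def by (meson lists.Nil order_refl)
    qed
    then have "real (covering_number L \<delta>) \<le> C * (1 / ?d * \<delta>) powr (- dimension)"
      unfolding Psi_UNIV_Nil[OF dd(1)] by simp
    then have 2: "real (covering_number L \<delta>) \<le> C * (1 / ?d) powr (- dimension) * \<delta> powr (- dimension)"
      using \<delta> by (subst (asm) powr_mult) (auto simp: mult_ac)
    from 1 2 show "\<kappa> * (3 / e) powr (- dimension) * \<delta> powr (- dimension) \<le> real (covering_number L \<delta>) \<and>
      real (covering_number L \<delta>) \<le> C * (1 / ?d) powr (- dimension) * \<delta> powr (- dimension)" by blast
  qed
qed

lemma box_dim_L: "box_dim L = dimension"
proof -
  obtain c C \<epsilon> where c: "0 < c" "0 < C" "0 < \<epsilon>"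
    and b: "\<And>\<delta>. 0 < \<delta> \<Longrightarrow> \<delta> < \<epsilon> \<Longrightarrow> c * \<delta> powr (- dimension) \<le> real (covering_number L \<delta>) \<and>
      real (covering_number L \<delta>) \<le> C * \<delta> powr (- dimension)"
    by (rule covering_number_L_bounds) blast
  let ?f = "\<lambda>\<delta>. ln (real (covering_number L \<delta>)) / ln (1 / \<delta>)"
  have lim: "((\<lambda>\<delta>. ln k / ln (1 / \<delta>) + dimension) \<longlongrightarrow> dimension) (at_right 0)" for k
  proof -
    have "filterlim (\<lambda>\<delta>::real. ln (1 / \<delta>)) at_top (at_right 0)" by real_asymp
    then have "((\<lambda>\<delta>. ln k / ln (1 / \<delta>)) \<longlongrightarrow> 0) (at_right 0)"
      by (intro tendsto_divide_0[OF tendsto_const]) (rule filterlim_at_top_imp_at_infinity)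
    then show ?thesis using tendsto_add[OF _ tendsto_const, of _ 0 _ dimension] by force
  qed
  have ev: "eventually (\<lambda>\<delta>. 0 < \<delta> \<and> \<delta> < min \<epsilon> 1) (at_right 0)"
    unfolding eventually_at_right_field using c by (intro exI[of _ "min \<epsilon> 1"]) auto
  have both: "ln c / ln (1 / \<delta>) + dimension \<le> ?f \<delta> \<and> ?f \<delta> \<le> ln C / ln (1 / \<delta>) + dimension"
    if \<delta>: "0 < \<delta> \<and> \<delta> < min \<epsilon> 1" for \<delta>
  proof -
    have l: "0 < ln (1 / \<delta>)" using \<delta> by simp
    have p: "0 < \<delta> powr (- dimension)" using \<delta> by simp
    have B: "c * \<delta> powr (- dimension) \<le> real (covering_number L \<delta>)" "real (covering_number L \<delta>) \<le> C * \<delta> powr (- dimension)"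
      using b \<delta> by auto
    have cov: "0 < real (covering_number L \<delta>)" using B(1) c p by (meson less_le_trans mult_pos_pos)
    have e: "ln (k * \<delta> powr (- dimension)) = ln k + dimension * ln (1 / \<delta>)" if "0 < k" for k
      using that p \<delta> by (simp add: ln_mult ln_powr ln_div)
    have "ln c + dimension * ln (1 / \<delta>) \<le> ln (real (covering_number L \<delta>))"
      unfolding e[OF c(1), symmetric] using B(1) c p by (subst ln_le_cancel_iff) (auto intro: cov[unfolded of_nat_0_less_iff])
    moreover have "ln (real (covering_number L \<delta>)) \<le> ln C + dimension * ln (1 / \<delta>)"
      unfolding e[OF c(2), symmetric] using B(2) c p cov by (subst ln_le_cancel_iff) auto
    moreover have "ln k / ln (1 / \<delta>) + dimension = (ln k + dimension * ln (1 / \<delta>)) / ln (1 / \<delta>)" for k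
      using l by (simp only: add_divide_distrib nonzero_mult_div_cancel_right[OF less_imp_neq[OF l, THEN not_sym]])
    ultimately show ?thesis using l by (simp only: divide_right_mono less_imp_le conj_absorb simp_thms)
  qed
  have "(?f \<longlongrightarrow> dimension) (at_right 0)"
    by (rule tendsto_sandwich[OF _ _ lim lim]; rule eventually_mono[OF ev]) (use both in blast)+
  then show ?thesis unfolding box_dim_def by (intro tendsto_Lim) auto
qed

end

lemma compact_closed_gap:
  fixes X Y :: "'a::heine_borel set"
  assumes "compact X" "closed Y" "X \<inter> Y = {}"
  obtains d where "0 < d" "\<And>x y. x \<in> X \<Longrightarrow> y \<in> Y \<Longrightarrow> d \<le> dist x y"
proof (cases "X = {} \<or> Y = {}")
  case True
  then show thesis using that[of 1] by auto
next
  case False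
  then have "0 < setdist X Y" using setdist_gt_0_compact_closed[OF assms(1,2)] assms(3) by blast
  then show thesis using that[of "setdist X Y"] setdist_le_dist by blast
qed

context LG_sponge
begin

section \<open>Islands and trivial points\<close>

text \<open>
  A part of the projected sponge that is separated from the rest of it and from the boundary of
  the cube. Each gap is measured in a single coordinate of \<open>S\<close>, because the maps \<open>phi w\<close> scale
  different coordinates differently.
\<close>

definition island :: "'n set \<Rightarrow> real \<Rightarrow> (real ^ 'n::{finite,linorder}) set \<Rightarrow> bool"
  where "island S \<eta> U \<longleftrightarrow> U \<subseteq> proj S ` L \<and> (\<forall>x\<in>U. \<forall>k\<in>S. \<eta> \<le> x $ k \<and> x $ k \<le> 1 - \<eta>) \<and>
    (\<forall>x\<in>U. \<forall>y\<in>proj S ` L - U. \<exists>k\<in>S. \<eta> \<le> \<bar>x $ k - y $ k\<bar>)"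

lemma compact_proj_L: "compact (proj S ` L)"
  by (intro compact_continuous_image continuous_on_proj compact_L)

lemma island_mono: "island S \<eta> U \<Longrightarrow> \<eta>' \<le> \<eta> \<Longrightarrow> island S \<eta>' U"
  unfolding island_def by (smt (verit))

text \<open>
  Disjoint compact and closed sets have positive distance, and a positive distance shows in
  some coordinate; outside \<open>S\<close> all points of the projection agree.
\<close>

lemma island_of_clopen:
  assumes "openin (top_of_set (proj S ` L)) U" "closedin (top_of_set (proj S ` L)) U"
    and cube: "\<And>x k. x \<in> U \<Longrightarrow> k \<in> S \<Longrightarrow> 0 < x $ k \<and> x $ k < 1"
  obtains \<eta> where "0 < \<eta>" "island S \<eta> U"
proof -
  let ?Q = "proj S ` L"
  have UQ: "U \<subseteq> ?Q" using assms(1) openin_imp_subset by blast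
  have cU: "compact U" using closedin_compact[OF compact_proj_L assms(2)] .
  have "closedin (top_of_set ?Q) (?Q - U)"
    using assms(1) UQ by (simp add: closedin_def double_diff)
  then have "closed (?Q - U)" using closedin_compact[OF compact_proj_L] compact_imp_closed by blast
  then obtain d where d: "0 < d" "\<And>x y. x \<in> U \<Longrightarrow> y \<in> ?Q - U \<Longrightarrow> d \<le> dist x y"
    using compact_closed_gap[OF cU, of "?Q - U"] by blast
  define B where "B = (\<Union>k\<in>S. {x :: real ^ 'n::{finite,linorder}. x $ k \<le> 0} \<union> {x. 1 \<le> x $ k})"
  have "closed B" unfolding B_def
    by (intro closed_UN ballI closed_Un closed_halfspace_component_le_cart closed_halfspace_component_ge_cart) auto
  moreover have "U \<inter> B = {}" using cube unfolding B_def by fastforce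
  ultimately obtain e where e: "0 < e" "\<And>x y. x \<in> U \<Longrightarrow> y \<in> B \<Longrightarrow> e \<le> dist x y"
    using compact_closed_gap[OF cU] by blast
  let ?d = "d / (2 * real CARD('n))"
  show thesis
  proof (rule that)
    show "0 < min e ?d" using d e by simp
    show "island S (min e ?d) U"
      unfolding island_def
    proof (intro conjI ballI)
      fix x k assume x: "x \<in> U" "k \<in> S"
      have *: "e \<le> \<bar>x $ k - s\<bar>" if "s = 0 \<or> s = 1" for s
      proof -
        define y where "y = (\<chi> i. if i = k then s else x $ i)"
        have "y $ k = s" by (simp add: y_def)
        then have "y \<in> {x. x $ k \<le> 0} \<union> {x. 1 \<le> x $ k}" using that by auto
        then have "y \<in> B" using x(2) unfolding B_def by blast
        then have "e \<le> dist x y" using e x by blast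
        also have "\<dots> \<le> (\<Sum>i\<in>UNIV. \<bar>x $ i - y $ i\<bar>)" by (rule dist_le_sum_coord)
        also have "\<dots> = (\<Sum>i\<in>UNIV. if i = k then \<bar>x $ k - s\<bar> else 0)"
          by (rule sum.cong) (auto simp: y_def)
        also have "\<dots> = \<bar>x $ k - s\<bar>" by simp
        finally show ?thesis .
      qed
      show "min e ?d \<le> x $ k" "x $ k \<le> 1 - min e ?d"
        using *[of 0] *[of 1] cube[OF x] by auto
    next
      fix x y assume x: "x \<in> U" "y \<in> ?Q - U"
      show "\<exists>k\<in>S. min e ?d \<le> \<bar>x $ k - y $ k\<bar>"
      proof (rule ccontr)
        assume "\<not> ?thesis"
        then have "\<bar>x $ k - y $ k\<bar> \<le> ?d" if "k \<in> S" for k using that by force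
        moreover have "x $ k = 0 \<and> y $ k = 0" if "k \<notin> S" for k
        proof -
          obtain x' y' where "x = proj S x'" "y = proj S y'" using x UQ by blast
          then show ?thesis using that by (simp add: proj_nth)
        qed
        ultimately have "\<bar>x $ k - y $ k\<bar> \<le> ?d" for k
          using d(1) by (cases "k \<in> S") auto
        then have "dist x y \<le> real CARD('n) * ?d" by (rule dist_le_card_mult)
        also have "\<dots> = d / 2" by simp
        finally show False using d(2)[OF x] d(1) by simp
      qed
    qed (use UQ in auto)
  qed
qed

lemma island_gap:
  assumes "island S \<eta> U" "x \<in> U" "y \<in> proj S ` L - U"
  shows "\<eta> \<le> dist x y"
  using assms coord_le_dist order_trans unfolding island_def by meson

lemma openin_island:
  assumes "island S \<eta> U" "0 < \<eta>"
  shows "openin (top_of_set (proj S ` L)) U" "closedin (top_of_set (proj S ` L)) U"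
proof -
  let ?Q = "proj S ` L"
  have UQ: "U \<subseteq> ?Q" using assms(1) by (simp add: island_def)
  have "ball x \<eta> \<inter> ?Q \<subseteq> U" if "x \<in> U" for x
    using island_gap[OF assms(1) that] by fastforce
  then show "openin (top_of_set ?Q) U"
    using UQ assms(2) unfolding openin_contains_ball by blast
  have "ball y \<eta> \<inter> ?Q \<subseteq> ?Q - U" if "y \<in> ?Q - U" for y
    using island_gap[OF assms(1) _ that] by (fastforce simp: dist_commute)
  then have "openin (top_of_set ?Q) (?Q - U)"
    using assms(2) unfolding openin_contains_ball by blast
  then show "closedin (top_of_set ?Q) U"
    using UQ by (simp add: closedin_def)
qed

text \<open>
  A point \<open>y\<close> of the same cylinder is handled by scaling. A point of another cylinder of the
  same length lies outside the open box of \<open>w\<close>, and the image of \<open>U\<close> keeps its distance from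
  the boundary of this box.
\<close>

lemma island_image_gap:
  assumes S: "down_closed S" and w: "w \<in> lists D" and U: "island S \<eta> U"
    and x: "x \<in> U" and y: "y \<in> proj S ` L" "y \<notin> (\<lambda>x. proj S (phi w x)) ` U"
  shows "\<exists>k\<in>S. \<eta> * rho w k \<le> \<bar>proj S (phi w x) $ k - y $ k\<bar>"
proof -
  obtain y' where y': "y' \<in> L" "y = proj S y'" using y by blast
  obtain u z where u: "u \<in> lists D" "length u = length w" "z \<in> L" "y' = phi u z"
    using L_word[OF y'(1), of "length w"] by blast
  have xk: "\<eta> \<le> x $ k" "x $ k \<le> 1 - \<eta>" if "k \<in> S" for k using U x that by (auto simp: island_def)
  have r: "0 < rho w k" for k using rho_pos[OF w] .
  have px: "proj S (phi w x) $ k = rho w k * x $ k + tau w k" if "k \<in> S" for k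
    using that by (simp add: proj_nth phi_nth)
  show ?thesis
  proof (cases "map (\<lambda>a. restrict a S) u = map (\<lambda>a. restrict a S) w")
    case True
    then have "y = proj S (phi w (proj S z))"
      unfolding y' u proj_phi_proj by (rule proj_phi_restrict)
    then have yk: "y $ k = rho w k * proj S z $ k + tau w k" and zU: "proj S z \<notin> U" if "k \<in> S" for k
      using that y(2) by (auto simp: proj_nth phi_nth)
    have "proj S z \<notin> U" using \<open>y = proj S (phi w (proj S z))\<close> y(2) by blast
    then have "proj S z \<in> proj S ` L - U" using u by blast
    then obtain k where k: "k \<in> S" "\<eta> \<le> \<bar>x $ k - proj S z $ k\<bar>" using U x unfolding island_def by blast
    have "\<eta> * rho w k \<le> \<bar>x $ k - proj S z $ k\<bar> * rho w k" using k r[of k] by (simp add: mult_right_mono less_imp_le)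
    also have "\<dots> = \<bar>proj S (phi w x) $ k - y $ k\<bar>"
      using px[OF k(1)] yk[OF k(1)] r[of k] by (simp add: abs_mult_pos' algebra_simps flip: right_diff_distrib abs_mult_pos)
    finally show ?thesis using k by blast
  next
    case False
    then obtain k where k: "k \<in> S" "tau u k + rho u k \<le> tau w k \<or> tau w k + rho w k \<le> tau u k"
      using neat_words[OF S u(1) w u(2)] by blast
    have yk: "y $ k = rho u k * z $ k + tau u k" using k by (simp add: y' u proj_nth phi_nth)
    have "0 \<le> rho u k * z $ k" "rho u k * z $ k \<le> rho u k * 1"
      using rho_pos[OF u(1), of k] L_cube[OF u(3), of k] by auto
    moreover have "rho w k * \<eta> \<le> rho w k * x $ k" "rho w k * x $ k \<le> rho w k * (1 - \<eta>)"
      using r[of k] xk[OF k(1)] by auto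
    ultimately have "\<eta> * rho w k \<le> \<bar>proj S (phi w x) $ k - y $ k\<bar>"
      using k(2) unfolding px[OF k(1)] yk by (simp add: algebra_simps) linarith
    then show ?thesis using k by blast
  qed
qed

lemma island_image:
  assumes S: "down_closed S" and w: "w \<in> lists D" and U: "island S \<eta> U" and \<eta>: "0 < \<eta>"
  shows "island S (\<eta> * q ^ length w) ((\<lambda>x. proj S (phi w x)) ` U)"
  unfolding island_def
proof (intro conjI ballI)
  have q: "\<eta> * q ^ length w \<le> \<eta> * rho w k" for k using rho_lower[OF w] \<eta> by simp
  show "(\<lambda>x. proj S (phi w x)) ` U \<subseteq> proj S ` L"
  proof
    fix y assume "y \<in> (\<lambda>x. proj S (phi w x)) ` U"
    then obtain z where "z \<in> L" "y = proj S (phi w (proj S z))" using U unfolding island_def by blast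
    then show "y \<in> proj S ` L" using phi_L[OF w] by (simp add: proj_phi_proj)
  qed
  fix y k assume y: "y \<in> (\<lambda>x. proj S (phi w x)) ` U" "k \<in> S"
  then obtain x where x: "x \<in> U" "y = proj S (phi w x)" by blast
  then have xk: "\<eta> \<le> x $ k" "x $ k \<le> 1 - \<eta>" using U y(2) by (auto simp: island_def)
  have yk: "y $ k = rho w k * x $ k + tau w k" using x y by (simp add: proj_nth phi_nth)
  have "rho w k * \<eta> \<le> rho w k * x $ k" "rho w k * x $ k \<le> rho w k * (1 - \<eta>)"
    using rho_pos[OF w, of k] xk by auto
  then show "\<eta> * q ^ length w \<le> y $ k" "y $ k \<le> 1 - \<eta> * q ^ length w"
    unfolding yk using q[of k] tau_nonneg[OF w, of k] tau_rho_le_1[OF w, of k] by (simp_all add: algebra_simps)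
next
  fix x y assume "x \<in> (\<lambda>x. proj S (phi w x)) ` U" "y \<in> proj S ` L - (\<lambda>x. proj S (phi w x)) ` U"
  then show "\<exists>k\<in>S. \<eta> * q ^ length w \<le> \<bar>x $ k - y $ k\<bar>"
    using island_image_gap[OF S w U] rho_lower[OF w] \<eta> by (smt (verit) DiffD1 DiffD2 imageE mult_left_mono)
qed

lemma small_cylinder:
  assumes "0 < \<epsilon>" "x \<in> proj S ` L"
  obtains w where "w \<in> lists D" "w \<noteq> []" "x \<in> proj S ` phi w ` L"
    "\<And>y k. y \<in> proj S ` phi w ` L \<Longrightarrow> \<bar>x $ k - y $ k\<bar> < \<epsilon>"
proof -
  obtain m where m: "(1 - q) ^ m < \<epsilon>" using real_arch_pow_inv[of \<epsilon> "1 - q"] assms(1) q_bounds by auto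
  have m': "(1 - q) ^ Suc m < \<epsilon>"
    using m q_bounds by (smt (verit) mult_left_le_one_le power_Suc zero_less_power)
  obtain x' where x': "x' \<in> L" "x = proj S x'" using assms by blast
  obtain w where w: "w \<in> lists D" "length w = Suc m" "x' \<in> phi w ` L" using L_word[OF x'(1), of "Suc m"] by blast
  show thesis
  proof (rule that)
    fix y k assume "y \<in> proj S ` phi w ` L"
    then obtain z z' where z: "z \<in> L" "y = proj S (phi w z)" "z' \<in> L" "x = proj S (phi w z')" using w x' by blast
    have e: "x $ k - y $ k = (if k \<in> S then rho w k * (z' $ k - z $ k) else 0)"
      by (simp add: z proj_nth phi_nth algebra_simps)
    have "\<bar>z' $ k - z $ k\<bar> \<le> 1" using L_cube[OF z(1), of k] L_cube[OF z(3), of k] by auto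
    then have "rho w k * \<bar>z' $ k - z $ k\<bar> \<le> rho w k * 1" using rho_pos[OF w(1), of k] by (intro mult_left_mono) auto
    then have "\<bar>x $ k - y $ k\<bar> \<le> rho w k" using rho_pos[OF w(1), of k] by (simp add: e abs_mult)
    then show "\<bar>x $ k - y $ k\<bar> < \<epsilon>" using rho_upper[OF w(1), of k] w(2) m' by simp
  qed (use w x' in auto)
qed

lemma cylinder_in_island:
  assumes "island S \<eta> U" "0 < \<eta>" "U \<noteq> {}"
  obtains v where "v \<in> lists D" "v \<noteq> []" "proj S ` phi v ` L \<subseteq> U"
proof -
  obtain x where x: "x \<in> U" "x \<in> proj S ` L" using assms unfolding island_def by blast
  obtain v where v: "v \<in> lists D" "v \<noteq> []" "\<And>y k. y \<in> proj S ` phi v ` L \<Longrightarrow> \<bar>x $ k - y $ k\<bar> < \<eta>"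
    using small_cylinder[OF assms(2) x(2)] by metis
  have "y \<in> U" if "y \<in> proj S ` phi v ` L" for y
  proof (rule ccontr)
    assume "y \<notin> U"
    moreover have "y \<in> proj S ` L" using that phi_L[OF v(1)] by blast
    ultimately obtain k where "\<eta> \<le> \<bar>x $ k - y $ k\<bar>" using assms(1) x(1) unfolding island_def by blast
    then show False using v(3)[OF that, of k] by simp
  qed
  then show thesis by (intro that[OF v(1,2)] subsetI)
qed

text \<open>
  The island contains a cylinder \<open>v\<close>, so the images of \<open>U\<close> under the iterates of \<open>v\<close> are
  nested. They are clopen and shrink to a point, which is therefore a component.
\<close>

lemma trivial_point_in_island:
  assumes S: "down_closed S" and U: "island S \<eta> U" "0 < \<eta>" "U \<noteq> {}"
  obtains x where "x \<in> U" "x \<in> trivial_points (proj S ` L)"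
proof -
  let ?Q = "proj S ` L"
  obtain v where v: "v \<in> lists D" "v \<noteq> []" "proj S ` phi v ` L \<subseteq> U" by (rule cylinder_in_island[OF U])
  define W where "W m = concat (replicate m v)" for m
  define U' where "U' m = (\<lambda>x. proj S (phi (W m) x)) ` U" for m
  have WD: "W m \<in> lists D" for m unfolding W_def using v(1) by (induction m) auto
  have W_Suc: "W (Suc m) = W m @ v" for m
    unfolding W_def by (induction m) auto
  have UQ: "U \<subseteq> ?Q" using U(1) by (simp add: island_def)
  have vU: "proj S (phi v x) \<in> U" if x: "x \<in> U" for x
  proof -
    obtain z where "z \<in> L" "x = proj S z" using UQ x by blast
    then have "proj S (phi v x) = proj S (phi v z)" by (simp add: proj_phi_proj)
    then show ?thesis using v(3) \<open>z \<in> L\<close> by blast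
  qed
  have isl: "island S (\<eta> * q ^ length (W m)) (U' m)" "0 < \<eta> * q ^ length (W m)" for m
    unfolding U'_def using island_image[OF S WD U(1,2)] U(2) q_bounds by auto
  have dec: "U' (Suc m) \<subseteq> U' m" for m
  proof
    fix y assume "y \<in> U' (Suc m)"
    then obtain x where x: "x \<in> U" "y = proj S (phi (W m) (phi v x))" by (auto simp: U'_def W_Suc phi_append)
    then have "y = proj S (phi (W m) (proj S (phi v x)))" by (simp add: proj_phi_proj)
    then show "y \<in> U' m" unfolding U'_def using vU[OF x(1)] by blast
  qed
  have "\<Inter> (range U') \<noteq> {}"
  proof (rule compact_nest)
    show "compact (U' m)" for m
      using openin_island(2)[OF isl] closedin_compact[OF compact_proj_L] by blast
    show "U' m \<noteq> {}" for m using U by (simp add: U'_def)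
    show "m \<le> k \<Longrightarrow> U' k \<subseteq> U' m" for m k using dec by (rule lift_Suc_antimono_le)
  qed
  then obtain x where x: "\<And>m. x \<in> U' m" by blast
  have "U' 0 = (\<lambda>x. proj S x) ` U" by (simp add: U'_def W_def)
  also have "\<dots> \<subseteq> U" using UQ proj_proj_subset[of S S] by auto
  finally have xU: "x \<in> U" using x[of 0] by blast
  have "C = {x}" if C: "C \<subseteq> ?Q" "connected C" "x \<in> C" for C
  proof -
    have sub: "C \<subseteq> U' m" for m
    proof -
      obtain G where G: "open G" "U' m = ?Q \<inter> G" using openin_island(1)[OF isl] unfolding openin_open by blast
      obtain H where H: "closed H" "U' m = ?Q \<inter> H" using openin_island(2)[OF isl] unfolding closedin_closed by blast
      have "C \<inter> U' m = C \<inter> G" "C \<inter> U' m = C \<inter> H" using G H C(1) by blast+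
      then have "openin (top_of_set C) (C \<inter> U' m)" "closedin (top_of_set C) (C \<inter> U' m)"
        using G(1) H(1) unfolding openin_open closedin_closed by blast+
      then have "C \<inter> U' m = C" using C(2,3) x[of m] unfolding connected_clopen by blast
      then show ?thesis by blast
    qed
    have "y = x" if y: "y \<in> C" for y
    proof (rule ccontr)
      assume "y \<noteq> x"
      then obtain k where k: "y $ k \<noteq> x $ k" by (auto simp: vec_eq_iff)
      obtain m where m: "(1 - q) ^ m < \<bar>x $ k - y $ k\<bar>"
        using real_arch_pow_inv[of "\<bar>x $ k - y $ k\<bar>" "1 - q"] k q_bounds by auto
      obtain a b where ab: "a \<in> U" "b \<in> U" "x = proj S (phi (W m) a)" "y = proj S (phi (W m) b)"
        using x[of m] sub[of m] y unfolding U'_def by blast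
      have cube: "0 \<le> c $ k \<and> c $ k \<le> 1" if "c \<in> U" for c
        using UQ that L_cube by (auto simp: proj_nth)
      have e: "x $ k - y $ k = (if k \<in> S then rho (W m) k * (a $ k - b $ k) else 0)"
        by (simp add: ab proj_nth phi_nth algebra_simps)
      have "rho (W m) k * \<bar>a $ k - b $ k\<bar> \<le> rho (W m) k * 1"
        using rho_pos[OF WD, of m k] cube[OF ab(1)] cube[OF ab(2)] by (intro mult_left_mono) auto
      then have "\<bar>x $ k - y $ k\<bar> \<le> rho (W m) k" using rho_pos[OF WD, of m k] by (simp add: e abs_mult)
      also have "\<dots> \<le> (1 - q) ^ length (W m)" by (rule rho_upper[OF WD])
      also have "\<dots> \<le> (1 - q) ^ m"
      proof (rule power_decreasing)
        have "length (W m) = m * length v" unfolding W_def by (induction m) auto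
        then show "m \<le> length (W m)" using v(2) by (simp add: Suc_le_eq)
      qed (use q_bounds in auto)
      finally show False using m by simp
    qed
    then show ?thesis using C(3) by blast
  qed
  then have *: "C = {x}" if "{x} \<subseteq> C" "C \<subseteq> ?Q" "connected C" for C using that by simp
  have "{x} \<in> components ?Q"
    unfolding in_components_maximal
  proof (intro conjI allI impI)
    show "{x} \<subseteq> ?Q" using xU UQ by blast
  qed (use * in auto)
  then have "x \<in> trivial_points ?Q" using xU UQ unfolding trivial_points_def by blast
  then show thesis by (rule that[OF xU])
qed

text \<open>
  By the Sura-Bura theorem a trivial point in the open cube has a clopen neighbourhood in the
  open cube.
\<close>

lemma trivial_point_iff_island:
  "open_cube j \<inter> trivial_points (proj {..j} ` L) \<noteq> {} \<longleftrightarrow> (\<exists>\<eta> U. 0 < \<eta> \<and> U \<noteq> {} \<and> island {..j} \<eta> U)"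
proof
  let ?Q = "proj {..j} ` L"
  assume "open_cube j \<inter> trivial_points ?Q \<noteq> {}"
  then obtain x where x: "x \<in> open_cube j" "x \<in> ?Q" "{x} \<in> components ?Q" by (auto simp: trivial_points_def)
  define G where "G = (\<Inter>k\<in>{..j}. {x :: real ^ 'n::{finite,linorder}. 0 < x $ k} \<inter> {x. x $ k < 1})"
  have "open G" unfolding G_def by (intro open_INT ballI open_Int open_halfspace_component_lt_cart open_halfspace_component_gt_cart) auto
  moreover have "{x} \<subseteq> G" using x(1) by (auto simp: G_def open_cube_def)
  moreover have "locally compact ?Q" by (simp add: closed_imp_locally_compact compact_imp_closed compact_proj_L)
  ultimately obtain U where U: "openin (top_of_set ?Q) U" "compact U" "{x} \<subseteq> U" "U \<subseteq> G"
    using Sura_Bura_clopen_subset[of ?Q "{x}" G] x(3) by auto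
  have "closedin (top_of_set ?Q) U"
    using U(1,2) by (meson closed_subset compact_imp_closed openin_imp_subset)
  then obtain \<eta> where "0 < \<eta>" "island {..j} \<eta> U"
    using island_of_clopen[OF U(1)] U(4) unfolding G_def by blast
  then show "\<exists>\<eta> U. 0 < \<eta> \<and> U \<noteq> {} \<and> island {..j} \<eta> U" using U(3) by blast
next
  assume "\<exists>\<eta> U. 0 < \<eta> \<and> U \<noteq> {} \<and> island {..j} \<eta> U"
  then obtain \<eta> U where U: "0 < \<eta>" "U \<noteq> {}" "island {..j} \<eta> U" by blast
  obtain x where x: "x \<in> U" "x \<in> trivial_points (proj {..j} ` L)"
    by (rule trivial_point_in_island[OF down_closed_atMost U(3,1,2)])
  have "x \<in> proj {..j} ` L" using U(3) x by (auto simp: island_def)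
  then have "\<forall>i>j. x $ i = 0" by (auto simp: proj_nth)
  moreover have "0 < x $ k \<and> x $ k < 1" if "k \<le> j" for k
  proof -
    have "\<eta> \<le> x $ k" "x $ k \<le> 1 - \<eta>" using U(3) x(1) that by (auto simp: island_def)
    then show ?thesis using U(1) by linarith
  qed
  ultimately have "x \<in> open_cube j" by (simp add: open_cube_def)
  then show "open_cube j \<inter> trivial_points (proj {..j} ` L) \<noteq> {}" using x by blast
qed

text \<open>
  If there is an island, its copies occur in arbitrarily small cylinders and contain trivial
  points. Conversely, a dense set meets the open cube, because the projection of \<open>L\<close> does.
\<close>

lemma trivial_points_dense_iff:
  "proj {..j} ` L \<subseteq> closure (trivial_points (proj {..j} ` L)) \<longleftrightarrow> open_cube j \<inter> trivial_points (proj {..j} ` L) \<noteq> {}"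
proof
  let ?Q = "proj {..j} ` L"
  assume dense: "?Q \<subseteq> closure (trivial_points ?Q)"
  obtain v \<gamma> where v: "v \<in> lists D" "0 < \<gamma>" "\<And>k. \<gamma> \<le> tau v k" "\<And>k. tau v k + rho v k \<le> 1 - \<gamma>"
    using interior_word by metis
  obtain z where z: "z \<in> L" using L_nonempty by blast
  define x where "x = proj {..j} (phi v z)"
  have xk: "\<gamma> \<le> x $ k \<and> x $ k \<le> 1 - \<gamma>" if "k \<le> j" for k
  proof -
    have "0 \<le> rho v k * z $ k" "rho v k * z $ k \<le> rho v k * 1"
      using rho_pos[OF v(1), of k] L_cube[OF z, of k] by auto
    then show ?thesis using v(3,4)[of k] that by (simp add: x_def proj_nth phi_nth)
  qed
  have "x \<in> ?Q" using z phi_L[OF v(1)] by (auto simp: x_def)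
  then obtain y where y: "y \<in> trivial_points ?Q" "dist y x < \<gamma>"
    using dense v(2) by (meson closure_approachable subsetD)
  have "0 < y $ k \<and> y $ k < 1" if "k \<le> j" for k
    using xk[OF that] coord_le_dist[of y k x] y(2) by linarith
  moreover have "\<forall>i>j. y $ i = 0" using y(1) by (auto simp: trivial_points_def proj_nth)
  ultimately show "open_cube j \<inter> trivial_points ?Q \<noteq> {}" using y(1) by (auto simp: open_cube_def)
next
  let ?Q = "proj {..j} ` L"
  assume "open_cube j \<inter> trivial_points ?Q \<noteq> {}"
  then obtain \<eta> U where U: "0 < \<eta>" "U \<noteq> {}" "island {..j} \<eta> U"
    using trivial_point_iff_island by blast
  show "?Q \<subseteq> closure (trivial_points ?Q)"
  proof (intro subsetI, unfold closure_approachable, intro allI impI)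
    fix y and e :: real assume y: "y \<in> ?Q" and e: "0 < e"
    define \<epsilon> where "\<epsilon> = e / (2 * real CARD('n))"
    have \<epsilon>: "0 < \<epsilon>" using e by (simp add: \<epsilon>_def)
    obtain w where w: "w \<in> lists D" "\<And>x k. x \<in> proj {..j} ` phi w ` L \<Longrightarrow> \<bar>y $ k - x $ k\<bar> < \<epsilon>"
      using small_cylinder[OF \<epsilon> y] by metis
    let ?U = "(\<lambda>x. proj {..j} (phi w x)) ` U"
    have "island {..j} (\<eta> * q ^ length w) ?U" by (rule island_image[OF down_closed_atMost w(1) U(3,1)])
    then obtain x where x: "x \<in> ?U" "x \<in> trivial_points ?Q"
      by (rule trivial_point_in_island[OF down_closed_atMost]) (use U q_bounds in auto)
    obtain u where u: "u \<in> U" "x = proj {..j} (phi w u)" using x by blast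
    then obtain z where "z \<in> L" "u = proj {..j} z" using U(3) unfolding island_def by blast
    then have "x \<in> proj {..j} ` phi w ` L" using u by (simp add: proj_phi_proj)
    then have "dist y x \<le> real CARD('n) * \<epsilon>" by (intro dist_le_card_mult less_imp_le w(2))
    also have "\<dots> < e" using e by (simp add: \<epsilon>_def)
    finally show "\<exists>x\<in>trivial_points ?Q. dist x y < e" using x by (auto simp: dist_commute)
  qed
qed

section \<open>Lower bounds by counting islands\<close>

definition has_islands :: bool
  where "has_islands \<longleftrightarrow> (\<forall>j. \<exists>\<eta> U. 0 < \<eta> \<and> U \<noteq> {} \<and> island {..j} \<eta> U)"

lemma uniform_islands:
  assumes has_islands
  obtains \<eta> U v where "0 < \<eta>" "\<And>S. v S \<in> lists D"
    "\<And>S. down_closed S \<Longrightarrow> S \<noteq> {} \<Longrightarrow> island S \<eta> (U S) \<and> proj S ` phi (v S) ` L \<subseteq> U S"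
proof -
  have "\<forall>j. \<exists>\<eta> U v. 0 < \<eta> \<and> island {..j} \<eta> U \<and> v \<in> lists D \<and> proj {..j} ` phi v ` L \<subseteq> U"
  proof
    fix j
    obtain \<eta> U where U: "0 < \<eta>" "U \<noteq> {}" "island {..j} \<eta> U" using assms unfolding has_islands_def by blast
    obtain v where "v \<in> lists D" "proj {..j} ` phi v ` L \<subseteq> U" 
      by (rule cylinder_in_island[OF U(3,1,2)]) (rule that; assumption)
    then show "\<exists>\<eta> U v. 0 < \<eta> \<and> island {..j} \<eta> U \<and> v \<in> lists D \<and> proj {..j} ` phi v ` L \<subseteq> U" using U by blast
  qed
  then obtain e U v where e: "\<And>j. 0 < e j" "\<And>j. island {..j} (e j) (U j)" "\<And>j. v j \<in> lists D"
      "\<And>j. proj {..j} ` phi (v j) ` L \<subseteq> U j" by metis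
  define \<eta> where "\<eta> = Min (range e)"
  have "\<eta> \<in> range e" unfolding \<eta>_def by (rule Min_in) auto
  then have \<eta>: "0 < \<eta>" using e(1) by auto
  have isl: "island {..j} \<eta> (U j)" for j
    by (rule island_mono[OF e(2)]) (auto simp: \<eta>_def)
  have mx: "Max {..j} = j" for j :: 'n by (rule Max_eqI) auto
  have "island S \<eta> (U (Max S)) \<and> proj S ` phi (v (Max S)) ` L \<subseteq> U (Max S)"
    if "down_closed S" "S \<noteq> {}" for S
  proof -
    obtain j where "S = {..j}" using \<open>S \<noteq> {}\<close> down_closed_cases[OF \<open>down_closed S\<close>] by metis
    then show ?thesis using isl[of j] e(4)[of j] by (simp add: mx)
  qed
  with \<eta> e(3) show thesis using that[of \<eta> "\<lambda>S. v (Max S)" "\<lambda>S. U (Max S)"] by blast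
qed

text \<open>
  A piece is a part of \<open>L\<close> with a gap of \<open>c * \<delta>\<close> to the rest of \<open>L\<close>. When coordinate \<open>b\<close> is
  dropped, pieces are intersected with the part \<open>G\<close> of \<open>L\<close> over the copy of an island of the
  current projection. They still meet \<open>Y\<close>, because the guard word leads into the island. A
  point outside the intersection is separated from it either by the gap of the piece or by the
  gap of the copy, which is comparable to the current shortest side and hence to \<open>\<delta>\<close>.
\<close>

lemma many_islands:
  assumes has_islands
  shows "\<exists>c>0. \<exists>\<kappa>>0. \<forall>\<delta>>0. \<forall>w\<in>lists D. (\<forall>k. \<delta> \<le> rho w k) \<longrightarrow>
    (\<exists>\<I>. finite \<I> \<and> disjoint \<I> \<and> \<kappa> * Psi UNIV w \<delta> \<le> real (card \<I>) \<and>
      (\<forall>I\<in>\<I>. I \<subseteq> L \<and> I \<inter> phi w ` L \<noteq> {} \<and> (\<forall>x\<in>I. \<forall>y\<in>L - I. c * \<delta> \<le> dist x y)))"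
proof -
  obtain \<eta> U v where U: "0 < \<eta>" and v: "\<And>S. v S \<in> lists D" and
    isl: "\<And>S. down_closed S \<Longrightarrow> S \<noteq> {} \<Longrightarrow> island S \<eta> (U S) \<and> proj S ` phi (v S) ` L \<subseteq> U S"
    using uniform_islands[OF assms] by metis
  obtain M \<kappa> where M: "1 \<le> M" and \<kappa>: "0 < \<kappa>" and pieces: "\<forall>\<delta>>0. \<forall>P. piece_rules v M \<delta> P \<longrightarrow> (\<forall>w\<in>lists D. (\<forall>k. \<delta> \<le> rho w k) \<longrightarrow>
    (\<exists>\<I>. finite \<I> \<and> disjoint \<I> \<and> \<kappa> * Psi UNIV w \<delta> \<le> real (card \<I>) \<and> (\<forall>I\<in>\<I>. P UNIV w (phi w ` L) I)))"
    using disjoint_pieces[of v, OF v] by (elim exE conjE) (rule that; assumption)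
  define c where "c = \<eta> / M"
  have c: "0 < c" using U M by (simp add: c_def)
  show ?thesis
  proof (rule exI[of _ c], rule conjI, rule c, rule exI[of _ \<kappa>], rule conjI, rule \<kappa>, intro allI impI ballI)
    fix \<delta> :: real and w assume \<delta>: "0 < \<delta>" and w: "w \<in> lists D" "\<forall>k. \<delta> \<le> rho w k"
    define P where "P S w Y I \<longleftrightarrow> I \<subseteq> open_box S w \<and> I \<subseteq> L \<and> I \<inter> Y \<noteq> {} \<and>
      (\<forall>x\<in>I. \<forall>y\<in>L - I. c * \<delta> \<le> dist x y)" for S w Y I
    have "piece_rules v M \<delta> P"
      unfolding piece_rules_def
    proof (intro conjI allI ballI impI)
      fix S w Y I assume "P S w Y I"
      then show "I \<noteq> {}" "I \<subseteq> open_box S w" by (auto simp: P_def)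
    next
      fix S w Y I a assume "a \<in> D" "w \<in> lists D" "P S (w @ [a]) (part S Y (w @ [a])) I"
      then show "P S w Y I" using open_box_append[of a w S] part_subset[of S Y "w @ [a]"] unfolding P_def by blast
    next
      fix b :: 'n and A w Y I
      let ?S = "insert b A" and ?v = "v (insert b A)"
      let ?Y = "part ?S Y (w @ ?v)"
      assume a: "down_closed ?S" "\<forall>a\<in>A. a < b" "w \<in> lists D" "\<delta> \<le> M * rho w b" "Y \<subseteq> L" "P A (w @ ?v) ?Y I"
      have i: "island ?S \<eta> (U ?S)" "proj ?S ` phi ?v ` L \<subseteq> U ?S" using isl[OF a(1)] by auto
      have g: "I \<subseteq> L" "I \<inter> ?Y \<noteq> {}" "\<forall>x\<in>I. \<forall>y\<in>L - I. c * \<delta> \<le> dist x y" using a(6) by (auto simp: P_def)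
      define G where "G = {x \<in> L. proj ?S x \<in> (\<lambda>x. proj ?S (phi w x)) ` U ?S}"
      have YG: "?Y \<subseteq> G"
      proof
        fix y assume y: "y \<in> ?Y"
        then obtain z where z: "z \<in> L" "proj ?S y = proj ?S (phi w (phi ?v z))" by (auto simp: part_def phi_append)
        then have "proj ?S y = proj ?S (phi w (proj ?S (phi ?v z)))" by (simp add: proj_phi_proj)
        moreover have "proj ?S (phi ?v z) \<in> U ?S" using i(2) z(1) by blast
        moreover have "y \<in> L" using y a(5) part_subset by blast
        ultimately show "y \<in> G" unfolding G_def by blast
      qed
      have meet: "I \<inter> G \<inter> Y \<noteq> {}" using g(2) YG part_subset[of ?S Y "w @ ?v"] by blast
      have box: "I \<inter> G \<subseteq> open_box ?S w"
        unfolding open_box_def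
      proof (intro subsetI CollectI ballI)
        fix x k assume x: "x \<in> I \<inter> G" "k \<in> ?S"
        obtain u where u: "u \<in> U ?S" "proj ?S x = proj ?S (phi w u)" using x(1) unfolding G_def by blast
        then have xk: "x $ k = rho w k * u $ k + tau w k" using x(2) unfolding proj_eq_iff phi_nth by blast
        have "\<eta> \<le> u $ k" "u $ k \<le> 1 - \<eta>" using i(1) u(1) x(2) by (auto simp: island_def)
        then have "0 < u $ k" "u $ k < 1" using U by auto
        then show "tau w k < x $ k \<and> x $ k < tau w k + rho w k" using rho_pos[OF a(3), of k] by (simp add: xk)
      qed
      have gap: "c * \<delta> \<le> dist x y" if x: "x \<in> I \<inter> G" and y: "y \<in> L - (I \<inter> G)" for x y
      proof (cases "y \<in> I")
        case False
        then show ?thesis using g(3) x y by blast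
      next
        case True
        then have "proj ?S y \<notin> (\<lambda>x. proj ?S (phi w x)) ` U ?S" using y unfolding G_def by blast
        moreover obtain u where u: "u \<in> U ?S" "proj ?S x = proj ?S (phi w u)" using x unfolding G_def by blast
        ultimately obtain k where k: "k \<in> ?S" "\<eta> * rho w k \<le> \<bar>proj ?S x $ k - proj ?S y $ k\<bar>"
          using island_image_gap[OF a(1,3) i(1) u(1), of "proj ?S y"] y by auto
        have "k \<le> b" using k a(2) by auto
        then have "\<delta> \<le> M * rho w k" using a(4) rho_antimono[OF a(3), of k b] M
          by (meson mult_left_mono order_trans zero_le_one)
        then have "\<eta> * \<delta> \<le> \<eta> * (M * rho w k)" using U by simp
        then have "c * \<delta> \<le> \<eta> * rho w k" using M by (simp add: c_def field_simps)
        also have "\<dots> \<le> \<bar>x $ k - y $ k\<bar>" using k by (simp add: proj_nth)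
        also have "\<dots> \<le> dist x y" by (rule coord_le_dist)
        finally show ?thesis .
      qed
      have "P ?S w Y (I \<inter> G)" unfolding P_def using box g(1) meet gap by blast
      then show "\<exists>J\<subseteq>I. P ?S w Y J" by (intro exI[of _ "I \<inter> G"] conjI Int_lower1)
    next
      fix w Y assume "Y \<subseteq> L" "Y \<noteq> {}"
      then show "\<exists>I. P {} w Y I" by (intro exI[of _ L]) (auto simp: P_def open_box_def)
    qed
    from pieces[rule_format, OF \<delta> this w(1) w(2)[rule_format]] obtain \<I> where "finite \<I>" "disjoint \<I>"
      "\<kappa> * Psi UNIV w \<delta> \<le> real (card \<I>)" "\<forall>I\<in>\<I>. P UNIV w (phi w ` L) I"
      by (elim exE conjE) (rule that; assumption)
    then show "\<exists>\<I>. finite \<I> \<and> disjoint \<I> \<and> \<kappa> * Psi UNIV w \<delta> \<le> real (card \<I>) \<and>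
      (\<forall>I\<in>\<I>. I \<subseteq> L \<and> I \<inter> phi w ` L \<noteq> {} \<and> (\<forall>x\<in>I. \<forall>y\<in>L - I. c * \<delta> \<le> dist x y))"
      by (intro exI[of _ \<I>] conjI ballI) (auto simp: P_def)
  qed
qed

lemma Psi_UNIV_scale:
  "w \<in> lists D \<Longrightarrow> 0 < s \<Longrightarrow> 0 < \<delta> \<Longrightarrow>
    Psi UNIV w (s * \<delta>) = s powr (- dimension) * (weight UNIV w * \<delta> powr (- dimension))"
  by (simp add: Psi_eq powr_mult)

lemma component_count_cylinder_lower:
  assumes has_islands
  obtains \<kappa> where "0 < \<kappa>" "\<And>w. w \<in> lists D \<Longrightarrow> \<exists>\<delta>\<^sub>0>0. \<forall>\<delta>. 0 < \<delta> \<and> \<delta> < \<delta>\<^sub>0 \<longrightarrow>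
    \<kappa> * (weight UNIV w * \<delta> powr (- dimension)) \<le> real (component_count (phi w ` L) \<delta>)"
proof -
  obtain c \<kappa> where c: "0 < c" "0 < \<kappa>" and many: "\<forall>\<delta>>0. \<forall>w\<in>lists D. (\<forall>k. \<delta> \<le> rho w k) \<longrightarrow>
    (\<exists>\<I>. finite \<I> \<and> disjoint \<I> \<and> \<kappa> * Psi UNIV w \<delta> \<le> real (card \<I>) \<and>
      (\<forall>I\<in>\<I>. I \<subseteq> L \<and> I \<inter> phi w ` L \<noteq> {} \<and> (\<forall>x\<in>I. \<forall>y\<in>L - I. c * \<delta> \<le> dist x y)))"
    using many_islands[OF assms] by (elim exE conjE) (rule that; assumption)
  show thesis
  proof (rule that[of "\<kappa> * (2 / c) powr (- dimension)"])
    show "0 < \<kappa> * (2 / c) powr (- dimension)" using c by simp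
    fix w assume w: "w \<in> lists D"
    show "\<exists>\<delta>\<^sub>0>0. \<forall>\<delta>. 0 < \<delta> \<and> \<delta> < \<delta>\<^sub>0 \<longrightarrow>
      \<kappa> * (2 / c) powr (- dimension) * (weight UNIV w * \<delta> powr (- dimension)) \<le> real (component_count (phi w ` L) \<delta>)"
    proof (intro exI[of _ "c / 2 * q ^ length w"] conjI allI impI)
      show "0 < c / 2 * q ^ length w" using c q_bounds by simp
      fix \<delta> :: real assume \<delta>: "0 < \<delta> \<and> \<delta> < c / 2 * q ^ length w"
      then have \<delta>': "0 < 2 / c * \<delta>" "2 / c * \<delta> \<le> q ^ length w" using c by (auto simp: field_simps)
      then have "\<forall>k. 2 / c * \<delta> \<le> rho w k" using rho_lower[OF w] by (meson order_trans)
      from many[rule_format, OF \<delta>'(1) w this[rule_format]] obtain \<I> where \<I>: "finite \<I>" "disjoint \<I>" "\<kappa> * Psi UNIV w (2 / c * \<delta>) \<le> real (card \<I>)"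
        "\<forall>I\<in>\<I>. I \<subseteq> L \<and> I \<inter> phi w ` L \<noteq> {} \<and> (\<forall>x\<in>I. \<forall>y\<in>L - I. c * (2 / c * \<delta>) \<le> dist x y)"
        by (elim exE conjE) (rule that; assumption)
      have sub: "phi w ` L \<subseteq> L" using phi_L[OF w] by blast
      have "card \<I> \<le> component_count (phi w ` L) \<delta>"
      proof (rule card_islands_le_component_count)
        show "bounded (phi w ` L)" using bounded_subset[OF bounded_L sub] .
        fix I x y assume "I \<in> \<I>" "x \<in> phi w ` L \<inter> I" "y \<in> phi w ` L - I"
        then have "c * (2 / c * \<delta>) \<le> dist x y" using \<I>(4) sub by blast
        then show "\<delta> < dist x y" using c \<delta> by simp
      qed (use \<I> \<delta> in auto)
      then show "\<kappa> * (2 / c) powr (- dimension) * (weight UNIV w * \<delta> powr (- dimension)) \<le> real (component_count (phi w ` L) \<delta>)"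
        using \<I>(3) Psi_UNIV_scale[OF w, of "2 / c" \<delta>] c \<delta> by (simp add: mult.assoc)
    qed
  qed
qed

lemma component_count_cylinder_upper:
  obtains C where "0 < C" "\<And>w. w \<in> lists D \<Longrightarrow> \<exists>\<delta>\<^sub>0>0. \<forall>\<delta>. 0 < \<delta> \<and> \<delta> < \<delta>\<^sub>0 \<longrightarrow>
    real (component_count (phi w ` L) \<delta>) \<le> C * (weight UNIV w * \<delta> powr (- dimension))"
proof -
  let ?d = "real CARD('n)"
  obtain C where C: "1 \<le> C" "\<And>\<delta>. 0 < \<delta> \<Longrightarrow> bounded_size (lists D) C UNIV 1 \<delta> L (\<lambda>Y. real (covering_number Y (?d * \<delta>)))"
    using covering_number_upper[of UNIV 1] bounded_L by auto
  let ?s = "1 / (2 * ?d)"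
  show thesis
  proof (rule that[of "C * ?s powr (- dimension)"])
    show "0 < C * ?s powr (- dimension)" using C by simp
    fix w assume w: "w \<in> lists D"
    have sub: "phi w ` L \<subseteq> L" using phi_L[OF w] by blast
    show "\<exists>\<delta>\<^sub>0>0. \<forall>\<delta>. 0 < \<delta> \<and> \<delta> < \<delta>\<^sub>0 \<longrightarrow>
      real (component_count (phi w ` L) \<delta>) \<le> C * ?s powr (- dimension) * (weight UNIV w * \<delta> powr (- dimension))"
    proof (intro exI[of _ "q ^ length w"] conjI allI impI)
      show "0 < q ^ length w" using q_bounds by simp
      fix \<delta> :: real assume \<delta>: "0 < \<delta> \<and> \<delta> < q ^ length w"
      have "1 \<le> ?d" by (simp add: Suc_le_eq)
      then have s: "0 < ?s" "?s \<le> 1" by (simp_all only: divide_le_eq_1 zero_less_divide_iff, linarith+)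
      have sd: "0 < ?s * \<delta>" using s \<delta> by simp
      have "?s * \<delta> \<le> \<delta>" using mult_right_mono[OF s(2), of \<delta>] \<delta> by simp
      then have le: "\<forall>k\<in>UNIV. ?s * \<delta> \<le> 1 * rho w k" using \<delta> rho_lower[OF w]
        by (metis less_imp_le mult_1 order_trans)
      have e: "\<delta> = 2 * (\<delta> / 2)" "\<delta> / 2 = ?d * (?s * \<delta>)" by simp_all
      have "component_count (phi w ` L) \<delta> \<le> covering_number (phi w ` L) (\<delta> / 2)"
        unfolding component_count_eq
        using classes_meeting_le_covering_number(2)[OF bounded_subset[OF bounded_L sub] order_refl, of "\<delta> / 2"] \<delta> by simp
      also have "real (covering_number (phi w ` L) (\<delta> / 2)) \<le> C * Psi UNIV w (?s * \<delta>)"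
        unfolding e(2) using C(2)[OF sd, unfolded bounded_size_def, rule_format, OF w sub _ shadow_UNIV] le
        by (simp add: flat_def)
      finally show "real (component_count (phi w ` L) \<delta>) \<le> C * ?s powr (- dimension) * (weight UNIV w * \<delta> powr (- dimension))"
        using Psi_UNIV_scale[OF w s(1), of \<delta>] \<delta> by (simp add: mult.assoc)
    qed
  qed
qed

section \<open>Digits that fix a face\<close>

text \<open>
  For \<open>s\<close> equal to \<open>0\<close> or \<open>1\<close>: the map of digit \<open>a\<close> sends the face \<open>x $ k = s\<close> of the cube into
  itself; by \<open>touches_iff\<close> otherwise it sends no point of \<open>L\<close> to this face.
\<close>

definition touches :: "'n \<Rightarrow> real \<Rightarrow> ('n \<Rightarrow> nat) \<Rightarrow> bool"
  where "touches k s a \<longleftrightarrow> r k (a k) * s + t k (a k) = s"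

lemma touches_iff:
  assumes "a \<in> D" "x \<in> L" "s = 0 \<or> s = 1"
  shows "r k (a k) * x $ k + t k (a k) = s \<longleftrightarrow> touches k s a \<and> x $ k = s"
  using assms(3)
proof
  assume s: "s = 0"
  have "0 \<le> r k (a k) * x $ k" using digit_bounds[OF assms(1), of k] L_cube[OF assms(2), of k] by simp
  then show ?thesis unfolding touches_def s using digit_bounds[OF assms(1), of k] by (auto simp: add_nonneg_eq_0_iff)
next
  assume s: "s = 1"
  have nn: "0 \<le> r k (a k) * (1 - x $ k)" using digit_bounds[OF assms(1), of k] L_cube[OF assms(2), of k] by simp
  show ?thesis
  proof
    assume "r k (a k) * x $ k + t k (a k) = s"
    then have "r k (a k) * (1 - x $ k) = r k (a k) + t k (a k) - 1" by (simp add: s right_diff_distrib)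
    then have "r k (a k) + t k (a k) = 1" "r k (a k) * (1 - x $ k) = 0"
      using nn digit_bounds(4)[OF assms(1), of k] by auto
    then show "touches k s a \<and> x $ k = s" using digit_bounds(1)[OF assms(1), of k] by (simp add: s touches_def)
  qed (simp add: s touches_def)
qed

text \<open>
  Some digit leaves the face, and its class has positive weight.
\<close>

lemma sum_weight_touches:
  assumes "down_closed S" "k \<in> S" "s = 0 \<or> s = 1"
  shows "(\<Sum>a | a \<in> transversal S \<and> touches k s a. weight S [a]) < 1"
proof -
  have "\<exists>a\<in>D. \<not> touches k s a"
    using assms(3)
  proof
    assume s: "s = 0"
    obtain a where "a \<in> D" "0 < t k (a k)" using nondegenerate_digits(1) by blast
    then show ?thesis unfolding touches_def s by (intro bexI[of _ a]) auto
  next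
    assume s: "s = 1"
    obtain a where "a \<in> D" "t k (a k) + r k (a k) < 1" using nondegenerate_digits(2) by blast
    then show ?thesis unfolding touches_def s by (intro bexI[of _ a]) auto
  qed
  then obtain a where a: "a \<in> D" "\<not> touches k s a" by blast
  obtain b where b: "b \<in> transversal S" "restrict b S = restrict a S" using transversal_rep[OF a(1)] .
  have nb: "\<not> touches k s b" using a(2) restrict_eq_nth[OF b(2) assms(2)] by (simp add: touches_def)
  have pos: "0 < weight S [c]" if "c \<in> transversal S" for c using weight_pos transversalD[OF that] by simp
  have "(\<Sum>a | a \<in> transversal S \<and> touches k s a. weight S [a]) < (\<Sum>a\<in>transversal S. weight S [a])"
    by (rule sum_strict_mono2[where b = b]) (use b nb pos in \<open>auto simp: less_imp_le\<close>)
  then show ?thesis using sum_weight[OF assms(1)] by simp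
qed

lemma transversal_UNIV: "transversal UNIV = D"
proof -
  have "restrict a UNIV = a" for a :: "'n \<Rightarrow> nat" by (simp add: restrict_def)
  then have "(\<lambda>a. restrict a UNIV) ` X = X" for X :: "('n \<Rightarrow> nat) set" by (simp only: image_ident)
  then show ?thesis using transversal_props(3)[of UNIV] by metis
qed

lemma phi_single: "phi [a] = sponge_map r t a"
  by (simp add: fun_eq_iff phi_Cons)

lemma closed_phi_L: "closed (phi w ` L)"
  by (intro compact_imp_closed compact_continuous_image continuous_on_phi compact_L)

lemma sponge_map_contracts:
  assumes "a \<in> D"
  shows "dist (sponge_map r t a x) (sponge_map r t a y) \<le> (1 - q) * dist x y"
proof -
  have "norm (sponge_map r t a x - sponge_map r t a y) \<le> norm ((1 - q) *\<^sub>R (x - y))"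
  proof (rule norm_le_componentwise_cart)
    fix k
    have "(sponge_map r t a x - sponge_map r t a y) $ k = r k (a k) * (x $ k - y $ k)"
      by (simp add: sponge_map_def algebra_simps)
    moreover have "r k (a k) * \<bar>x $ k - y $ k\<bar> \<le> (1 - q) * \<bar>x $ k - y $ k\<bar>"
      by (rule mult_right_mono) (use q_bounds(4)[OF assms] in auto)
    ultimately show "norm ((sponge_map r t a x - sponge_map r t a y) $ k) \<le> norm (((1 - q) *\<^sub>R (x - y)) $ k)"
      using digit_bounds(1)[OF assms, of k] q_bounds(1,2) by (simp add: abs_mult)
  qed
  then show ?thesis using q_bounds(1,2) by (simp add: dist_norm)
qed

end

section \<open>The canonical Bernoulli measure\<close>

locale Bernoulli_sponge = LG_sponge n r t D L \<beta> + prob_space \<mu>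
  for n :: "'n::{finite,linorder} \<Rightarrow> nat" and r t D L \<beta>
    and \<mu> :: "(real ^ 'n::{finite,linorder}) measure" +
  assumes sets_\<mu>: "sets \<mu> = sets borel"
    and self_similar: "\<And>B. B \<in> sets borel \<Longrightarrow>
      measure \<mu> B = (\<Sum>a\<in>D. weight UNIV [a] * measure \<mu> (sponge_map r t a -` B))"
begin

lemma space_\<mu>: "space \<mu> = UNIV"
  using sets_eq_imp_space_eq[OF sets_\<mu>] by simp

lemma sponge_vimage_borel: "B \<in> sets borel \<Longrightarrow> sponge_map r t a -` B \<in> sets borel"
  using measurable_sets[OF borel_measurable_continuous_onI[OF continuous_on_phi[of UNIV "[a]"]]]
  by (simp add: phi_single)

lemma sum_weight_D: "(\<Sum>a\<in>D. weight UNIV [a]) = 1"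
  using sum_weight[of UNIV] by (simp add: transversal_UNIV)

text \<open>
  Let \<open>f c\<close> be the measure of the points at distance more than \<open>c\<close> from \<open>L\<close>. Since all maps
  contract distances to \<open>L\<close> by the factor \<open>1 - q\<close>, self-similarity gives \<open>f c \<le> f (c / (1 -
  q))\<close>. Iteration leads to infinity, where \<open>f\<close> tends to \<open>0\<close>.
\<close>

lemma null_complement: "- L \<in> null_sets \<mu>"
proof -
  define A where "A c = {x. c < infdist x L}" for c :: real
  have A_borel: "A c \<in> sets \<mu>" for c
    unfolding sets_\<mu> A_def
    by (intro borel_open open_Collect_less continuous_intros) 
  have step: "measure \<mu> (A c) \<le> measure \<mu> (A (c / (1 - q)))" for c
  proof -
    have sub: "sponge_map r t a -` A c \<subseteq> A (c / (1 - q))" if a: "a \<in> D" for a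
    proof
      fix x assume "x \<in> sponge_map r t a -` A c"
      then have "c < infdist (sponge_map r t a x) L" by (simp add: A_def)
      moreover obtain y where y: "y \<in> L" "infdist x L = dist x y"
        using infdist_attains_inf[OF compact_imp_closed[OF compact_L] L_nonempty] by blast
      have "sponge_map r t a y \<in> L" using phi_L[of "[a]"] a y by (simp add: phi_single)
      then have "infdist (sponge_map r t a x) L \<le> (1 - q) * infdist x L"
        using sponge_map_contracts[OF a, of x y] y(2) by (metis infdist_le order_trans)
      ultimately show "x \<in> A (c / (1 - q))"
        using q_bounds(1,2) by (simp add: A_def field_simps)
    qed
    have "measure \<mu> (A c) = (\<Sum>a\<in>D. weight UNIV [a] * measure \<mu> (sponge_map r t a -` A c))"
      using self_similar A_borel sets_\<mu> by blast
    also have "\<dots> \<le> (\<Sum>a\<in>D. weight UNIV [a] * measure \<mu> (A (c / (1 - q))))"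
    proof (intro sum_mono mult_left_mono finite_measure_mono sub A_borel)
      fix a assume "a \<in> D"
      then show "0 \<le> weight UNIV [a]" using weight_pos[of "[a]" UNIV] by simp
    qed
    also have "\<dots> = measure \<mu> (A (c / (1 - q)))"
      by (simp add: sum_distrib_right[symmetric] sum_weight_D)
    finally show ?thesis .
  qed
  have lim: "(\<lambda>m. measure \<mu> (A (real m))) \<longlonglongrightarrow> 0"
  proof -
    have "(\<lambda>m. measure \<mu> (A (real m))) \<longlonglongrightarrow> measure \<mu> (\<Inter>m. A (real m))"
      by (intro finite_Lim_measure_decseq) (use A_borel in \<open>auto simp: decseq_def A_def\<close>)
    moreover have "(\<Inter>m. A (real m)) = {}"
    proof -
      have "\<exists>m. x \<notin> A (real m)" for x
        using real_arch_simple[of "infdist x L"] by (auto simp: A_def not_less)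
      then show ?thesis by blast
    qed
    ultimately show ?thesis by simp
  qed
  have zero: "measure \<mu> (A c) = 0" if c: "0 < c" for c
  proof -
    have "measure \<mu> (A c) \<le> measure \<mu> (A (real m))" for m
    proof -
      have iter: "measure \<mu> (A c) \<le> measure \<mu> (A (c / (1 - q) ^ i))" for i
      proof (induction i)
        case (Suc i)
        show ?case using Suc step[of "c / (1 - q) ^ i"] by (simp add: mult.commute)
      qed simp
      obtain i where i: "(1 - q) ^ i < c / (real m + 1)" using real_arch_pow_inv[of "c / (real m + 1)" "1 - q"] c q_bounds by auto
      then have "real m \<le> c / (1 - q) ^ i" using q_bounds(1,2) by (simp add: field_simps)
         (smt (verit) mult_nonneg_nonneg of_nat_0_le_iff zero_less_power)
      then have "measure \<mu> (A (c / (1 - q) ^ i)) \<le> measure \<mu> (A (real m))"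
        by (intro finite_measure_mono A_borel) (auto simp: A_def)
      then show ?thesis using iter[of i] by linarith
    qed
    then have "measure \<mu> (A c) \<le> 0" using lim by (intro LIMSEQ_le_const[OF lim]) auto
    then show ?thesis using measure_nonneg[of \<mu> "A c"] by linarith
  qed
  have "A (1 / real (Suc m)) \<in> null_sets \<mu>" for m
    using zero A_borel by (auto simp: null_sets_def emeasure_eq_measure)
  then have "(\<Union>m. A (1 / real (Suc m))) \<in> null_sets \<mu>" by (rule null_sets_UN)
  moreover have "- L = (\<Union>m. A (1 / real (Suc m)))"
  proof (intro subset_antisym subsetI)
    fix x assume "x \<in> - L"
    then have "0 < infdist x L"
      using infdist_pos_not_in_closed[OF compact_imp_closed[OF compact_L] L_nonempty] by simp
    then obtain m where "1 / real (Suc m) < infdist x L" by (metis nat_approx_posE)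
    then show "x \<in> (\<Union>m. A (1 / real (Suc m)))" unfolding A_def by blast
  qed (auto simp: A_def)
  ultimately show ?thesis by simp
qed

lemma measure_mono_on_L:
  assumes "B \<in> sets borel" "A \<inter> L \<subseteq> B" "A \<in> sets borel"
  shows "measure \<mu> A \<le> measure \<mu> B"
proof (rule finite_measure_mono_AE)
  have "AE x in \<mu>. x \<in> L" using AE_not_in[OF null_complement] by simp
  then show "AE x in \<mu>. x \<in> A \<longrightarrow> x \<in> B" by eventually_elim (use assms(2) in auto)
qed (use assms sets_\<mu> in simp)

text \<open>
  Only the digits that fix the face contribute, so the measure of the face is at most \<open>p < 1\<close>
  times itself.
\<close>

lemma measure_face:
  assumes "s = 0 \<or> s = 1"
  shows "measure \<mu> {x \<in> L. x $ k = s} = 0"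
proof -
  let ?F = "{x \<in> L. x $ k = s}"
  have "closed (L \<inter> {x. x $ k = s})"
    by (intro closed_Int compact_imp_closed[OF compact_L] closed_Collect_eq continuous_intros)
  then have F: "?F \<in> sets borel" by (simp add: Int_def)
  let ?p = "\<Sum>a | a \<in> D \<and> touches k s a. weight UNIV [a]"
  have wp: "0 \<le> weight UNIV [a]" if "a \<in> D" for a using weight_pos[of "[a]" UNIV] that by simp
  have "measure \<mu> ?F = (\<Sum>a\<in>D. weight UNIV [a] * measure \<mu> (sponge_map r t a -` ?F))"
    using self_similar[OF F] .
  also have "\<dots> \<le> (\<Sum>a\<in>D. if touches k s a then weight UNIV [a] * measure \<mu> ?F else 0)"
  proof (rule sum_mono)
    fix a assume a: "a \<in> D"
    have sub: "sponge_map r t a -` ?F \<inter> L \<subseteq> (if touches k s a then ?F else {})"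
      using touches_iff[OF a _ assms, of _ k] by (auto simp: sponge_map_def)
    have "measure \<mu> (sponge_map r t a -` ?F) \<le> measure \<mu> (if touches k s a then ?F else {})"
      by (rule measure_mono_on_L[OF _ sub sponge_vimage_borel[OF F]]) (use F in auto)
    then show "weight UNIV [a] * measure \<mu> (sponge_map r t a -` ?F) \<le> (if touches k s a then weight UNIV [a] * measure \<mu> ?F else 0)"
      using wp[OF a] by (auto simp: mult_left_mono mult_nonneg_nonpos)
  qed
  also have "\<dots> = ?p * measure \<mu> ?F"
    by (simp add: sum.inter_filter[symmetric] sum_distrib_right)
  finally have "measure \<mu> ?F * (1 - ?p) \<le> 0" by (simp add: algebra_simps)
  moreover have "?p < 1" using sum_weight_touches[of UNIV k s] assms by (simp add: transversal_UNIV)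
  ultimately have "measure \<mu> ?F \<le> 0" by (simp add: mult_le_0_iff)
  then show ?thesis using measure_nonneg[of \<mu> ?F] by linarith
qed

text \<open>
  In the self-similarity relation for a cylinder with first digit \<open>a\<close>, the terms of the other
  digits vanish: the corresponding cylinders meet only in images of faces, and faces are null
  sets.
\<close>

lemma measure_cylinder: "w \<in> lists D \<Longrightarrow> measure \<mu> (phi w ` L) = weight UNIV w"
proof (induction w)
  case Nil
  have "measure \<mu> L = 1"
  proof -
    have "measure \<mu> (space \<mu>) \<le> measure \<mu> L"
      unfolding space_\<mu> by (rule measure_mono_on_L) (use compact_imp_closed[OF compact_L] in auto)
    then show ?thesis using prob_space prob_le_1[of L] by linarith
  qed
  then show ?case by (simp add: weight_def image_def)
next
  case (Cons a u)
  let ?X = "phi u ` L"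
  have aD: "a \<in> D" "u \<in> lists D" using Cons by auto
  have XL: "?X \<subseteq> L" using phi_L[OF aD(2)] by blast
  have img: "phi (a # u) ` L = sponge_map r t a ` ?X" by (auto simp: phi_Cons)
  have bor: "phi w ` L \<in> sets borel" for w using closed_phi_L by simp
  have inj: "sponge_map r t a -` sponge_map r t a ` ?X = ?X"
  proof (rule inj_vimage_image_eq)
    show "inj (sponge_map r t a)"
      using digit_bounds(1)[OF aD(1)] by (auto intro!: injI simp: sponge_map_def vec_eq_iff less_imp_neq[THEN not_sym])
  qed
  have other: "measure \<mu> (sponge_map r t b -` phi (a # u) ` L) = 0" if b: "b \<in> D" "b \<noteq> a" for b
  proof -
    define B where "B = (\<Union>k. {x \<in> L. x $ k = 0} \<union> {x \<in> L. x $ k = 1})"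
    have F: "closed {x \<in> L. x $ k = s}" for k s
    proof -
      have "closed (L \<inter> {x. x $ k = s})"
        by (intro closed_Int compact_imp_closed[OF compact_L] closed_Collect_eq continuous_intros)
      then show ?thesis by (simp add: Int_def)
    qed
    have null: "{x \<in> L. x $ k = s} \<in> null_sets \<mu>" if "s = 0 \<or> s = 1" for k s
      using measure_face[OF that, of k] F[of k s] sets_\<mu> by (auto simp: null_sets_def emeasure_eq_measure)
    have "B \<in> null_sets \<mu>"
      unfolding B_def using null by (intro null_sets_UN' null_sets.Un) (auto simp: countable_finite)
    then have B: "B \<in> sets borel" "measure \<mu> B = 0"
      using sets_\<mu> by (auto simp: null_sets_def measure_def)
    have sub: "sponge_map r t b -` phi (a # u) ` L \<inter> L \<subseteq> B"
    proof
      fix x assume x: "x \<in> sponge_map r t b -` phi (a # u) ` L \<inter> L"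
      then obtain z where z: "z \<in> L" "sponge_map r t b x = sponge_map r t a z" using XL unfolding img by blast
      have xL: "x \<in> L" using x by blast
      have "restrict a UNIV \<noteq> restrict b UNIV" using b(2) by (simp add: restrict_def)
      then obtain k where k: "t k (a k) + r k (a k) \<le> t k (b k) \<or> t k (b k) + r k (b k) \<le> t k (a k)"
        using neat_digits[OF aD(1) b(1) down_closed_UNIV] by blast
      have e: "r k (b k) * x $ k + t k (b k) = r k (a k) * z $ k + t k (a k)"
        using arg_cong[OF z(2), of "\<lambda>v. v $ k"] by (simp add: sponge_map_def)
      have ra: "0 \<le> r k (a k) * z $ k" "r k (a k) * z $ k \<le> r k (a k) * 1"
        using digit_bounds(1)[OF aD(1), of k] L_cube[OF z(1), of k] by auto
      have rb: "0 < r k (b k)" "0 \<le> r k (b k) * x $ k" "r k (b k) * x $ k \<le> r k (b k) * 1"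
        using digit_bounds(1)[OF b(1), of k] L_cube[OF xL, of k] by auto
      have "r k (b k) * x $ k = 0 \<or> r k (b k) * x $ k = r k (b k) * 1" using k e ra rb by linarith
      then have "x $ k = 0 \<or> x $ k = 1" using rb(1) by simp
      then show "x \<in> B" unfolding B_def using xL by blast
    qed
    have "measure \<mu> (sponge_map r t b -` phi (a # u) ` L) \<le> measure \<mu> B"
      by (rule measure_mono_on_L[OF B(1) sub sponge_vimage_borel[OF bor]])
    then show ?thesis using B(2) measure_nonneg by (metis order_antisym)
  qed
  have "measure \<mu> (phi (a # u) ` L) = (\<Sum>b\<in>D. weight UNIV [b] * measure \<mu> (sponge_map r t b -` phi (a # u) ` L))"
    by (rule self_similar[OF bor])
  also have "\<dots> = (\<Sum>b\<in>D. if b = a then weight UNIV [a] * weight UNIV u else 0)"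
    by (rule sum.cong[OF refl]) (use other inj img Cons.IH aD in auto)
  also have "\<dots> = weight UNIV [a] * weight UNIV u" using aD by simp
  also have "\<dots> = weight UNIV (a # u)" using weight_append[of "[a]" u UNIV] aD by simp
  finally show ?case .
qed

end

section \<open>Few components in the absence of islands\<close>

lemma subadditive_classes_meeting: "subadditive_on E (\<lambda>Y. real (classes_meeting E \<delta> Y))"
  unfolding subadditive_on_def
proof (intro conjI allI impI)
  fix X Y
  have "classes_meeting E \<delta> (X \<union> Y) \<le> classes_meeting E \<delta> X + classes_meeting E \<delta> Y"
    unfolding classes_meeting_def image_Un by (rule card_Un_le)
  then show "real (classes_meeting E \<delta> (X \<union> Y)) \<le> real (classes_meeting E \<delta> X) + real (classes_meeting E \<delta> Y)"
    by linarith
qed (simp add: classes_meeting_def)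

lemma classes_meeting_mono:
  fixes E :: "'a::euclidean_space set"
  assumes "bounded E" "0 < \<delta>" "Y \<subseteq> E" "\<And>x. x \<in> X \<Longrightarrow> \<exists>y\<in>Y. (x, y) \<in> chain_equiv E \<delta>"
  shows "classes_meeting E \<delta> X \<le> classes_meeting E \<delta> Y"
  unfolding classes_meeting_def
proof (rule card_mono)
  show "finite ((\<lambda>y. chain_equiv E \<delta> `` {y}) ` Y)"
    using classes_meeting_le_covering_number(1)[OF bounded_subset[OF assms(1,3)] assms(3), of "\<delta> / 2"] assms(2) by simp
  have eq: "equiv E (chain_equiv E \<delta>)" using assms(2) by (intro equiv_chain_equiv) simp
  show "(\<lambda>y. chain_equiv E \<delta> `` {y}) ` X \<subseteq> (\<lambda>y. chain_equiv E \<delta> `` {y}) ` Y"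
  proof (intro image_subsetI)
    fix x assume "x \<in> X"
    then obtain y where "y \<in> Y" "(x, y) \<in> chain_equiv E \<delta>" using assms(4) by blast
    then show "chain_equiv E \<delta> `` {x} \<in> (\<lambda>y. chain_equiv E \<delta> `` {y}) ` Y"
      using equiv_class_eq[OF eq] by blast
  qed
qed

context LG_sponge
begin

definition face :: "('n \<Rightarrow> nat) list \<Rightarrow> 'n \<Rightarrow> real \<Rightarrow> (real ^ 'n::{finite,linorder}) set"
  where "face w k s = {y. y $ k = tau w k + s * rho w k}"

text \<open>
  Over a face of a cylinder only the digits that fix the face survive a refinement, and their
  weights add up to at most \<open>\<theta>\<close>. The estimate \<open>bounded_size\<close> is used after \<open>m\<close> refinements.
\<close>

lemma face_decay:
  assumes S: "down_closed S" "k \<in> S" and s: "s = 0 \<or> s = 1" and \<delta>: "0 < \<delta>" and C: "0 \<le> C"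
    and h: "subadditive_on L h" "\<And>X Y. X \<subseteq> Y \<Longrightarrow> Y \<subseteq> L \<Longrightarrow> h X \<le> h Y"
    and bd: "bounded_size (lists D) C S 1 \<delta> L h"
    and \<theta>: "(\<Sum>a | a \<in> transversal S \<and> touches k s a. weight S [a]) \<le> \<theta>"
  shows "w \<in> lists D \<Longrightarrow> Y \<subseteq> L \<Longrightarrow> shadow S w Y \<Longrightarrow> flat S \<delta> Y \<Longrightarrow> \<forall>k\<in>S. \<delta> \<le> q ^ m * rho w k \<Longrightarrow>
    h (Y \<inter> face w k s) \<le> \<theta> ^ m * C * Psi S w \<delta>"
proof (induction m arbitrary: w Y)
  case 0
  have "h (Y \<inter> face w k s) \<le> h Y" using 0(2) by (intro h(2)) auto
  also have "\<dots> \<le> C * Psi S w \<delta>" using bd 0 unfolding bounded_size_def by simp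
  finally show ?case by simp
next
  case (Suc m)
  let ?T = "{a \<in> transversal S. touches k s a}"
  let ?Z = "\<lambda>a. part S Y (w @ [a]) \<inter> face (w @ [a]) k s"
  have sub: "Y \<inter> face w k s \<subseteq> (\<Union>a\<in>?T. ?Z a)"
  proof
    fix y assume y: "y \<in> Y \<inter> face w k s"
    obtain z where z: "z \<in> L" "proj S y = proj S (phi w z)" using shadowE[OF Suc(4)] y by blast
    obtain a z' where a: "a \<in> D" "z' \<in> L" "z = sponge_map r t a z'" using z(1) L_eq by blast
    obtain b where b: "b \<in> transversal S" "restrict b S = restrict a S" using transversal_rep[OF a(1)] .
    have "proj S y = proj S (phi (w @ [a]) z')" using z a by (simp add: phi_append phi_Cons)
    note P = part_rep[OF IntD1[OF y] this a(2) b(2)]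
    have ab: "a k = b k" using restrict_eq_nth[OF b(2) S(2)] by simp
    have "y $ k = rho w k * z $ k + tau w k" using z(2) S(2) unfolding proj_eq_iff phi_nth by blast
    then have "rho w k * z $ k = rho w k * s" using y by (simp add: face_def)
    then have "z $ k = s" using rho_pos[OF Suc(2), of k] by simp
    then have "touches k s a" "z' $ k = s" using touches_iff[OF a(1,2) s, of k] a(3) by (auto simp: sponge_map_def)
    moreover have "y $ k = rho (w @ [b]) k * z' $ k + tau (w @ [b]) k" using P(2) S(2) unfolding proj_eq_iff phi_nth by blast
    ultimately have "b \<in> ?T" "y \<in> face (w @ [b]) k s" using b(1) ab by (auto simp: touches_def face_def)
    then show "y \<in> (\<Union>a\<in>?T. ?Z a)" using P(1) by blast
  qed
  have ZL: "?Z a \<subseteq> L" for a using part_subset[of S Y] Suc(3) by blast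
  have "h (Y \<inter> face w k s) \<le> h (\<Union>a\<in>?T. ?Z a)" using ZL by (intro h(2) sub) blast
  also have "\<dots> \<le> (\<Sum>a\<in>?T. h (?Z a))" by (rule subadditive_on_UN[OF h(1)]) (use ZL in auto)
  also have "\<dots> \<le> (\<Sum>a\<in>?T. \<theta> ^ m * C * Psi S (w @ [a]) \<delta>)"
  proof (rule sum_mono, rule Suc.IH)
    fix a assume "a \<in> ?T"
    then have a: "a \<in> D" using transversalD by blast
    show "w @ [a] \<in> lists D" using a Suc(2) by simp
    show "part S Y (w @ [a]) \<subseteq> L" using part_subset[of S Y] Suc(3) by blast
    show "shadow S (w @ [a]) (part S Y (w @ [a]))" using shadow_part[OF Suc(4), of "[a]"] a by simp
    show "flat S \<delta> (part S Y (w @ [a]))" using flat_subset[OF Suc(5) part_subset] .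
    show "\<forall>k\<in>S. \<delta> \<le> q ^ m * rho (w @ [a]) k"
    proof
      fix k assume "k \<in> S"
      then have "\<delta> \<le> q ^ m * (rho w k * q)" using Suc(6) by (simp add: mult_ac)
      also have "\<dots> \<le> q ^ m * rho (w @ [a]) k"
        using q_bounds(1) q_bounds(3)[OF a, of k] rho_pos[OF Suc(2), of k] by (intro mult_left_mono) auto
      finally show "\<delta> \<le> q ^ m * rho (w @ [a]) k" .
    qed
  qed
  also have "\<dots> = \<theta> ^ m * C * Psi S w \<delta> * (\<Sum>a\<in>?T. weight S [a])"
    unfolding sum_distrib_left
    by (intro sum.cong refl) (use Psi_append[OF Suc(2) _ \<delta>] transversalD in auto)
  also have "\<dots> \<le> \<theta> ^ m * C * Psi S w \<delta> * \<theta>"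
  proof (intro mult_left_mono \<theta>)
    have "0 \<le> (\<Sum>a\<in>?T. weight S [a])"
      by (intro sum_nonneg less_imp_le weight_pos) (use transversalD in auto)
    then have "0 \<le> \<theta>" using \<theta> by linarith
    then show "0 \<le> \<theta> ^ m * C * Psi S w \<delta>" using C Psi_pos[OF Suc(2) \<delta>, of S] by simp
  qed
  finally show ?case by (simp add: mult_ac)
qed

text \<open>
  A chain class is clopen, so it would be an island if it stayed off the boundary.
\<close>

lemma chains_touch_boundary:
  assumes no: "\<not> (\<exists>\<eta> U. 0 < \<eta> \<and> U \<noteq> {} \<and> island S \<eta> U)" and \<delta>: "0 < \<delta>" and z: "z \<in> proj S ` L"
  obtains z' k s where "(z, z') \<in> chain_equiv (proj S ` L) \<delta>" "k \<in> S" "s = 0 \<or> s = 1" "z' $ k = s"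
proof -
  let ?Q = "proj S ` L"
  define K where "K = chain_equiv ?Q \<delta> `` {z}"
  have KQ: "K \<subseteq> ?Q" using chain_equiv_subset unfolding K_def by blast
  have zK: "z \<in> K" using chain_equiv_step[OF z z] \<delta> by (simp add: K_def)
  have near: "y \<in> K" if "x \<in> K" "y \<in> ?Q" "dist x y < \<delta>" for x y
  proof -
    have "(x, y) \<in> chain_equiv ?Q \<delta>" using that KQ by (intro chain_equiv_step) auto
    then show ?thesis using \<open>x \<in> K\<close> chain_equiv_trans unfolding K_def by blast
  qed
  have "openin (top_of_set ?Q) K"
    unfolding openin_contains_ball using KQ near \<delta> by (auto intro!: exI[of _ \<delta>])
  moreover have "openin (top_of_set ?Q) (?Q - K)"
    unfolding openin_contains_ball using near \<delta>
    by (auto intro!: exI[of _ \<delta>] simp: dist_commute)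
  then have "closedin (top_of_set ?Q) K" using KQ by (simp add: closedin_def)
  moreover have "\<not> (\<exists>\<eta>. 0 < \<eta> \<and> island S \<eta> K)" using no zK by blast
  ultimately have "\<not> (\<forall>x\<in>K. \<forall>k\<in>S. 0 < x $ k \<and> x $ k < 1)"
    using island_of_clopen[of S K] by blast
  then obtain z' k where z': "z' \<in> K" "k \<in> S" "\<not> (0 < z' $ k \<and> z' $ k < 1)" by blast
  then obtain y where "y \<in> L" "z' = proj S y" using KQ by blast
  then have "z' $ k = 0 \<or> z' $ k = 1" using z'(2,3) L_cube[of y k] by (auto simp: proj_nth)
  then show thesis using that[of z' k "z' $ k"] z' unfolding K_def by blast
qed

text \<open>
  The maps \<open>phi w\<close> are contractions and \<open>Y\<close> is not wider than \<open>\<delta>\<close> in the coordinates outside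
  \<open>S\<close>, so any points of \<open>Y\<close> over the points of a chain form a chain, with steps at most
  \<open>CARD('n) * \<delta>\<close>.
\<close>

lemma chain_lift:
  assumes Y: "Y \<subseteq> L" "shadow S w Y" "flat S \<delta> Y" and w: "w \<in> lists D"
    and chain: "(z, z') \<in> chain_equiv (proj S ` L) \<delta>" and y: "y \<in> Y" "proj S y = proj S (phi w z)"
    and e: "real CARD('n) * \<delta> \<le> e"
  shows "\<exists>y'\<in>Y. proj S y' = proj S (phi w z') \<and> (y, y') \<in> chain_equiv L e"
proof -
  have step: "\<exists>y'\<in>Y. proj S y' = proj S (phi w b) \<and> (x, y') \<in> chain_equiv L e"
    if x: "x \<in> Y" "proj S x = proj S (phi w a)" and b: "b \<in> proj S ` L" "dist a b \<le> \<delta>" for x a b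
  proof -
    obtain l where l: "l \<in> L" "b = proj S l" using b(1) by blast
    obtain y' where y': "y' \<in> Y" "proj S y' = proj S (phi w l)" by (rule shadow_lift[OF Y(2) l(1)])
    have "\<bar>x $ k - y' $ k\<bar> \<le> \<delta>" for k
    proof (cases "k \<in> S")
      case True
      have "x $ k = rho w k * a $ k + tau w k" "y' $ k = rho w k * l $ k + tau w k"
        using x(2) y'(2) True unfolding proj_eq_iff phi_nth by blast+
      then have "x $ k - y' $ k = rho w k * (a $ k - b $ k)" using True by (simp add: l(2) proj_nth algebra_simps)
      then have "\<bar>x $ k - y' $ k\<bar> = rho w k * \<bar>a $ k - b $ k\<bar>" using rho_pos[OF w, of k] by (simp add: abs_mult)
      also have "\<dots> \<le> 1 * \<bar>a $ k - b $ k\<bar>" by (intro mult_right_mono rho_le_1[OF w]) auto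
      also have "\<dots> \<le> \<delta>" using coord_le_dist[of a k b] b(2) by simp
      finally show ?thesis .
    next
      case False
      then show ?thesis using Y(3) x(1) y'(1) unfolding flat_def by blast
    qed
    then have "dist x y' \<le> e" using dist_le_card_mult e by (meson order_trans)
    then have "(x, y') \<in> chain_equiv L e" using x(1) y'(1) Y(1) by (intro chain_equiv_step) auto
    moreover have "proj S y' = proj S (phi w b)" using y'(2) by (simp add: l(2) proj_phi_proj)
    ultimately show ?thesis using y'(1) by blast
  qed
  show ?thesis
    using chain unfolding chain_equiv_def[of "proj S ` L"]
  proof (induction rule: trancl_induct)
    case (base b)
    then show ?case using step[OF y] by blast
  next
    case (step a b)
    then obtain x where x: "x \<in> Y" "proj S x = proj S (phi w a)" "(y, x) \<in> chain_equiv L e" by blast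
    then obtain y' where "y' \<in> Y" "proj S y' = proj S (phi w b)" "(x, y') \<in> chain_equiv L e"
      using \<open>\<And>x b a. x \<in> Y \<Longrightarrow> proj S x = proj S (phi w a) \<Longrightarrow> b \<in> proj S ` L \<Longrightarrow> dist a b \<le> \<delta> \<Longrightarrow>
        \<exists>y'\<in>Y. proj S y' = proj S (phi w b) \<and> (x, y') \<in> chain_equiv L e\<close>[of x a b] step(2) by blast
    then show ?case using chain_equiv_trans[OF x(3)] by blast
  qed
qed

lemma classes_touch_boundary:
  assumes no: "\<not> (\<exists>\<eta> U. 0 < \<eta> \<and> U \<noteq> {} \<and> island S \<eta> U)" and \<delta>: "0 < \<delta>"
    and Y: "Y \<subseteq> L" "shadow S w Y" "flat S \<delta> Y" and w: "w \<in> lists D" and e: "real CARD('n) * \<delta> \<le> e"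
  shows "real (classes_meeting L e Y) \<le> (\<Sum>(k, s)\<in>S \<times> {0, 1}. real (classes_meeting L e (Y \<inter> face w k s)))"
proof -
  let ?B = "\<Union>x\<in>S \<times> {0, 1}. Y \<inter> face w (fst x) (snd x)"
  have "0 < real CARD('n) * \<delta>" using \<delta> by simp
  then have e0: "0 < e" using e by linarith
  have "classes_meeting L e Y \<le> classes_meeting L e ?B"
  proof (rule classes_meeting_mono[OF bounded_L e0])
    show "?B \<subseteq> L" using Y(1) by blast
    fix y assume y: "y \<in> Y"
    obtain z0 where z0: "z0 \<in> L" "proj S y = proj S (phi w z0)" by (rule shadowE[OF Y(2) y])
    then have z: "proj S z0 \<in> proj S ` L" "proj S y = proj S (phi w (proj S z0))" by (auto simp: proj_phi_proj)
    obtain z' k s where z': "(proj S z0, z') \<in> chain_equiv (proj S ` L) \<delta>" "k \<in> S" "s = 0 \<or> s = 1" "z' $ k = s"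
      by (rule chains_touch_boundary[OF no \<delta> z(1)])
    obtain y' where y': "y' \<in> Y" "proj S y' = proj S (phi w z')" "(y, y') \<in> chain_equiv L e"
      using chain_lift[OF Y w z'(1) y z(2) e] by blast
    have "y' $ k = rho w k * z' $ k + tau w k" using y'(2) z'(2) unfolding proj_eq_iff phi_nth by blast
    then have "y' \<in> face w k s" using z'(4) by (simp add: face_def mult.commute)
    then have "y' \<in> ?B" using y'(1) z'(2,3) by (intro UN_I[of "(k, s)"]) auto
    then show "\<exists>y'\<in>?B. (y, y') \<in> chain_equiv L e" using y'(3) by blast
  qed
  then have "real (classes_meeting L e Y) \<le> real (classes_meeting L e ?B)" by simp
  also have "\<dots> \<le> (\<Sum>x\<in>S \<times> {0, 1}. real (classes_meeting L e (Y \<inter> face w (fst x) (snd x))))"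
    by (rule subadditive_on_UN[OF subadditive_classes_meeting]) (use Y(1) in auto)
  finally show ?thesis by (simp add: case_prod_unfold)
qed

text \<open>
  Every class that meets \<open>Y\<close> meets one of the finitely many faces of the cylinder below \<open>Y\<close>,
  and over a face the number of classes decays geometrically in \<open>m\<close>.
\<close>

lemma no_island_bounded_size:
  assumes S: "down_closed S" "S \<noteq> {}" and no: "\<not> (\<exists>\<eta> U. 0 < \<eta> \<and> U \<noteq> {} \<and> island S \<eta> U)" and \<epsilon>: "0 < \<epsilon>"
  obtains m where "\<And>\<delta> w Y. 0 < \<delta> \<Longrightarrow> w \<in> lists D \<Longrightarrow> Y \<subseteq> L \<Longrightarrow> shadow S w Y \<Longrightarrow> flat S \<delta> Y \<Longrightarrow>
    \<forall>k\<in>S. \<delta> \<le> q ^ m * rho w k \<Longrightarrow>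
    real (classes_meeting L (2 * (real CARD('n) * \<delta>)) Y) \<le> \<epsilon> * Psi S w \<delta>"
proof -
  let ?d = "real CARD('n)"
  obtain C where C: "1 \<le> C" "\<And>\<delta>. 0 < \<delta> \<Longrightarrow> bounded_size (lists D) C S 1 \<delta> L (\<lambda>Y. real (covering_number Y (?d * \<delta>)))"
    using covering_number_upper[OF S order_refl] bounded_L by blast
  define T where "T = (\<lambda>(k, s). \<Sum>a | a \<in> transversal S \<and> touches k s a. weight S [a]) ` (S \<times> {0, 1})"
  define \<theta> where "\<theta> = Max T"
  have T: "finite T" "T \<noteq> {}" unfolding T_def using S(2) by auto
  have "\<theta> \<in> T" unfolding \<theta>_def using T by (rule Max_in)
  then obtain k s where ks: "k \<in> S" "s = 0 \<or> s = 1" "\<theta> = (\<Sum>a | a \<in> transversal S \<and> touches k s a. weight S [a])"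
    unfolding T_def by auto
  have \<theta>: "0 \<le> \<theta>" "\<theta> < 1"
  proof -
    show "0 \<le> \<theta>" unfolding ks(3) by (intro sum_nonneg less_imp_le weight_pos) (use transversalD in auto)
    show "\<theta> < 1" unfolding ks(3) using sum_weight_touches[OF S(1) ks(1,2)] .
  qed
  have le_\<theta>: "(\<Sum>a | a \<in> transversal S \<and> touches k s a. weight S [a]) \<le> \<theta>" if "k \<in> S" "s = 0 \<or> s = 1" for k s
    unfolding \<theta>_def using T(1) that by (intro Max_ge) (auto simp: T_def)
  define N where "N = real (card (S \<times> {0, 1 :: real}))"
  have N: "0 < N" using S(2) by (simp add: N_def card_gt_0_iff)
  obtain m where m: "\<theta> ^ m < \<epsilon> / (N * C)" using real_arch_pow_inv[of "\<epsilon> / (N * C)" \<theta>] \<theta> \<epsilon> N C by auto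
  show thesis
  proof (rule that[of m])
    fix \<delta> :: real and w Y assume as: "0 < \<delta>" "w \<in> lists D" "Y \<subseteq> L" "shadow S w Y" "flat S \<delta> Y"
      "\<forall>k\<in>S. \<delta> \<le> q ^ m * rho w k"
    let ?e = "2 * (?d * \<delta>)"
    have d\<delta>: "0 < ?d * \<delta>" using as(1) by simp
    let ?h = "\<lambda>Y. real (classes_meeting L ?e Y)"
    have le: "?h X \<le> real (covering_number X (?d * \<delta>))" if "X \<subseteq> L" for X
      using classes_meeting_le_covering_number(2)[OF bounded_subset[OF bounded_L that] that d\<delta>] by simp
    have bd: "bounded_size (lists D) C S 1 \<delta> L ?h"
      using C(2)[OF as(1)] le unfolding bounded_size_def by (meson order_trans)
    have mono: "?h X \<le> ?h Z" if "X \<subseteq> Z" "Z \<subseteq> L" for X Z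
    proof -
      have "\<exists>y\<in>Z. (x, y) \<in> chain_equiv L ?e" if "x \<in> X" for x
        using that \<open>X \<subseteq> Z\<close> \<open>Z \<subseteq> L\<close> d\<delta> by (intro bexI[of _ x] chain_equiv_step) auto
      then show ?thesis using classes_meeting_mono[OF bounded_L _ that(2), of ?e X] d\<delta> by simp
    qed
    have "?h Y \<le> (\<Sum>(k, s)\<in>S \<times> {0, 1}. ?h (Y \<inter> face w k s))"
      using classes_touch_boundary[OF no as(1,3-5,2), of ?e] d\<delta> by linarith
    also have "\<dots> \<le> (\<Sum>(k, s)\<in>S \<times> {0, 1 :: real}. \<theta> ^ m * C * Psi S w \<delta>)"
    proof (rule sum_mono, clarify)
      fix k and s :: real assume ks: "k \<in> S" "s \<in> {0, 1}"
      then have s: "s = 0 \<or> s = 1" by auto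
      show "?h (Y \<inter> face w k s) \<le> \<theta> ^ m * C * Psi S w \<delta>"
        by (rule face_decay[OF S(1) ks(1) s as(1) _ subadditive_classes_meeting mono bd le_\<theta>[OF ks(1) s] as(2-6)])
           (use C in auto)
    qed
    also have "\<dots> = N * (\<theta> ^ m * C * Psi S w \<delta>)" by (simp add: N_def case_prod_unfold)
    also have "\<dots> = (\<theta> ^ m * (N * C)) * Psi S w \<delta>" by (simp add: mult_ac)
    also have "\<dots> \<le> \<epsilon> * Psi S w \<delta>"
    proof (rule mult_right_mono)
      have "0 < N * C" using N C by simp
      then show "\<theta> ^ m * (N * C) \<le> \<epsilon>" using m by (simp add: field_simps)
    qed (use Psi_pos[OF as(2,1), of S] in simp)
    finally show "?h Y \<le> \<epsilon> * Psi S w \<delta>" .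
  qed
qed

text \<open>
  Strict inequality between the ratios makes the sides of a cylinder exponentially different in
  the length of the word.
\<close>

lemma rho_ratio:
  obtains \<sigma> where "0 < \<sigma>" "\<sigma> < 1" "\<And>w i j. w \<in> lists D \<Longrightarrow> i < j \<Longrightarrow> rho w j \<le> \<sigma> ^ length w * rho w i"
proof -
  define X where "X = insert (1/2) ((\<lambda>(a, i, j). r j (a j) / r i (a i)) ` {(a, i, j). a \<in> D \<and> i < j})"
  have "finite {(a, i :: 'n, j :: 'n). a \<in> D \<and> i < j}"
    by (rule finite_subset[of _ "D \<times> UNIV \<times> UNIV"]) auto
  then have X: "finite X" "X \<noteq> {}" by (auto simp: X_def)
  define \<sigma> where "\<sigma> = Max X"
  have "0 < x \<and> x < 1" if "x \<in> X" for x
  proof -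
    consider "x = 1 / 2" | a i j where "a \<in> D" "i < j" "x = r j (a j) / r i (a i)"
      using \<open>x \<in> X\<close> unfolding X_def by auto
    then show ?thesis
    proof cases
      case 2
      then show ?thesis using ratio_strict[OF 2(1,2)] digit_bounds(1)[OF 2(1)] by simp
    qed simp
  qed
  moreover have "\<sigma> \<in> X" unfolding \<sigma>_def by (rule Max_in[OF X])
  ultimately have \<sigma>: "0 < \<sigma>" "\<sigma> < 1" by blast+
  have "r j (a j) \<le> \<sigma> * r i (a i)" if "a \<in> D" "i < j" for a i j
  proof -
    have "r j (a j) / r i (a i) \<in> X"
      unfolding X_def by (rule insertI2, rule image_eqI[of _ _ "(a, i, j)"]) (use that in auto)
    then have "r j (a j) / r i (a i) \<le> \<sigma>" unfolding \<sigma>_def by (rule Max_ge[OF X(1)])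
    then show ?thesis using digit_bounds(1)[OF that(1), of i] by (simp add: field_simps)
  qed
  then have "rho w j \<le> \<sigma> ^ length w * rho w i" if "w \<in> lists D" "i < j" for w i j
    using that(1)
  proof (induction w)
    case (Cons a w)
    have "r j (a j) * rho w j \<le> (\<sigma> * r i (a i)) * (\<sigma> ^ length w * rho w i)"
      using Cons \<open>i < j\<close> \<sigma>(1) digit_bounds(1)[of a] rho_pos[of w]
      by (intro mult_mono) (auto simp: less_imp_le)
    then show ?case by (simp add: mult_ac)
  qed simp
  then show thesis using that \<sigma> by blast
qed

text \<open>
  If \<open>j\<close> is the last coordinate, \<open>no_island_bounded_size\<close> applies to \<open>L\<close> itself. Otherwise
  consider the moment when the coordinate after \<open>j\<close> is dropped. Its side is comparable to \<open>\<delta>\<close>,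
  so for small \<open>\<delta>\<close> the word is long and by \<open>rho_ratio\<close> the sides up to \<open>j\<close> are as long,
  compared to \<open>\<delta>\<close>, as \<open>no_island_bounded_size\<close> requires. The bound found there climbs to all
  coordinates by \<open>bounded_size_climb\<close>.
\<close>

lemma few_components:
  assumes no: "\<not> (\<exists>\<eta> U. 0 < \<eta> \<and> U \<noteq> {} \<and> island {..j} \<eta> U)" and \<epsilon>: "0 < \<epsilon>"
  shows "\<exists>\<delta>\<^sub>1>0. \<forall>\<delta>. 0 < \<delta> \<and> \<delta> < \<delta>\<^sub>1 \<longrightarrow> real (component_count L \<delta>) \<le> \<epsilon> * \<delta> powr (- dimension)"
proof -
  let ?d = "real CARD('n)" and ?S = "{..j}"
  let ?h = "\<lambda>\<delta> Y. real (classes_meeting L (2 * (?d * \<delta>)) Y)"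
  let ?\<epsilon> = "\<epsilon> / (1 / (2 * ?d)) powr (- dimension)"
  have e': "0 < ?\<epsilon>" using \<epsilon> by simp
  have ne: "?S \<noteq> {}" by auto
  have sh: "shadow UNIV [] L" "flat UNIV \<delta> L" for \<delta> by (simp_all add: shadow_def flat_def image_def)
  have "\<exists>\<delta>\<^sub>1>0. \<forall>\<delta>. 0 < \<delta> \<and> \<delta> < \<delta>\<^sub>1 \<longrightarrow> ?h \<delta> L \<le> ?\<epsilon> * Psi UNIV [] \<delta>"
  proof (cases "?S = UNIV")
    case True
    obtain m where m: "\<And>\<delta> w Y. 0 < \<delta> \<Longrightarrow> w \<in> lists D \<Longrightarrow> Y \<subseteq> L \<Longrightarrow> shadow ?S w Y \<Longrightarrow> flat ?S \<delta> Y \<Longrightarrow>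
        \<forall>k\<in>?S. \<delta> \<le> q ^ m * rho w k \<Longrightarrow> ?h \<delta> Y \<le> ?\<epsilon> * Psi ?S w \<delta>"
      using no_island_bounded_size[OF down_closed_atMost ne no e'] by metis
    show ?thesis
      using m[unfolded True, OF _ lists.Nil order_refl sh] q_bounds(1)
      by (intro exI[of _ "q ^ m"]) (auto simp: less_imp_le)
  next
    case False
    then have "?S \<subset> UNIV" by blast
    from bounded_size_climb[OF down_closed_UNIV down_closed_atMost this order_refl]
    obtain M K where MK: "1 \<le> M" "1 \<le> K" and climb: "\<And>\<delta> E h C. 0 < \<delta> \<Longrightarrow> 0 \<le> C \<Longrightarrow> subadditive_on E h \<Longrightarrow>
      bounded_size (dropped ?S M \<delta>) C ?S M \<delta> E h \<Longrightarrow> bounded_size (lists D) (C * K) UNIV 1 \<delta> E h" by metis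
    have eK: "0 < ?\<epsilon> / K" using MK by (intro divide_pos_pos e') simp
    obtain m where m: "\<And>\<delta> w Y. 0 < \<delta> \<Longrightarrow> w \<in> lists D \<Longrightarrow> Y \<subseteq> L \<Longrightarrow> shadow ?S w Y \<Longrightarrow> flat ?S \<delta> Y \<Longrightarrow>
        \<forall>k\<in>?S. \<delta> \<le> q ^ m * rho w k \<Longrightarrow> ?h \<delta> Y \<le> ?\<epsilon> / K * Psi ?S w \<delta>"
      using no_island_bounded_size[OF down_closed_atMost ne no eK] by metis
    obtain \<sigma> where \<sigma>: "0 < \<sigma>" "\<sigma> < 1" "\<And>w i j. w \<in> lists D \<Longrightarrow> i < j \<Longrightarrow> rho w j \<le> \<sigma> ^ length w * rho w i"
      using rho_ratio by metis
    have qm: "0 < q ^ m" using q_bounds(1) by simp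
    \<comment> \<open>words longer than \<open>N\<close> have sides up to \<open>j\<close> of length at least \<open>\<delta> / q ^ m\<close>\<close>
    obtain N where N: "\<sigma> ^ N < q ^ m / M" using real_arch_pow_inv[of "q ^ m / M" \<sigma>] \<sigma> qm MK by auto
    show ?thesis
    proof (intro exI[of _ "min (q ^ N) 1"] conjI allI impI)
      show "0 < min (q ^ N) 1" using q_bounds(1) by simp
      fix \<delta> assume \<delta>: "0 < \<delta> \<and> \<delta> < min (q ^ N) 1"
      have B: "bounded_size (dropped ?S M \<delta>) (?\<epsilon> / K) ?S M \<delta> L (?h \<delta>)"
        unfolding bounded_size_def
      proof (intro ballI allI impI)
        fix w Y assume w: "w \<in> dropped ?S M \<delta>" and Y: "Y \<subseteq> L" "shadow ?S w Y" "flat ?S \<delta> Y"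
        obtain b where b: "w \<in> lists D" "j < b" "rho w b \<le> \<delta>" "\<delta> \<le> M * rho w b"
          using w by (auto simp: dropped_def not_le)
        have "q ^ length w < q ^ N" using rho_lower[OF b(1), of b] b(3) \<delta> by linarith
        then have "N < length w" using q_bounds(1,2) by (simp add: power_strict_decreasing_iff)
        then have \<sigma>w: "\<sigma> ^ length w \<le> \<sigma> ^ N" using \<sigma> by (intro power_decreasing) auto
        have "\<delta> \<le> q ^ m * rho w k" if k: "k \<in> ?S" for k
        proof -
          have "k < b" using k b(2) by simp
          then have "\<delta> \<le> M * (\<sigma> ^ length w * rho w k)"
            using b(4) \<sigma>(3)[OF b(1)] MK by (meson mult_left_mono order_trans zero_le_one)
          also have "\<dots> = (M * \<sigma> ^ length w) * rho w k" by simp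
          also have "\<dots> \<le> q ^ m * rho w k"
          proof (rule mult_right_mono)
            have "\<sigma> ^ length w \<le> q ^ m / M" using \<sigma>w N by linarith
            then show "M * \<sigma> ^ length w \<le> q ^ m" using MK by (simp add: field_simps)
          qed (use rho_pos[OF b(1), of k] in simp)
          finally show ?thesis .
        qed
        then show "?h \<delta> Y \<le> ?\<epsilon> / K * Psi ?S w \<delta>" using m \<delta> b(1) Y by blast
      qed
      have "bounded_size (lists D) (?\<epsilon> / K * K) UNIV 1 \<delta> L (?h \<delta>)"
        by (rule climb[OF _ less_imp_le[OF eK] subadditive_classes_meeting B]) (use \<delta> in simp)
      from this[unfolded bounded_size_def, rule_format, OF lists.Nil order_refl _ sh]
      have "?h \<delta> L \<le> ?\<epsilon> / K * K * Psi UNIV [] \<delta>" using \<delta> by simp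
      then show "?h \<delta> L \<le> ?\<epsilon> * Psi UNIV [] \<delta>" using MK by simp
    qed
  qed
  then obtain \<delta>\<^sub>1 where \<delta>1: "0 < \<delta>\<^sub>1" "\<And>\<delta>. 0 < \<delta> \<Longrightarrow> \<delta> < \<delta>\<^sub>1 \<Longrightarrow> ?h \<delta> L \<le> ?\<epsilon> * Psi UNIV [] \<delta>" by blast
  show ?thesis
  proof (intro exI[of _ "2 * ?d * \<delta>\<^sub>1"] conjI allI impI)
    show "0 < 2 * ?d * \<delta>\<^sub>1" using \<delta>1 by simp
    fix \<delta> assume \<delta>: "0 < \<delta> \<and> \<delta> < 2 * ?d * \<delta>\<^sub>1"
    let ?\<delta> = "1 / (2 * ?d) * \<delta>"
    have "0 < ?\<delta>" "?\<delta> < \<delta>\<^sub>1" using \<delta> by (auto simp: field_simps)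
    then have "?h ?\<delta> L \<le> ?\<epsilon> * Psi UNIV [] ?\<delta>" by (rule \<delta>1(2))
    moreover have "Psi UNIV [] ?\<delta> = (1 / (2 * ?d)) powr (- dimension) * \<delta> powr (- dimension)"
      using Psi_UNIV_scale[of "[]" "1 / (2 * ?d)" \<delta>] \<delta> by (simp add: weight_def)
    moreover have "?\<epsilon> * ((1 / (2 * ?d)) powr (- dimension) * \<delta> powr (- dimension)) = \<epsilon> * \<delta> powr (- dimension)"
      by simp
    moreover have "2 * (?d * ?\<delta>) = \<delta>" by simp
    ultimately show "real (component_count L \<delta>) \<le> \<epsilon> * \<delta> powr (- dimension)"
      unfolding component_count_eq by metis
  qed
qed

lemma islands_if_maximal_power_law:
  assumes "maximal_power_law L"
  shows has_islands
proof (rule ccontr)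
  assume "\<not> has_islands"
  then obtain j where no: "\<not> (\<exists>\<eta> U. 0 < \<eta> \<and> U \<noteq> {} \<and> island {..j} \<eta> U)" unfolding has_islands_def by blast
  have "(\<lambda>\<delta>. \<delta> powr (- dimension)) \<in> O[at_right 0](\<lambda>\<delta>. real (component_count L \<delta>))"
    using assms unfolding maximal_power_law_def box_dim_L bigtheta_def bigomega_iff_bigo[symmetric] by blast
  then obtain c where c: "0 < c" "eventually (\<lambda>\<delta>. norm (\<delta> powr (- dimension)) \<le> c * norm (real (component_count L \<delta>))) (at_right 0)"
    by (rule landau_o.bigE)
  obtain \<delta>\<^sub>1 where \<delta>1: "0 < \<delta>\<^sub>1" "\<And>\<delta>. 0 < \<delta> \<and> \<delta> < \<delta>\<^sub>1 \<Longrightarrow> real (component_count L \<delta>) \<le> 1 / (2 * c) * \<delta> powr (- dimension)"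
    using few_components[OF no, of "1 / (2 * c)"] c(1) by auto
  have "eventually (\<lambda>\<delta>. 0 < \<delta> \<and> \<delta> < \<delta>\<^sub>1) (at_right 0)"
    unfolding eventually_at_right_field using \<delta>1(1) by (intro exI[of _ "\<delta>\<^sub>1"]) auto
  with c(2) have "eventually (\<lambda>\<delta>. False) (at_right (0::real))"
  proof eventually_elim
    case (elim \<delta>)
    have p: "0 < \<delta> powr (- dimension)" using elim(2) by simp
    have "\<delta> powr (- dimension) \<le> c * real (component_count L \<delta>)" using elim(1) by simp
    also have "\<dots> \<le> c * (1 / (2 * c) * \<delta> powr (- dimension))"
      by (intro mult_left_mono \<delta>1(2) elim(2)) (use c(1) in simp)
    also have "\<dots> = \<delta> powr (- dimension) / 2" using c(1) by simp
    finally show False using p by simp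
  qed
  then show False by simp
qed

end

section \<open>The equivalence\<close>

context Bernoulli_sponge
begin

lemma component_counting_measure_if_islands:
  assumes has_islands
  shows "component_counting_measure r t D L \<mu>"
proof -
  obtain \<kappa> where \<kappa>: "0 < \<kappa>" "\<And>w. w \<in> lists D \<Longrightarrow> \<exists>\<delta>\<^sub>0>0. \<forall>\<delta>. 0 < \<delta> \<and> \<delta> < \<delta>\<^sub>0 \<longrightarrow>
      \<kappa> * (weight UNIV w * \<delta> powr (- dimension)) \<le> real (component_count (phi w ` L) \<delta>)"
    using component_count_cylinder_lower[OF assms] by metis
  obtain C where C: "0 < C" "\<And>w. w \<in> lists D \<Longrightarrow> \<exists>\<delta>\<^sub>0>0. \<forall>\<delta>. 0 < \<delta> \<and> \<delta> < \<delta>\<^sub>0 \<longrightarrow>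
      real (component_count (phi w ` L) \<delta>) \<le> C * (weight UNIV w * \<delta> powr (- dimension))"
    using component_count_cylinder_upper by metis
  define M where "M = max 1 (max C (1 / \<kappa>))"
  have M: "1 \<le> M" "C \<le> M" "inverse M \<le> \<kappa>"
  proof -
    show "1 \<le> M" "C \<le> M" by (auto simp: M_def)
    have "1 / \<kappa> \<le> M" by (auto simp: M_def)
    then have "inverse M \<le> inverse (1 / \<kappa>)" using \<kappa>(1) by (intro le_imp_inverse_le) auto
    then show "inverse M \<le> \<kappa>" by simp
  qed
  have "\<exists>\<delta>\<^sub>0>0. \<forall>\<delta>. 0 < \<delta> \<and> \<delta> < \<delta>\<^sub>0 \<longrightarrow>
    inverse M * measure \<mu> R * \<delta> powr (- box_dim L) \<le> real (component_count R \<delta>) \<and>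
    real (component_count R \<delta>) \<le> M * measure \<mu> R * \<delta> powr (- box_dim L)"
    if R: "R \<in> cylinders r t D L" for R
  proof -
    obtain w where w: "w \<in> lists D" "R = phi w ` L" using R by (auto simp: cylinders_def phi_def)
    obtain d1 where d1: "d1 > 0" "\<And>\<delta>. 0 < \<delta> \<and> \<delta> < d1 \<Longrightarrow>
      \<kappa> * (weight UNIV w * \<delta> powr (- dimension)) \<le> real (component_count R \<delta>)" using \<kappa>(2)[OF w(1)] w(2) by blast
    obtain d2 where d2: "d2 > 0" "\<And>\<delta>. 0 < \<delta> \<and> \<delta> < d2 \<Longrightarrow>
      real (component_count R \<delta>) \<le> C * (weight UNIV w * \<delta> powr (- dimension))" using C(2)[OF w(1)] w(2) by blast
    have mR: "measure \<mu> R = weight UNIV w" using measure_cylinder[OF w(1)] w(2) by simp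
    show ?thesis
    proof (intro exI[of _ "min d1 d2"] conjI allI impI)
      show "0 < min d1 d2" using d1 d2 by simp
      fix \<delta> assume \<delta>: "0 < \<delta> \<and> \<delta> < min d1 d2"
      have x: "0 \<le> weight UNIV w * \<delta> powr (- dimension)" using weight_pos[OF w(1), of UNIV] by simp
      show "inverse M * measure \<mu> R * \<delta> powr (- box_dim L) \<le> real (component_count R \<delta>)"
        using mult_right_mono[OF M(3) x] d1(2)[of \<delta>] \<delta> by (simp add: box_dim_L mR mult.assoc)
      show "real (component_count R \<delta>) \<le> M * measure \<mu> R * \<delta> powr (- box_dim L)"
        using mult_right_mono[OF M(2) x] d2(2)[of \<delta>] \<delta> by (simp add: box_dim_L mR mult.assoc)
    qed
  qed
  moreover have "emeasure \<mu> (- L) = 0" using null_complement by (simp add: null_sets_def)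
  ultimately show ?thesis
    unfolding component_counting_measure_def using finite_measure_axioms sets_\<mu> M(1) by blast
qed

lemma maximal_power_law_if_component_counting_measure:
  assumes "component_counting_measure r t D L \<mu>"
  shows "maximal_power_law L"
proof -
  have "L \<in> cylinders r t D L" unfolding cylinders_def by (intro CollectI exI[of _ "[]"]) (simp add: image_def)
  moreover have "measure \<mu> L = 1" using measure_cylinder[of "[]"] by (simp add: weight_def image_def)
  ultimately obtain M \<delta>\<^sub>0 where M: "1 \<le> M" "0 < \<delta>\<^sub>0" and b: "\<And>\<delta>. 0 < \<delta> \<and> \<delta> < \<delta>\<^sub>0 \<Longrightarrow>
    inverse M * \<delta> powr (- box_dim L) \<le> real (component_count L \<delta>) \<and>
    real (component_count L \<delta>) \<le> M * \<delta> powr (- box_dim L)"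
    using assms unfolding component_counting_measure_def by (metis mult.right_neutral)
  have ev: "eventually (\<lambda>\<delta>. 0 < \<delta> \<and> \<delta> < \<delta>\<^sub>0) (at_right 0)"
    unfolding eventually_at_right_field using M by (intro exI[of _ "\<delta>\<^sub>0"]) auto
  show ?thesis
    unfolding maximal_power_law_def
  proof (rule bigthetaI)
    show "(\<lambda>\<delta>. real (component_count L \<delta>)) \<in> O[at_right 0](\<lambda>\<delta>. \<delta> powr (- box_dim L))"
      by (rule bigoI[where c = M], rule eventually_mono[OF ev]) (use b in auto)
    show "(\<lambda>\<delta>. real (component_count L \<delta>)) \<in> \<Omega>[at_right 0](\<lambda>\<delta>. \<delta> powr (- box_dim L))"
      unfolding bigomega_iff_bigo
      by (rule bigoI[where c = M], rule eventually_mono[OF ev]) (use b M in \<open>auto simp: field_simps\<close>)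
  qed
qed

end

theorem theorem1p2:
  fixes n :: "'n::{finite,linorder} \<Rightarrow> nat"
    and r t :: "'n \<Rightarrow> nat \<Rightarrow> real"
    and D :: "('n \<Rightarrow> nat) set"
    and L :: "(real ^ 'n::{finite,linorder}) set"
    and \<mu> :: "(real ^ 'n::{finite,linorder}) measure"
  assumes "diagonal_ifs n r t D"
    and "is_attractor r t D L"
    and "lalley_gatzouras r t D"
    and "nondegenerated L"
    and "canonical_Bernoulli_measure r t D \<mu>"
  shows "(component_counting_measure r t D L \<mu> \<longleftrightarrow> maximal_power_law L) \<and>
    (maximal_power_law L \<longleftrightarrow> (\<forall>j. open_cube j \<inter> trivial_points (coord_proj j ` L) \<noteq> {})) \<and>
    ((\<forall>j. open_cube j \<inter> trivial_points (coord_proj j ` L) \<noteq> {}) \<longleftrightarrow>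
      (\<forall>j. coord_proj j ` L \<subseteq> closure (trivial_points (coord_proj j ` L))))"
proof -
  obtain \<beta> where \<mu>: "prob_space \<mu>" "sets \<mu> = sets borel" and \<beta>: "canonical_exponents r D \<beta>" and
    sim: "\<And>B. B \<in> sets borel \<Longrightarrow> measure \<mu> B =
      (\<Sum>a\<in>D. (\<Prod>k\<in>UNIV. r k (a k) powr \<beta> k) * measure \<mu> (sponge_map r t a -` B))"
    using assms(5) unfolding canonical_Bernoulli_measure_def by blast
  interpret LG_sponge n r t D L \<beta>
    by unfold_locales (use assms \<beta> in auto)
  interpret prob_space \<mu> by (rule \<mu>(1))
  interpret Bernoulli_sponge n r t D L \<beta> \<mu>
    by unfold_locales (use \<mu> sim in \<open>auto simp: weight_single\<close>)
  have islands: "has_islands \<longleftrightarrow> (\<forall>j. open_cube j \<inter> trivial_points (coord_proj j ` L) \<noteq> {})"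
    unfolding has_islands_def coord_proj_eq_proj trivial_point_iff_island ..
  have dense: "(\<forall>j. open_cube j \<inter> trivial_points (coord_proj j ` L) \<noteq> {}) \<longleftrightarrow>
      (\<forall>j. coord_proj j ` L \<subseteq> closure (trivial_points (coord_proj j ` L)))"
    unfolding coord_proj_eq_proj trivial_points_dense_iff ..
  show ?thesis
    using component_counting_measure_if_islands maximal_power_law_if_component_counting_measure
      islands_if_maximal_power_law islands dense by blast
qed

end
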